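(* Suppose $(M,g_M)$ is a closed Riemannian manifold and $(N,g_N) := \mathbf{S}^1 \times (M,g_M)$ is its Riemannian product with a unit circle. Let $u_i : N \to [-1,1]$ be double-well phase transitions for a double-well potential $W$ and parameters $\varepsilon_i \searrow 0$, and suppose that $$\lim_{i\to\infty} \{u_i = 0\} = \{\theta_1,\ldots,\theta_m\} \times M =: \Sigma \quad \text{in the Hausdorff sense,}$$ where $\theta_1,\ldots,\theta_m \in \mathbf{S}^1$ are distinct. Then: (a) $\lim_{i\to\infty} u_i = \pm 1$ locally uniformly on $N \setminus \Sigma$, with the $\pm$ sign necessarily alternating across each component of $\Sigma$ (thus, $m$ is even). (b) $\Sigma$ is invariant under a rotation by $\tfrac{2\pi}{m}$ radians along the $\mathbf{S}^1$ fiber.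
   Context: A function $W \in C^\infty(\mathbf{R};\mathbf{R})$ is a double-well potential if: (1) $W(x) \geq 0$ for all $x$, with equality if and only if $x = \pm 1$; (2) $W(x) = W(-x)$ for all $x$; (3) $W''(\pm 1) > 0$; (4) $W'(x)/x$ is increasing for $x \in (0,1)$ and decreasing for $x \in (-1,0)$. Given a closed Riemannian manifold $(N,g_N)$, a double-well potential $W$ and $\varepsilon > 0$, a double-well phase transition on $N$ for the potential $W$ with parameter $\varepsilon$ is a function $u \in C^\infty(N;[-1,1])$ that is a critical point of $$E_\varepsilon(u) := \int_N \Big( \tfrac12 \varepsilon |\nabla_{g_N} u|^2 + \varepsilon^{-1} W(u) \Big)\, d\mu_{g_N},$$ equivalently $\varepsilon^2 \Delta_{g_N} u = W'(u)$ on $N$. Convergence "in the Hausdorff sense" means convergence to $0$ of the Hausdorff distance in $(N,g_N)$ between the closed sets.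
   Formalization: In (a) the limit is taken after multiplying each u_i by a sign s_i (one per component of M), since for u_i = (-1)^i v_i the limit of u_i itself does not exist; "increasing"/"decreasing" in (4) are read strictly, and M has positive dimension. *)

theory Defs
  imports "HOL-Analysis.Analysis"
begin

section \<open>Smooth maps on open subsets of Euclidean spaces\<close>

fun Ck_on :: "nat \<Rightarrow> 'e::real_normed_vector set \<Rightarrow> ('e \<Rightarrow> 'f::real_normed_vector) \<Rightarrow> bool" where
  "Ck_on 0 S f \<longleftrightarrow> continuous_on S f"
| "Ck_on (Suc k) S f \<longleftrightarrow>
     (\<forall>x\<in>S. f differentiable (at x)) \<and>
     (\<forall>v. Ck_on k S (\<lambda>x. frechet_derivative f (at x) v))"

definition smooth_on :: "'e::real_normed_vector set \<Rightarrow> ('e \<Rightarrow> 'f::real_normed_vector) \<Rightarrow> bool" where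
  "smooth_on S f \<longleftrightarrow> (\<forall>k. Ck_on k S f)"


section \<open>Riemannian manifolds\<close>

text \<open>
  A Riemannian manifold is a topology together with an atlas. Every chart carries the
  coordinate expression of the metric: \<open>cmetric c y v w\<close> is
  $\sum_{ij} g_{ij}(y) v^i w^j$ at the coordinate point \<open>y\<close> of the image of the chart \<open>c\<close>.
  The values of \<open>coord c\<close> outside \<open>cdom c\<close>, and of \<open>cmetric c\<close> outside the image, are irrelevant.
\<close>

record ('a, 'e) rchart =
  cdom :: "'a set"
  coord :: "'a \<Rightarrow> 'e"
  cmetric :: "'e \<Rightarrow> 'e \<Rightarrow> 'e \<Rightarrow> real"

record ('a, 'e) rmanifold =
  mtop :: "'a topology"
  atlas :: "('a, 'e) rchart set"

abbreviation points :: "('a, 'e) rmanifold \<Rightarrow> 'a set" where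
  "points M \<equiv> topspace (mtop M)"

definition cimage :: "('a, 'e) rchart \<Rightarrow> 'e set" where
  "cimage c = coord c ` cdom c"

definition param :: "('a, 'e) rchart \<Rightarrow> 'e \<Rightarrow> 'a" where
  "param c = inv_into (cdom c) (coord c)"

definition is_chart :: "'a topology \<Rightarrow> ('a, 'e::euclidean_space) rchart \<Rightarrow> bool" where
  "is_chart X c \<longleftrightarrow>
     openin X (cdom c) \<and> open (cimage c) \<and>
     homeomorphic_map (subtopology X (cdom c)) (top_of_set (cimage c)) (coord c)"

definition metric_on_chart :: "('a, 'e::euclidean_space) rchart \<Rightarrow> bool" where
  "metric_on_chart c \<longleftrightarrow>
     (\<forall>v w. smooth_on (cimage c) (\<lambda>y. cmetric c y v w)) \<and>
     (\<forall>y\<in>cimage c. bilinear (cmetric c y) \<and>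
        (\<forall>v w. cmetric c y v w = cmetric c y w v) \<and>
        (\<forall>v. v \<noteq> 0 \<longrightarrow> cmetric c y v v > 0))"

definition compatible :: "('a, 'e::euclidean_space) rchart \<Rightarrow> ('a, 'e) rchart \<Rightarrow> bool" where
  "compatible c d \<longleftrightarrow>
     (let S = coord c ` (cdom c \<inter> cdom d); T = coord d \<circ> param c in
        smooth_on S T \<and>
        (\<forall>y\<in>S. \<forall>v w. cmetric c y v w =
           cmetric d (T y) (frechet_derivative T (at y) v) (frechet_derivative T (at y) w)))"

definition riemannian_manifold :: "('a, 'e::euclidean_space) rmanifold \<Rightarrow> bool" where
  "riemannian_manifold M \<longleftrightarrow>
     points M \<noteq> {} \<and> Hausdorff_space (mtop M) \<and> second_countable (mtop M) \<and>
     (\<Union>c\<in>atlas M. cdom c) = points M \<and>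
     (\<forall>c\<in>atlas M. is_chart (mtop M) c \<and> metric_on_chart c) \<and>
     (\<forall>c\<in>atlas M. \<forall>d\<in>atlas M. compatible c d)"

text \<open>Charts are onto open sets, so there is no boundary and closed just means compact.\<close>

definition closed_riemannian_manifold :: "('a, 'e::euclidean_space) rmanifold \<Rightarrow> bool" where
  "closed_riemannian_manifold M \<longleftrightarrow> riemannian_manifold M \<and> compact_space (mtop M)"

definition smooth_function :: "('a, 'e::euclidean_space) rmanifold \<Rightarrow> ('a \<Rightarrow> real) \<Rightarrow> bool" where
  "smooth_function M u \<longleftrightarrow> (\<forall>c\<in>atlas M. smooth_on (cimage c) (u \<circ> param c))"

text \<open>Quantities that do not depend on the chart are computed in an arbitrary chart at the point.\<close>

definition chart_at :: "('a, 'e) rmanifold \<Rightarrow> 'a \<Rightarrow> ('a, 'e) rchart" where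
  "chart_at M p = (SOME c. c \<in> atlas M \<and> p \<in> cdom c)"

definition grad_coord :: "('a, 'e::euclidean_space) rchart \<Rightarrow> ('a \<Rightarrow> real) \<Rightarrow> 'a \<Rightarrow> 'e" where
  "grad_coord c u p =
     (THE v. \<forall>w. cmetric c (coord c p) v w = frechet_derivative (u \<circ> param c) (at (coord c p)) w)"

definition grad_norm_sq :: "('a, 'e::euclidean_space) rmanifold \<Rightarrow> ('a \<Rightarrow> real) \<Rightarrow> 'a \<Rightarrow> real" where
  "grad_norm_sq M u p =
     (let c = chart_at M p; v = grad_coord c u p in cmetric c (coord c p) v v)"


subsection \<open>Riemannian volume\<close>

text \<open>The determinant (Leibniz formula) of the matrix of a bilinear form in the standard basis.\<close>

definition gram_det :: "('e::euclidean_space \<Rightarrow> 'e \<Rightarrow> real) \<Rightarrow> real" where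
  "gram_det g = (\<Sum>p | p permutes (Basis :: 'e set). of_int (sign p) * (\<Prod>b\<in>Basis. g b (p b)))"

definition is_volume_measure :: "('a, 'e::euclidean_space) rmanifold \<Rightarrow> 'a measure \<Rightarrow> bool" where
  "is_volume_measure M \<mu> \<longleftrightarrow>
     space \<mu> = points M \<and> sets \<mu> = sigma_sets (points M) {U. openin (mtop M) U} \<and>
     (\<forall>c\<in>atlas M. \<forall>A\<in>sets \<mu>. A \<subseteq> cdom c \<longrightarrow>
        emeasure \<mu> A =
          (\<integral>\<^sup>+ y\<in>coord c ` A. ennreal (sqrt (gram_det (cmetric c y))) \<partial>lborel))"

definition volume_measure :: "('a, 'e::euclidean_space) rmanifold \<Rightarrow> 'a measure" where
  "volume_measure M = (THE \<mu>. is_volume_measure M \<mu>)"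


subsection \<open>Riemannian distance and Hausdorff distance\<close>

definition piecewise_C1_curve :: "('a, 'e::euclidean_space) rmanifold \<Rightarrow> (real \<Rightarrow> 'a) \<Rightarrow> bool" where
  "piecewise_C1_curve M \<gamma> \<longleftrightarrow>
     continuous_map (top_of_set {0..1}) (mtop M) \<gamma> \<and>
     (\<forall>c\<in>atlas M. \<forall>a b. 0 \<le> a \<and> a \<le> b \<and> b \<le> 1 \<and> \<gamma> ` {a..b} \<subseteq> cdom c \<longrightarrow>
        (coord c \<circ> \<gamma>) piecewise_C1_differentiable_on {a..b})"

definition speed :: "('a, 'e::euclidean_space) rmanifold \<Rightarrow> (real \<Rightarrow> 'a) \<Rightarrow> real \<Rightarrow> real" where
  "speed M \<gamma> t =
     (let c = chart_at M (\<gamma> t); v = vector_derivative (coord c \<circ> \<gamma>) (at t)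
      in sqrt (cmetric c (coord c (\<gamma> t)) v v))"

definition curve_length :: "('a, 'e::euclidean_space) rmanifold \<Rightarrow> (real \<Rightarrow> 'a) \<Rightarrow> ennreal" where
  "curve_length M \<gamma> = (\<integral>\<^sup>+ t\<in>{0..1}. ennreal (speed M \<gamma> t) \<partial>lborel)"

text \<open>The distance is \<open>\<infinity>\<close> between points in different components.\<close>

definition riemannian_dist :: "('a, 'e::euclidean_space) rmanifold \<Rightarrow> 'a \<Rightarrow> 'a \<Rightarrow> ennreal" where
  "riemannian_dist M p q =
     Inf {curve_length M \<gamma> |\<gamma>. piecewise_C1_curve M \<gamma> \<and> \<gamma> 0 = p \<and> \<gamma> 1 = q}"

definition hausdorff_distance :: "('a \<Rightarrow> 'a \<Rightarrow> ennreal) \<Rightarrow> 'a set \<Rightarrow> 'a set \<Rightarrow> ennreal" where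
  "hausdorff_distance d A B = max (SUP a\<in>A. INF b\<in>B. d a b) (SUP b\<in>B. INF a\<in>A. d a b)"

definition hausdorff_limit ::
    "('a, 'e::euclidean_space) rmanifold \<Rightarrow> (nat \<Rightarrow> 'a set) \<Rightarrow> 'a set \<Rightarrow> bool" where
  "hausdorff_limit M A B \<longleftrightarrow> (\<lambda>i. hausdorff_distance (riemannian_dist M) (A i) B) \<longlonglongrightarrow> 0"


subsection \<open>Products and the unit circle\<close>

definition product_chart :: "('a, 'e) rchart \<Rightarrow> ('b, 'f) rchart \<Rightarrow> ('a \<times> 'b, 'e \<times> 'f) rchart" where
  "product_chart c d =
     \<lparr> cdom = cdom c \<times> cdom d,
       coord = (\<lambda>(p, q). (coord c p, coord d q)),
       cmetric = (\<lambda>(x, y) (v, v') (w, w'). cmetric c x v w + cmetric d y v' w') \<rparr>"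

definition riemannian_product ::
    "('a, 'e) rmanifold \<Rightarrow> ('b, 'f) rmanifold \<Rightarrow> ('a \<times> 'b, 'e \<times> 'f) rmanifold" where
  "riemannian_product M N =
     \<lparr> mtop = prod_topology (mtop M) (mtop N),
       atlas = {product_chart c d |c d. c \<in> atlas M \<and> d \<in> atlas N} \<rparr>"

text \<open>
  The angle chart on the unit circle minus \<open>cis a\<close>, with values in the interval from \<open>a\<close> to
  \<open>a + 2 * pi\<close>; it is inverse to \<open>cis\<close>, and the metric is $d\theta^2$.
\<close>

definition angle_chart :: "real \<Rightarrow> (complex, real) rchart" where
  "angle_chart a =
     \<lparr> cdom = sphere 0 1 - {cis a},
       coord = (\<lambda>z. a + Arg2pi (z * cis (- a))),
       cmetric = (\<lambda>_ v w. v * w) \<rparr>"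

definition unit_circle :: "(complex, real) rmanifold" where
  "unit_circle = \<lparr> mtop = top_of_set (sphere 0 1), atlas = range angle_chart \<rparr>"


section \<open>Double-well phase transitions\<close>

text \<open>Increasing and decreasing are read strictly.\<close>

definition double_well :: "(real \<Rightarrow> real) \<Rightarrow> bool" where
  "double_well W \<longleftrightarrow>
     smooth_on UNIV W \<and>
     (\<forall>x. W x \<ge> 0) \<and> (\<forall>x. W x = 0 \<longleftrightarrow> x = 1 \<or> x = -1) \<and>
     (\<forall>x. W x = W (- x)) \<and>
     deriv (deriv W) 1 > 0 \<and> deriv (deriv W) (-1) > 0 \<and>
     strict_mono_on {0<..<1} (\<lambda>x. deriv W x / x) \<and>
     strict_antimono_on {-1<..<0} (\<lambda>x. deriv W x / x)"

definition energy ::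
    "('a, 'e::euclidean_space) rmanifold \<Rightarrow> (real \<Rightarrow> real) \<Rightarrow> real \<Rightarrow> ('a \<Rightarrow> real) \<Rightarrow> real" where
  "energy N W \<epsilon> u =
     (\<integral>p. (1/2 * \<epsilon> * grad_norm_sq N u p + inverse \<epsilon> * W (u p)) \<partial>volume_measure N)"

definition critical_point ::
    "('a, 'e::euclidean_space) rmanifold \<Rightarrow> (real \<Rightarrow> real) \<Rightarrow> real \<Rightarrow> ('a \<Rightarrow> real) \<Rightarrow> bool" where
  "critical_point N W \<epsilon> u \<longleftrightarrow>
     (\<forall>\<phi>. smooth_function N \<phi> \<longrightarrow>
        ((\<lambda>t. energy N W \<epsilon> (\<lambda>p. u p + t * \<phi> p)) has_real_derivative 0) (at 0))"

definition phase_transition ::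
    "('a, 'e::euclidean_space) rmanifold \<Rightarrow> (real \<Rightarrow> real) \<Rightarrow> real \<Rightarrow> ('a \<Rightarrow> real) \<Rightarrow> bool" where
  "phase_transition N W \<epsilon> u \<longleftrightarrow>
     smooth_function N u \<and> (\<forall>p\<in>points N. u p \<in> {-1..1}) \<and> critical_point N W \<epsilon> u"


section \<open>Locally uniform convergence and alternating signs\<close>

definition locally_uniform_limit ::
    "'a topology \<Rightarrow> (nat \<Rightarrow> 'a \<Rightarrow> real) \<Rightarrow> ('a \<Rightarrow> real) \<Rightarrow> bool" where
  "locally_uniform_limit X f l \<longleftrightarrow>
     (\<forall>p\<in>topspace X. \<exists>U. openin X U \<and> p \<in> U \<and> uniform_limit U f l sequentially)"

text \<open>A locally constant choice of sign.\<close>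

definition sign_function :: "'a topology \<Rightarrow> ('a \<Rightarrow> real) \<Rightarrow> bool" where
  "sign_function X s \<longleftrightarrow>
     continuous_map X euclideanreal s \<and> (\<forall>p\<in>topspace X. s p = 1 \<or> s p = -1)"

text \<open>The two sides of the slice of \<open>z\<close> near \<open>(z, x)\<close> are reached by rotating \<open>z\<close> by \<open>\<plusminus>t\<close>.\<close>

definition changes_sign_across :: "complex \<Rightarrow> 'a set \<Rightarrow> (complex \<times> 'a \<Rightarrow> real) \<Rightarrow> bool" where
  "changes_sign_across z A \<sigma> \<longleftrightarrow>
     (\<forall>x\<in>A. \<exists>\<delta>>0. \<forall>t. 0 < t \<and> t < \<delta> \<longrightarrow> \<sigma> (z * cis t, x) = - \<sigma> (z * cis (- t), x))"

end

theory Submission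
  imports Defs
begin

text \<open>
  Put \<open>w = W'\<close>. Lifted to \<open>\<real> \<times> M\<close>, a phase transition solves
  \<open>\<partial>\<^sub>\<theta>\<^sup>2 u + \<Delta>\<^sub>M u = w u / \<epsilon>\<^sup>2\<close>. Since \<open>w x / x\<close> is strictly increasing on \<open>(0, 1)\<close>, a solution that is
  positive on a slab dominates every subsolution that is nonpositive at the ends of the slab: a
  maximum greater than \<open>1\<close> of the quotient would violate the maximum principle.

  Let \<open>c\<close> be the right-most position of a zero near a limit slice, with \<open>u > 0\<close> to the right of it. If
  \<open>u \<ge> 0\<close> on a slice in the mirror image of the positive region, comparing \<open>u\<close> with its odd reflections
  in slices moving down to \<open>c\<close> gives \<open>u \<theta> + u (2 * c - \<theta>) \<ge> 0\<close>. This sum solves a linear equation and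
  is bounded below by a multiple of \<open>cosh\<close>, so \<open>u > 0\<close> on the slice \<open>c\<close>, a contradiction. Hence the
  sign alternates. If the gap to the left of a limit slice were shorter than the one to its right, the
  mirror image of the right gap would reach past the left gap into the next region where \<open>u > 0\<close>. So the
  gaps are nonincreasing; being periodic, they are all equal to \<open>2 * pi / m\<close>. Signs and gaps have
  the common period \<open>m\<close>, which makes \<open>m\<close> even. Finally, for small \<open>\<epsilon>\<close> a cosine arch of amplitude
  close to \<open>1\<close> over a short interval is a subsolution, which forces \<open>\<bar>u\<bar> \<longlonglongrightarrow> 1\<close> away from the limit slices.
\<close>

text \<open>\<open>M\<close> may be disconnected, and sign information does not pass between its
  components. Every comparison therefore runs over a clopen \<open>Q\<close>, which has no boundary
  to control, and the limiting sign is normalised at each point of \<open>M\<close> separately.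
  About half of the work is to turn criticality of the energy, an integral against a measure given
  only by a description, into a pointwise equation. That equation is expanded along a basis that is
  orthonormal at one point only. The Laplacian there becomes a sum of one-variable second
  derivatives plus drift, so second derivative tests along curves suffice. The circle factor adds no
  first-order term, hence reflections in \<open>\<theta>\<close> send solutions to solutions. The
  mirror cannot stand at the zero slice \<open>c\<close> itself, because positivity fails there. It
  stands at \<open>c + \<eta>\<close>, and letting \<open>\<eta>\<close> tend to \<open>0\<close>
  loses strictness; the second, linear comparison recovers it. The right-most zero is taken because
  only to the right of it is the sign known all the way to the vicinity of the next slice.\<close>

declare Ck_on.simps(2) [simp del]

section \<open>Calculus of \<open>Ck_on\<close>: locality, algebraic operations and
  composition\<close>

lemma Ck_on_cong_imp:
  fixes f g :: "'a::real_normed_vector \<Rightarrow> 'b::real_normed_vector"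
  assumes "open S" "\<forall>x\<in>S. f x = g x" "Ck_on k S f"
  shows "Ck_on k S g"
  using assms(2,3)
proof (induction k arbitrary: f g)
  case 0
  then show ?case using continuous_on_cong by fastforce
next
  case (Suc k)
  \<comment> \<open>\<open>S\<close> is open, so \<open>f\<close> and \<open>g\<close> agree near
    \<open>x\<close> and share their derivative there.\<close>
  have d: "(g has_derivative frechet_derivative f (at x)) (at x)" if "x \<in> S" for x
    using Suc.prems that has_derivative_transform_within_open[OF _ assms(1) that]
    by (metis Ck_on.simps(2) frechet_derivative_works)
  have "frechet_derivative g (at x) = frechet_derivative f (at x)" if "x \<in> S" for x
    using frechet_derivative_at[OF d[OF that]] by simp
  then have e: "\<forall>x\<in>S. frechet_derivative f (at x) v = frechet_derivative g (at x) v" for v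
    by metis
  have "Ck_on k S (\<lambda>x. frechet_derivative f (at x) v)" for v
    using Suc.prems(2) unfolding Ck_on.simps(2) by blast
  from Suc.IH[OF e this] have "Ck_on k S (\<lambda>x. frechet_derivative g (at x) v)" for v .
  then show ?case using d unfolding Ck_on.simps(2) differentiable_def by blast
qed

text \<open>Lets an explicit derivative \<open>f'\<close> stand in for
  \<open>frechet_derivative\<close>; the two agree on the open set \<open>S\<close>, which is enough
  for the lower orders.\<close>

lemma Ck_on_SucI:
  assumes "open S" "\<And>x. x \<in> S \<Longrightarrow> (f has_derivative f' x) (at x)" "\<And>v. Ck_on k S (\<lambda>x. f' x v)"
  shows "Ck_on (Suc k) S f"
proof -
  have "frechet_derivative f (at x) = f' x" if "x \<in> S" for x
    using frechet_derivative_at[OF assms(2)[OF that]] by simp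
  then have e: "\<forall>x\<in>S. f' x v = frechet_derivative f (at x) v" for v
    by metis
  from Ck_on_cong_imp[OF assms(1) e assms(3)]
  show ?thesis using assms(2) unfolding Ck_on.simps(2) differentiable_def by blast
qed

lemma Ck_on_SucD:
  assumes "Ck_on (Suc k) S f"
  shows "x \<in> S \<Longrightarrow> (f has_derivative frechet_derivative f (at x)) (at x)"
    and "Ck_on k S (\<lambda>x. frechet_derivative f (at x) v)"
  using assms by (auto simp: frechet_derivative_works Ck_on.simps(2))

lemma Ck_on_Suc_imp: "Ck_on (Suc k) S f \<Longrightarrow> Ck_on k S f"
proof (induction k arbitrary: f)
  case 0
  then show ?case
    by (auto intro!: continuous_at_imp_continuous_on differentiable_imp_continuous_within simp: Ck_on.simps(2))
next
  case (Suc k)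
  then show ?case by (metis Ck_on.simps(2))
qed

lemma Ck_on_le: "Ck_on k S f \<Longrightarrow> j \<le> k \<Longrightarrow> Ck_on j S f"
  by (rule inc_induct[of j k "\<lambda>j. Ck_on j S f"]) (auto dest: Ck_on_Suc_imp)

lemma Ck_on_imp_continuous_on: "Ck_on k S f \<Longrightarrow> continuous_on S f"
  using Ck_on_le[of k S f 0] by simp

text \<open>Used where an explicit formula is available only near each point, as for angle
  transitions and for bumps seen from another chart.\<close>

lemma Ck_on_locally:
  fixes f :: "'a::real_normed_vector \<Rightarrow> 'b::real_normed_vector"
  assumes "\<And>x. x \<in> S \<Longrightarrow> \<exists>T. open T \<and> x \<in> T \<and> Ck_on k T f"
  shows "Ck_on k S f"
  using assms
proof (induction k arbitrary: f)
  case 0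
  then show ?case
    by (metis Ck_on.simps(1) continuous_at_imp_continuous_on continuous_on_eq_continuous_at)
next
  case (Suc k)
  have "f differentiable at x" if "x \<in> S" for x using Suc.prems[OF that] by (auto simp: Ck_on.simps(2))
  moreover have "Ck_on k S (\<lambda>x. frechet_derivative f (at x) v)" for v
    by (rule Suc.IH) (use Suc.prems in \<open>fastforce simp: Ck_on.simps(2)\<close>)
  ultimately show ?case by (simp add: Ck_on.simps(2))
qed

lemma Ck_on_const: "open S \<Longrightarrow> Ck_on k S (\<lambda>x. c)"
proof (induction k arbitrary: c)
  case (Suc k)
  show ?case by (rule Ck_on_SucI[where f'="\<lambda>x v. 0"]) (use Suc in auto)
qed simp

lemma Ck_on_bounded_linear:
  assumes "open S" "bounded_linear f"
  shows "Ck_on k S f"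
proof (cases k)
  case 0
  then show ?thesis using assms by (simp add: linear_continuous_on)
next
  case (Suc j)
  show ?thesis unfolding Suc
    by (rule Ck_on_SucI[OF assms(1), where f'="\<lambda>x. f"])
      (use assms Ck_on_const in \<open>auto intro: bounded_linear_imp_has_derivative\<close>)
qed

lemma Ck_on_add:
  assumes "open S" "Ck_on k S f" "Ck_on k S g"
  shows "Ck_on k S (\<lambda>x. f x + g x)"
  using assms(2,3)
proof (induction k arbitrary: f g)
  case 0
  then show ?case by (auto intro: continuous_intros)
next
  case (Suc k)
  show ?case
    by (rule Ck_on_SucI[OF assms(1) has_derivative_add[OF Ck_on_SucD(1)[OF Suc.prems(1)] Ck_on_SucD(1)[OF Suc.prems(2)]]])
      (use Suc in \<open>auto intro: Ck_on_SucD(2)\<close>)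
qed

text \<open>The product rule once for all bounded bilinear maps; multiplication, scaling and inner
  product are instances.\<close>

lemma Ck_on_bilinear:
  assumes "open S" "bounded_bilinear p" "Ck_on k S f" "Ck_on k S g"
  shows "Ck_on k S (\<lambda>x. p (f x) (g x))"
  using assms(3,4)
proof (induction k arbitrary: f g)
  case 0
  then show ?case using assms(2) by (simp add: bounded_bilinear.continuous_on)
next
  case (Suc k)
  show ?case
    by (rule Ck_on_SucI[OF assms(1) bounded_bilinear.FDERIV[OF assms(2) Ck_on_SucD(1)[OF Suc.prems(1)] Ck_on_SucD(1)[OF Suc.prems(2)]]])
      (use Suc assms(1) in \<open>auto intro!: Ck_on_add intro: Ck_on_SucD(2) Ck_on_Suc_imp\<close>)
qed

lemmas Ck_on_mult = Ck_on_bilinear[OF _ bounded_bilinear_mult]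
lemmas Ck_on_scaleR = Ck_on_bilinear[OF _ bounded_bilinear_scaleR]
lemmas Ck_on_inner = Ck_on_bilinear[OF _ bounded_bilinear_inner]

lemma Ck_on_sum:
  assumes "open S" "\<And>i. i \<in> I \<Longrightarrow> Ck_on k S (f i)"
  shows "Ck_on k S (\<lambda>x. \<Sum>i\<in>I. f i x)"
  using assms(2)
  by (induction I rule: infinite_finite_induct) (auto intro: Ck_on_const Ck_on_add assms(1))

lemma Ck_on_prod:
  fixes f :: "'i \<Rightarrow> 'a::real_normed_vector \<Rightarrow> 'b::{real_normed_algebra,comm_ring_1}"
  assumes "open S" "\<And>i. i \<in> I \<Longrightarrow> Ck_on k S (f i)"
  shows "Ck_on k S (\<lambda>x. \<Prod>i\<in>I. f i x)"
  using assms(2)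
  by (induction I rule: infinite_finite_induct) (auto intro: Ck_on_const Ck_on_mult assms(1))

lemma Ck_on_linear_comp:
  assumes "open S" "bounded_linear h" "Ck_on k S f"
  shows "Ck_on k S (\<lambda>x. h (f x))"
  using assms(3)
proof (induction k arbitrary: f)
  case 0
  then show ?case using linear_continuous_on[OF assms(2)] continuous_on_compose2[of UNIV h S f] by auto
next
  case (Suc k)
  show ?case
    by (rule Ck_on_SucI[OF assms(1) bounded_linear.has_derivative[OF assms(2) Ck_on_SucD(1)[OF Suc.prems]]])
      (use Suc in \<open>auto intro: Ck_on_SucD(2)\<close>)
qed

lemma Ck_on_minus: "open S \<Longrightarrow> Ck_on k S f \<Longrightarrow> Ck_on k S (\<lambda>x. - f x)"
  by (rule Ck_on_linear_comp[OF _ bounded_linear_minus[OF bounded_linear_ident]])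

lemma Ck_on_diff:
  assumes "open S" "Ck_on k S f" "Ck_on k S g"
  shows "Ck_on k S (\<lambda>x. f x - g x)"
  using Ck_on_add[OF assms(1,2) Ck_on_minus[OF assms(1,3)]] by simp

text \<open>The chain rule evaluates the derivative of \<open>g\<close> in the direction
  \<open>frechet_derivative f (at x) v\<close>, which moves with \<open>x\<close>, whereas
  \<open>Ck_on\<close> speaks of fixed directions only. Expanding that direction in the basis of the
  Euclidean space \<open>'e\<close> reduces it to fixed ones.\<close>

lemma Ck_on_compose:
  fixes f :: "'a::real_normed_vector \<Rightarrow> 'e::euclidean_space" and g :: "'e \<Rightarrow> 'f::real_normed_vector"
  assumes S: "open S" and T: "open T" and sub: "f ` S \<subseteq> T" and "Ck_on k S f" "Ck_on k T g"
  shows "Ck_on k S (\<lambda>x. g (f x))"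
  using assms(4,5)
proof (induction k arbitrary: g)
  case 0
  then show ?case using sub by (auto intro: continuous_on_compose2[of T g S f])
next
  case (Suc k)
  have d: "((\<lambda>x. g (f x)) has_derivative
      (\<lambda>v. \<Sum>b\<in>Basis. (frechet_derivative f (at x) v \<bullet> b) *\<^sub>R frechet_derivative g (at (f x)) b)) (at x)"
    if "x \<in> S" for x
  proof -
    have g': "(g has_derivative frechet_derivative g (at (f x))) (at (f x))"
      using Ck_on_SucD(1)[OF Suc.prems(2)] that sub by auto
    then have lin: "linear (frechet_derivative g (at (f x)))"
      by (rule has_derivative_linear)
    have "frechet_derivative g (at (f x)) w = (\<Sum>b\<in>Basis. (w \<bullet> b) *\<^sub>R frechet_derivative g (at (f x)) b)" for w
    proof -
      have "frechet_derivative g (at (f x)) (\<Sum>b\<in>Basis. (w \<bullet> b) *\<^sub>R b) =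
          (\<Sum>b\<in>Basis. (w \<bullet> b) *\<^sub>R frechet_derivative g (at (f x)) b)"
        by (simp only: linear_sum[OF lin] linear_cmul[OF lin])
      then show ?thesis by (simp only: euclidean_representation)
    qed
    from has_derivative_eq_rhs[OF has_derivative_compose[OF Ck_on_SucD(1)[OF Suc.prems(1) that] g'] ext, OF this]
    show ?thesis .
  qed
  show ?case
  proof (rule Ck_on_SucI[OF S d])
    fix v
    have "Ck_on k S (\<lambda>x. frechet_derivative g (at (f x)) b)" for b
      by (rule Suc.IH) (use Suc.prems in \<open>auto intro: Ck_on_Suc_imp Ck_on_SucD(2)\<close>)
    then show "Ck_on k S (\<lambda>x. \<Sum>b\<in>Basis. (frechet_derivative f (at x) v \<bullet> b) *\<^sub>R frechet_derivative g (at (f x)) b)"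
      using Ck_on_SucD(2)[OF Suc.prems(1)] S
      by (intro Ck_on_sum Ck_on_scaleR Ck_on_inner Ck_on_const) auto
  qed
qed

lemma Ck_on_real_SucI:
  fixes g :: "real \<Rightarrow> real"
  assumes "open S" "\<And>x. x \<in> S \<Longrightarrow> (g has_real_derivative g' x) (at x)" "Ck_on k S g'"
  shows "Ck_on (Suc k) S g"
  by (rule Ck_on_SucI[OF assms(1), where f' = "\<lambda>x v. g' x * v"])
    (use assms in \<open>auto simp: has_field_derivative_def intro: Ck_on_mult Ck_on_const\<close>)

text \<open>The derivative of \<open>inverse\<close> is a polynomial in \<open>inverse\<close>, so
  the induction closes on itself; \<open>Ck_on_sqrt\<close> works likewise, through the inverse of
  \<open>sqrt\<close>.\<close>

lemma Ck_on_inverse_real: "Ck_on k {0<..} (inverse :: real \<Rightarrow> real)"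
proof (induction k)
  case 0
  then show ?case by (auto intro!: continuous_intros)
next
  case (Suc k)
  show ?case
    by (rule Ck_on_real_SucI[where g' = "\<lambda>x. - (inverse x * inverse x)"])
      (use Suc in \<open>auto simp: power2_eq_square intro!: derivative_eq_intros Ck_on_mult Ck_on_minus\<close>)
qed

lemma Ck_on_sqrt: "Ck_on k {0<..} sqrt"
proof (induction k)
  case 0
  then show ?case by (auto intro!: continuous_intros)
next
  case (Suc k)
  have "Ck_on k {0<..} (\<lambda>x. (1/2) * inverse (sqrt x))"
    using Suc by (intro Ck_on_mult Ck_on_const Ck_on_compose[OF _ _ _ _ Ck_on_inverse_real]) auto
  then show ?case
    by (intro Ck_on_real_SucI[where g' = "\<lambda>x. (1/2) * inverse (sqrt x)"])
      (auto intro!: derivative_eq_intros)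
qed

lemma Ck_on_Pair:
  assumes "open S" "Ck_on k S f" "Ck_on k S g"
  shows "Ck_on k S (\<lambda>x. (f x, g x))"
proof -
  have "Ck_on k S (\<lambda>x. (f x, 0) + (0, g x))"
    using assms bounded_linear_Pair[OF bounded_linear_ident bounded_linear_zero]
      bounded_linear_Pair[OF bounded_linear_zero bounded_linear_ident]
    by (intro Ck_on_add) (auto intro!: Ck_on_linear_comp[OF assms(1), of "\<lambda>x. (x, 0)"] Ck_on_linear_comp[OF assms(1), of "\<lambda>x. (0, x)"])
  then show ?thesis by simp
qed

section \<open>Bump functions\<close>

text \<open>The flat functions p(1/x) e^(-1/x). Carrying the polynomial \<open>p\<close> makes the
  family closed under differentiation, so smoothness, also at \<open>0\<close>, is one induction
  over all \<open>p\<close>.\<close>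

definition exp_tail :: "real poly \<Rightarrow> real \<Rightarrow> real" where
  "exp_tail p x = (if x > 0 then poly p (inverse x) * exp (- inverse x) else 0)"

lemma poly_times_exp_minus_tendsto_0: "((\<lambda>x. poly p x * exp (-x)) \<longlongrightarrow> (0::real)) at_top"
proof -
  have "((\<lambda>x. \<Sum>i\<le>degree p. coeff p i * (x ^ i / exp x)) \<longlongrightarrow> (\<Sum>i\<le>degree p. coeff p i * 0)) at_top"
    by (intro tendsto_sum tendsto_mult tendsto_const tendsto_power_div_exp_0)
  then show ?thesis
    by (simp add: poly_altdef sum_distrib_right exp_minus divide_inverse mult.assoc)
qed

lemma exp_tail_tendsto_0: "(exp_tail p \<longlongrightarrow> 0) (at 0)"
proof -
  have "((\<lambda>x. exp_tail p x) \<longlongrightarrow> 0) (at_right 0)"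
  proof (rule Lim_transform_eventually)
    show "((\<lambda>x. poly p (inverse x) * exp (- inverse x)) \<longlongrightarrow> 0) (at_right 0)"
      using poly_times_exp_minus_tendsto_0[of p] filterlim_inverse_at_top_right
      by (rule filterlim_compose)
    show "\<forall>\<^sub>F x in at_right 0. poly p (inverse x) * exp (- inverse x) = exp_tail p x"
      by (auto simp: exp_tail_def eventually_at_filter)
  qed
  moreover have "((\<lambda>x. exp_tail p x) \<longlongrightarrow> 0) (at_left 0)"
    by (rule Lim_transform_eventually[OF tendsto_const])
      (auto simp: exp_tail_def eventually_at_filter)
  ultimately show ?thesis by (simp add: filterlim_split_at)
qed

text \<open>The new polynomial is X^2 (p - p'): the inner derivative contributes the square of
  \<open>inverse x\<close>, once through the polynomial and once through the exponential.\<close>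

lemma exp_tail_has_derivative:
  "(exp_tail p has_real_derivative exp_tail ([:0, 0, 1:] * (p - pderiv p)) x) (at x)"
proof -
  consider "x > 0" | "x < 0" | "x = 0" by linarith
  then show ?thesis
  proof cases
    case 1
    have i: "(inverse has_real_derivative - (inverse x * inverse x)) (at x)"
      using 1 DERIV_inverse[of x] by (simp add: power2_eq_square)
    have "((\<lambda>x. poly p (inverse x)) has_real_derivative
        poly (pderiv p) (inverse x) * - (inverse x * inverse x)) (at x)"
      by (rule DERIV_chain2[OF poly_DERIV i])
    moreover have "((\<lambda>x. exp (- inverse x)) has_real_derivative
        exp (- inverse x) * (inverse x * inverse x)) (at x)"
      using DERIV_chain2[OF DERIV_exp DERIV_minus[OF i]] by simp
    ultimately have "((\<lambda>x. poly p (inverse x) * exp (- inverse x)) has_real_derivative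
        (poly (pderiv p) (inverse x) * - (inverse x * inverse x)) * exp (- inverse x) +
        (exp (- inverse x) * (inverse x * inverse x)) * poly p (inverse x)) (at x)"
      by (rule DERIV_mult)
    also have "(poly (pderiv p) (inverse x) * - (inverse x * inverse x)) * exp (- inverse x) +
        (exp (- inverse x) * (inverse x * inverse x)) * poly p (inverse x) =
      exp_tail ([:0, 0, 1:] * (p - pderiv p)) x"
      using 1 by (simp add: exp_tail_def left_diff_distrib right_diff_distrib)
    finally have "((\<lambda>x. poly p (inverse x) * exp (- inverse x)) has_real_derivative
        exp_tail ([:0, 0, 1:] * (p - pderiv p)) x) (at x)" .
    then show ?thesis
      by (rule has_field_derivative_transform_within_open[where S = "{0<..}"]) (use 1 in \<open>auto simp: exp_tail_def\<close>)
  next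
    case 2
    have "((\<lambda>x. 0) has_real_derivative exp_tail ([:0, 0, 1:] * (p - pderiv p)) x) (at x)"
      using 2 by (auto simp: exp_tail_def)
    then show ?thesis
      by (rule has_field_derivative_transform_within_open[where S = "{..<0}"]) (use 2 in \<open>auto simp: exp_tail_def\<close>)
  next
    case 3
    \<comment> \<open>The difference quotient at \<open>0\<close> belongs to the same family, with
      polynomial \<open>[:0, 1:] * p\<close>, so it tends to \<open>0\<close>.\<close>
    have "((\<lambda>y. exp_tail ([:0, 1:] * p) y) \<longlongrightarrow> 0) (at 0)"
      by (rule exp_tail_tendsto_0)
    moreover have "exp_tail ([:0, 1:] * p) y = (exp_tail p y - exp_tail p 0) / (y - 0)" for y
      by (auto simp: exp_tail_def field_simps)
    ultimately show ?thesis
      using 3 by (simp add: has_field_derivative_iff exp_tail_def)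
  qed
qed

lemma Ck_on_exp_tail: "Ck_on k UNIV (exp_tail p)"
proof (induction k arbitrary: p)
  case 0
  then show ?case
    using exp_tail_has_derivative by (auto intro!: continuous_at_imp_continuous_on DERIV_isCont)
next
  case (Suc k)
  then show ?case
    by (intro Ck_on_real_SucI[OF _ exp_tail_has_derivative]) auto
qed

text \<open>The squared distance, unlike the norm, is smooth at the centre \<open>a\<close>.\<close>

definition bump :: "'e::euclidean_space \<Rightarrow> real \<Rightarrow> 'e \<Rightarrow> real" where
  "bump a r y = exp_tail 1 (r\<^sup>2 - (y - a) \<bullet> (y - a))"

lemma Ck_on_bump: "Ck_on k UNIV (bump a r)"
proof -
  have "Ck_on k UNIV (\<lambda>y. r\<^sup>2 - (y - a) \<bullet> (y - a))"
    by (intro Ck_on_diff Ck_on_const Ck_on_inner Ck_on_bounded_linear[OF _ bounded_linear_ident]) auto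
  then have "Ck_on k UNIV (\<lambda>y. exp_tail 1 (r\<^sup>2 - (y - a) \<bullet> (y - a)))"
    by (rule Ck_on_compose[OF open_UNIV open_UNIV subset_UNIV _ Ck_on_exp_tail])
  then show ?thesis by (simp add: bump_def[abs_def])
qed

lemma bump_nonneg: "bump a r y \<ge> 0"
  by (simp add: bump_def exp_tail_def)

lemma bump_pos_iff: "r > 0 \<Longrightarrow> bump a r y > 0 \<longleftrightarrow> y \<in> ball a r"
  using abs_le_square_iff[of r "norm (a - y)"]
  by (auto simp: bump_def exp_tail_def dist_norm norm_minus_commute[of y a] dot_square_norm not_le[symmetric])

lemma bump_eq_0: "r > 0 \<Longrightarrow> y \<notin> ball a r \<Longrightarrow> bump a r y = 0"
  using bump_nonneg[of a r y] bump_pos_iff[of r a y] by linarith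

section \<open>Gram determinants and change of variables\<close>

text \<open>The library states Cramer's rule and the change of variables formula for
  \<open>real ^ 'n\<close>; the following index type transfers them to an arbitrary Euclidean space.\<close>

typedef (overloaded) 'e bidx = "Basis :: 'e::euclidean_space set"
  morphisms basis_vec Abs_bidx
  using nonempty_Basis by blast

instance bidx :: (euclidean_space) finite
proof
  have "(UNIV :: 'a bidx set) = Abs_bidx ` Basis"
    by (rule type_definition.Abs_image[OF type_definition_bidx, symmetric])
  then show "finite (UNIV :: 'a bidx set)" by (metis finite_Basis finite_imageI)
qed

text \<open>An arbitrary order pulled back from an injection into the naturals; the change of
  variables theorem is stated for well-ordered index types.\<close>

instantiation bidx :: (euclidean_space) linorder
begin

definition bidx_rank :: "'a bidx \<Rightarrow> nat" where
  "bidx_rank = (SOME f. inj f)"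

definition less_eq_bidx :: "'a bidx \<Rightarrow> 'a bidx \<Rightarrow> bool" where
  "less_eq_bidx i j \<longleftrightarrow> bidx_rank i \<le> bidx_rank j"

definition less_bidx :: "'a bidx \<Rightarrow> 'a bidx \<Rightarrow> bool" where
  "less_bidx i j \<longleftrightarrow> bidx_rank i < bidx_rank j"

lemma inj_bidx_rank: "inj (bidx_rank :: 'a bidx \<Rightarrow> nat)"
  using someI_ex[of "inj :: ('a bidx \<Rightarrow> nat) \<Rightarrow> bool"] finite_imp_inj_to_nat_seg[of "UNIV :: 'a bidx set"]
  unfolding bidx_rank_def by auto

instance
  by standard (use inj_bidx_rank in \<open>auto simp: less_eq_bidx_def less_bidx_def inj_def\<close>)

end

instance bidx :: (euclidean_space) wellorder
proof
  fix P :: "'a bidx \<Rightarrow> bool" and a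
  assume "\<And>x. (\<And>y. y < x \<Longrightarrow> P y) \<Longrightarrow> P x"
  then show "P a"
    unfolding less_bidx_def by (rule measure_induct_rule[of bidx_rank])
qed

lemma basis_vec_in_Basis [simp]: "basis_vec i \<in> Basis"
  using basis_vec .

lemma bij_betw_basis_vec: "bij_betw basis_vec UNIV Basis"
  by (intro bij_betwI[where g = Abs_bidx]) (auto simp: basis_vec_inverse Abs_bidx_inverse)

lemma inner_basis_vec: "basis_vec i \<bullet> basis_vec j = (if i = j then 1 else 0)"
  by (simp add: inner_Basis basis_vec_inject)

definition to_vec :: "'e::euclidean_space \<Rightarrow> real ^ 'e bidx" where
  "to_vec v = (\<chi> i. v \<bullet> basis_vec i)"

definition of_vec :: "real ^ 'e::euclidean_space bidx \<Rightarrow> 'e" where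
  "of_vec w = (\<Sum>i\<in>UNIV. (w $ i) *\<^sub>R basis_vec i)"

lemma sum_basis_vec: "(\<Sum>i\<in>UNIV. f (basis_vec i)) = sum f Basis"
  using sum.reindex_bij_betw[OF bij_betw_basis_vec] .

lemma prod_basis_vec: "(\<Prod>i\<in>UNIV. f (basis_vec i)) = prod f Basis"
  using prod.reindex_bij_betw[OF bij_betw_basis_vec] .

lemma of_vec_to_vec [simp]: "of_vec (to_vec v) = v"
  using sum_basis_vec[of "\<lambda>b. (v \<bullet> b) *\<^sub>R b"] by (simp add: of_vec_def to_vec_def euclidean_representation)

lemma of_vec_inner_basis_vec: "of_vec w \<bullet> basis_vec i = w $ i"
  by (simp add: of_vec_def inner_sum_left inner_basis_vec if_distrib cong: if_cong)

lemma to_vec_of_vec [simp]: "to_vec (of_vec w) = w"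
  by (simp add: to_vec_def vec_eq_iff of_vec_inner_basis_vec)

lemma linear_to_vec: "linear to_vec"
  by (intro linearI) (simp_all add: to_vec_def vec_eq_iff inner_simps)

lemma linear_of_vec: "linear of_vec"
  by (intro linearI) (simp_all add: of_vec_def scaleR_sum_right sum.distrib scaleR_add_left)

lemma continuous_on_of_vec: "continuous_on S of_vec"
  using linear_of_vec linear_continuous_on linear_conv_bounded_linear by blast

lemma of_vec_measurable [measurable]: "of_vec \<in> borel \<rightarrow>\<^sub>M borel"
  using borel_measurable_continuous_onI[OF continuous_on_of_vec] .

text \<open>Lebesgue measure is determined by the volumes of boxes, and \<open>of_vec\<close>
  carries the standard basis to the standard basis, hence boxes to boxes with the same side
  lengths.\<close>

lemma lborel_distr_of_vec: "distr lborel borel of_vec = (lborel :: 'e::euclidean_space measure)"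
proof (rule lborel_eqI[symmetric])
  fix l u :: 'e assume le: "\<And>b. b \<in> Basis \<Longrightarrow> l \<bullet> b \<le> u \<bullet> b"
  have "of_vec -` box l u = box (to_vec l) (to_vec u)"
  proof -
    have "of_vec w \<in> box l u \<longleftrightarrow> w \<in> box (to_vec l) (to_vec u)" for w
      unfolding mem_box_cart mem_box bij_betw_imp_surj_on[OF bij_betw_basis_vec, symmetric] to_vec_def
      by (simp add: of_vec_inner_basis_vec)
    then show ?thesis by auto
  qed
  moreover have "emeasure lborel (box (to_vec l) (to_vec u)) = (\<Prod>b\<in>Basis. (u - l) \<bullet> b)"
  proof -
    have le': "to_vec l \<bullet> b \<le> to_vec u \<bullet> b" if "b \<in> Basis" for b
      using that le by (auto simp: Basis_vec_def inner_axis to_vec_def)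
    have "bij_betw (\<lambda>i. axis i 1) UNIV (Basis :: (real ^ 'e bidx) set)"
      by (auto simp: bij_betw_def inj_on_def axis_eq_axis Basis_vec_def)
    from prod.reindex_bij_betw[OF this, of "\<lambda>b. (to_vec u - to_vec l) \<bullet> b"]
    have "(\<Prod>b\<in>Basis. (to_vec u - to_vec l) \<bullet> b) = (\<Prod>i\<in>UNIV. (u - l) \<bullet> basis_vec i)"
      by (simp add: to_vec_def inner_axis inner_diff_left)
    then show ?thesis
      using emeasure_lborel_box[OF le'] prod_basis_vec[of "\<lambda>b. (u - l) \<bullet> b"] by simp
  qed
  ultimately show "emeasure (distr lborel borel of_vec) (box l u) = (\<Prod>b\<in>Basis. (u - l) \<bullet> b)"
    by (simp add: emeasure_distr)
qed simp

lemma nn_integral_of_vec: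
  assumes [measurable]: "f \<in> borel_measurable borel"
  shows "(\<integral>\<^sup>+w. f (of_vec w) \<partial>lborel) = (\<integral>\<^sup>+v. f v \<partial>lborel)"
  by (subst lborel_distr_of_vec[symmetric], subst nn_integral_distr) auto

definition form_matrix :: "('e::euclidean_space \<Rightarrow> 'e \<Rightarrow> real) \<Rightarrow> real ^ 'e bidx ^ 'e bidx" where
  "form_matrix g = (\<chi> i j. g (basis_vec i) (basis_vec j))"

definition op_matrix :: "('e::euclidean_space \<Rightarrow> 'e) \<Rightarrow> real ^ 'e bidx ^ 'e bidx" where
  "op_matrix L = matrix (\<lambda>w. to_vec (L (of_vec w)))"

lemma op_matrix_nth: "op_matrix L $ i $ j = L (basis_vec j) \<bullet> basis_vec i"
proof -
  have "of_vec (axis j 1) = basis_vec j"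
    by (rule trans[OF _ of_vec_to_vec], rule arg_cong[where f = of_vec]) (auto simp: to_vec_def vec_eq_iff axis_def inner_basis_vec)
  then show ?thesis by (simp add: op_matrix_def matrix_def to_vec_def)
qed

text \<open>Conjugation by \<open>basis_vec\<close> matches permutations of \<open>Basis\<close>
  with permutations of the index type. It preserves signs and factors, so the two Leibniz sums agree
  term by term.\<close>

lemma gram_det_eq: "gram_det g = det (form_matrix g)"
  unfolding gram_det_def det_def
proof (rule sum.reindex_bij_witness[where i = "map_permutation UNIV basis_vec" and j = "map_permutation Basis Abs_bidx"], goal_cases)
  case (1 p)
  then show ?case
    by (intro map_permutation_compose_inv[where A = Basis and B = UNIV]) (auto simp: Abs_bidx_inverse intro!: bij_betwI[where g = basis_vec] basis_vec_inverse)
next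
  case (2 p)
  then show ?case
    by (intro CollectI map_permutation_permutes[of Abs_bidx Basis UNIV p])
      (auto simp: Abs_bidx_inverse intro!: bij_betwI[where g = basis_vec] basis_vec_inverse)
next
  case (3 p)
  then show ?case
    by (intro map_permutation_compose_inv[OF bij_betw_basis_vec]) (auto simp: basis_vec_inverse)
next
  case (4 p)
  then show ?case using map_permutation_permutes[OF bij_betw_basis_vec] by auto
next
  case (5 p)
  then have p: "p permutes Basis" by simp
  have inj: "inj_on Abs_bidx (Basis :: 'a set)" by (simp add: inj_on_def Abs_bidx_inject)
  have s: "sign (map_permutation Basis Abs_bidx p) = sign p"
    by (rule sign_map_permutation[OF inj p]) simp
  have e: "basis_vec (map_permutation Basis Abs_bidx p i) = p (basis_vec i)" for i
    using map_permutation_apply[OF inj, of "basis_vec i" p] permutes_in_image[OF p, of "basis_vec i"]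
    by (simp add: basis_vec_inverse Abs_bidx_inverse)
  have "(\<Prod>i\<in>UNIV. g (basis_vec i) (p (basis_vec i))) = (\<Prod>b\<in>Basis. g b (p b))"
    using prod_basis_vec[of "\<lambda>b. g b (p b)"] .
  then show ?case by (simp add: s e form_matrix_def)
qed

lemma bilinear_sum_expand:
  assumes "bilinear g"
  shows "g (\<Sum>i\<in>I. a i *\<^sub>R v i) (\<Sum>j\<in>J. b j *\<^sub>R w j) = (\<Sum>i\<in>I. \<Sum>j\<in>J. a i * (g (v i) (w j) * b j))"
  using assms unfolding bilinear_def
  by (subst sum.swap)
    (simp add: linear_sum[of "\<lambda>x. g x _"] linear_cmul[of "\<lambda>x. g x _"] linear_sum[of "g _"] linear_cmul[of "g _"] sum_distrib_left mult.commute mult.left_commute)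

lemma bilinear_form_matrix:
  assumes "bilinear g"
  shows "g v w = to_vec v \<bullet> (form_matrix g *v to_vec w)"
proof -
  have "g v w = g (of_vec (to_vec v)) (of_vec (to_vec w))" by simp
  also have "\<dots> = to_vec v \<bullet> (form_matrix g *v to_vec w)"
    unfolding of_vec_def bilinear_sum_expand[OF assms]
    by (simp add: inner_vec_def matrix_vector_mult_def form_matrix_def sum_distrib_left)
  finally show ?thesis .
qed

lemma form_matrix_pullback:
  assumes "bilinear g"
  shows "form_matrix (\<lambda>v w. g (L v) (L w)) = transpose (op_matrix L) ** form_matrix g ** op_matrix L"
proof -
  have "g (L (basis_vec i)) (L (basis_vec j)) =
      (transpose (op_matrix L) ** form_matrix g ** op_matrix L) $ i $ j" for i j
  proof -
    have "g (L (basis_vec i)) (L (basis_vec j)) = to_vec (L (basis_vec i)) \<bullet> (form_matrix g *v to_vec (L (basis_vec j)))"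
      by (rule bilinear_form_matrix[OF assms])
    also have "\<dots> = (transpose (op_matrix L) ** (form_matrix g ** op_matrix L)) $ i $ j"
      by (simp add: inner_vec_def matrix_vector_mult_def matrix_matrix_mult_def transpose_def op_matrix_nth to_vec_def)
    finally show ?thesis by (simp add: matrix_mul_assoc)
  qed
  then show ?thesis by (simp add: form_matrix_def vec_eq_iff)
qed

text \<open>The square root of this identity is the transformation law of a density, which makes the
  volume independent of the chart.\<close>

lemma gram_det_pullback:
  assumes "bilinear g"
  shows "gram_det (\<lambda>v w. g (L v) (L w)) = gram_det g * (det (op_matrix L))\<^sup>2"
  unfolding gram_det_eq form_matrix_pullback[OF assms, where L = L] det_mul det_transpose
  by (simp add: power2_eq_square)

text \<open>A nonzero vector in the kernel of the matrix would satisfy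
  \<open>g v v = 0\<close>.\<close>

lemma det_form_matrix_nonzero:
  assumes "bilinear g" "\<And>v. v \<noteq> 0 \<Longrightarrow> g v v > 0"
  shows "det (form_matrix g) \<noteq> 0"
proof -
  have "w = 0" if "form_matrix g *v w = 0" for w
  proof -
    have "g (of_vec w) (of_vec w) = 0"
      using bilinear_form_matrix[OF assms(1), of "of_vec w" "of_vec w"] that by simp
    then have "of_vec w = 0" using assms(2)[of "of_vec w"] by force
    then show "w = 0" by (metis linear_0 linear_to_vec to_vec_of_vec)
  qed
  then show ?thesis
    by (metis invertible_det_nz invertible_left_inverse matrix_left_invertible_ker)
qed

lemma gram_det_inner: "gram_det ((\<bullet>) :: 'e::euclidean_space \<Rightarrow> _) = 1"
proof -
  have "form_matrix ((\<bullet>) :: 'e \<Rightarrow> _) = mat 1"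
    by (simp add: form_matrix_def mat_def vec_eq_iff inner_basis_vec)
  then show ?thesis by (simp add: gram_det_eq det_I)
qed

text \<open>The determinant does not vanish along the segment from the Euclidean inner product to
  \<open>g\<close>, so it keeps the sign it has at the Euclidean end.\<close>

lemma gram_det_pos:
  assumes g: "bilinear g" "\<And>v. v \<noteq> 0 \<Longrightarrow> g v v > 0"
  shows "gram_det g > 0"
proof (rule ccontr)
  assume "\<not> gram_det g > 0"
  define h where "h s v w = (1 - s) * (v \<bullet> w) + s * g v w" for s v w
  have "continuous_on {0..1} (\<lambda>s. gram_det (h s))"
    unfolding gram_det_def h_def by (intro continuous_intros)
  moreover have "h 0 = (\<bullet>)" "h 1 = g" by (auto simp: h_def fun_eq_iff)
  ultimately obtain s where s: "0 \<le> s" "s \<le> 1" "gram_det (h s) = 0"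
    using IVT2'[of "\<lambda>s. gram_det (h s)" 1 0 0] gram_det_inner \<open>\<not> gram_det g > 0\<close>
    by (metis not_less zero_le_one)
  have "bilinear (h s)"
    unfolding bilinear_def h_def
    by (auto intro!: linearI simp: bilinear_ladd[OF g(1)] bilinear_radd[OF g(1)] bilinear_lmul[OF g(1)]
        bilinear_rmul[OF g(1)] inner_simps algebra_simps)
  moreover have "h s v v > 0" if "v \<noteq> 0" for v
    using that s g(2)[OF that] unfolding h_def
    by (cases "s = 0") (auto intro!: add_nonneg_pos)
  ultimately show False using det_form_matrix_nonzero[of "h s"] s(3) by (simp add: gram_det_eq)
qed


section \<open>Change of variables for nonnegative integrals\<close>

lemma absolutely_integrable_iff_nn_integral:
  fixes f :: "'e::euclidean_space \<Rightarrow> real"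
  assumes meas: "(\<lambda>x. f x * indicator A x) \<in> borel_measurable borel"
    and nonneg: "\<And>x. x \<in> A \<Longrightarrow> f x \<ge> 0" and "b \<ge> 0"
  shows "f absolutely_integrable_on A \<and> integral A f = b \<longleftrightarrow>
    (\<integral>\<^sup>+x. ennreal (f x * indicator A x) \<partial>lborel) = ennreal b"
proof -
  define h where "h = (\<lambda>x. f x * indicator A x)"
  have h[measurable]: "h \<in> borel_measurable lborel" and h0: "h x \<ge> 0" for x
    using meas nonneg by (auto simp: h_def indicator_def)
  have 1: "f absolutely_integrable_on A \<longleftrightarrow> integrable lborel h"
    unfolding set_integrable_def using integrable_completion[OF h] by (simp add: h_def mult.commute)
  have 2: "integral A f = integral\<^sup>L lborel h" if "integrable lborel h"
    using set_lebesgue_integral_eq_integral(2)[of A f] that integral_completion[OF h] 1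
    by (simp add: set_lebesgue_integral_def h_def mult.commute)
  show ?thesis
    unfolding h_def[symmetric] fun_cong[OF h_def, symmetric]
  proof (intro iffI conjI)
    assume "f absolutely_integrable_on A \<and> integral A f = b"
    then show "(\<integral>\<^sup>+x. ennreal (h x) \<partial>lborel) = ennreal b"
      using 1 2 nn_integral_eq_integral[of lborel h] h0 by simp
  next
    assume I: "(\<integral>\<^sup>+x. ennreal (h x) \<partial>lborel) = ennreal b"
    then have i: "integrable lborel h"
      by (intro integrableI_nn_integral_finite[where x = b]) (use h0 in auto)
    then show "f absolutely_integrable_on A" using 1 by simp
    show "integral A f = b"
      using nn_integral_eq_integral[OF i] h0 I 2[OF i] \<open>b \<ge> 0\<close> by (simp add: integral_nonneg_AE)
  qed
qed

text \<open>The theorem behind it speaks of absolute integrability and gauge integrals;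
  \<open>absolutely_integrable_iff_nn_integral\<close> rewrites both sides as Lebesgue integrals of
  nonnegative functions.\<close>

lemma nn_integral_change_of_variables_cart:
  fixes T :: "real ^ 'n::{finite,wellorder} \<Rightarrow> real ^ 'n::_" and f :: "real ^ 'n::_ \<Rightarrow> real"
  assumes B: "B \<in> sets borel" and der: "\<And>x. x \<in> B \<Longrightarrow> (T has_derivative T' x) (at x within B)"
    and inj: "inj_on T B"
    and meas: "(\<lambda>y. f y * indicator (T ` B) y) \<in> borel_measurable borel"
      "(\<lambda>x. \<bar>det (matrix (T' x))\<bar> * f (T x) * indicator B x) \<in> borel_measurable borel"
    and nonneg: "\<And>y. y \<in> T ` B \<Longrightarrow> f y \<ge> 0"
  shows "(\<integral>\<^sup>+y. ennreal (f y * indicator (T ` B) y) \<partial>lborel) =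
    (\<integral>\<^sup>+x. ennreal (\<bar>det (matrix (T' x))\<bar> * f (T x) * indicator B x) \<partial>lborel)" (is "?L = ?R")
proof -
  have iff: "(\<lambda>x. \<bar>det (matrix (T' x))\<bar> * f (T x)) absolutely_integrable_on B \<and>
      integral B (\<lambda>x. \<bar>det (matrix (T' x))\<bar> * f (T x)) = b \<longleftrightarrow>
      f absolutely_integrable_on (T ` B) \<and> integral (T ` B) f = b" for b
    using has_absolute_integral_change_of_variables[OF _ der inj, of "\<lambda>x. vec (f x) :: real ^ 1" "vec b"] B
    unfolding absolutely_integrable_on_1_iff integral_on_1_eq by simp
  have iff': "?R = ennreal b \<longleftrightarrow> ?L = ennreal b" if "b \<ge> 0" for b
    using iff[of b] absolutely_integrable_iff_nn_integral[OF meas(1) nonneg that]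
      absolutely_integrable_iff_nn_integral[OF meas(2) _ that] nonneg by simp
  \<comment> \<open>The two sides take the same finite values, so one is infinite exactly when the
    other is.\<close>
  show ?thesis
    by (cases ?L; cases ?R) (use iff' in metis)+
qed

text \<open>Conjugation by \<open>of_vec\<close>, which preserves Lebesgue measure, transports the
  formula; \<open>op_matrix\<close> is the matrix of the conjugated derivative.\<close>

lemma nn_integral_change_of_variables:
  fixes T :: "'e::euclidean_space \<Rightarrow> 'e" and f :: "'e \<Rightarrow> real"
  assumes B: "B \<in> sets borel" and der: "\<And>x. x \<in> B \<Longrightarrow> (T has_derivative T' x) (at x within B)"
    and inj: "inj_on T B"
    and meas: "(\<lambda>y. f y * indicator (T ` B) y) \<in> borel_measurable borel"
      "(\<lambda>x. \<bar>det (op_matrix (T' x))\<bar> * f (T x) * indicator B x) \<in> borel_measurable borel"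
    and nonneg: "\<And>y. y \<in> T ` B \<Longrightarrow> f y \<ge> 0"
  shows "(\<integral>\<^sup>+y. ennreal (f y * indicator (T ` B) y) \<partial>lborel) =
    (\<integral>\<^sup>+x. ennreal (\<bar>det (op_matrix (T' x))\<bar> * f (T x) * indicator B x) \<partial>lborel)"
proof -
  define B2 where "B2 = of_vec -` B"
  define T2 where "T2 = (\<lambda>w. to_vec (T (of_vec w)))"
  define T2' where "T2' = (\<lambda>w v. to_vec (T' (of_vec w) (of_vec v)))"
  have bl: "bounded_linear (to_vec :: 'e \<Rightarrow> _)" "bounded_linear (of_vec :: _ \<Rightarrow> 'e)"
    using linear_to_vec linear_of_vec linear_conv_bounded_linear by blast+
  have mem: "w \<in> T2 ` B2 \<longleftrightarrow> of_vec w \<in> T ` B" "w \<in> B2 \<longleftrightarrow> of_vec w \<in> B" for w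
    unfolding T2_def B2_def by (auto simp: image_iff) (metis of_vec_to_vec to_vec_of_vec vimageI)+
  have det: "det (matrix (T2' w)) = det (op_matrix (T' (of_vec w)))" for w
    by (simp add: T2'_def op_matrix_def)
  have ind: "(indicator (T2 ` B2) w :: real) = indicator (T ` B) (of_vec w)"
    "(indicator B2 w :: real) = indicator B (of_vec w)" for w
    by (simp_all add: indicator_def mem)
  have "(\<integral>\<^sup>+w. ennreal (f (of_vec w) * indicator (T2 ` B2) w) \<partial>lborel) =
    (\<integral>\<^sup>+w. ennreal (\<bar>det (matrix (T2' w))\<bar> * f (of_vec (T2 w)) * indicator B2 w) \<partial>lborel)"
  proof (rule nn_integral_change_of_variables_cart)
    show "B2 \<in> sets borel" unfolding B2_def using measurable_sets[OF of_vec_measurable B] by simp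
    show "(T2 has_derivative T2' w) (at w within B2)" if "w \<in> B2" for w
    proof -
      have "(of_vec has_derivative of_vec) (at w within B2)"
        by (rule bounded_linear_imp_has_derivative[OF bl(2)])
      moreover have "(T has_derivative T' (of_vec w)) (at (of_vec w) within of_vec ` B2)"
        by (rule has_derivative_subset[OF der]) (use that in \<open>auto simp: B2_def\<close>)
      ultimately have "((\<lambda>w. T (of_vec w)) has_derivative (\<lambda>v. T' (of_vec w) (of_vec v))) (at w within B2)"
        by (rule has_derivative_in_compose)
      then show ?thesis unfolding T2_def T2'_def by (rule bounded_linear.has_derivative[OF bl(1)])
    qed
    show "inj_on T2 B2"
      using inj unfolding inj_on_def T2_def B2_def by (metis of_vec_to_vec to_vec_of_vec vimageE)
    show "(\<lambda>w. f (of_vec w) * indicator (T2 ` B2) w) \<in> borel_measurable borel"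
      unfolding ind using measurable_compose[OF of_vec_measurable meas(1)] .
    show "(\<lambda>w. \<bar>det (matrix (T2' w))\<bar> * f (of_vec (T2 w)) * indicator B2 w) \<in> borel_measurable borel"
      unfolding ind det T2_def of_vec_to_vec using measurable_compose[OF of_vec_measurable meas(2)] .
    show "f (of_vec w) \<ge> 0" if "w \<in> T2 ` B2" for w
      using that nonneg by (simp add: mem)
  qed
  then show ?thesis
    unfolding ind det unfolding T2_def of_vec_to_vec
    using nn_integral_of_vec[of "\<lambda>y. ennreal (f y * indicator (T ` B) y)"] nn_integral_of_vec[of "\<lambda>x. ennreal (\<bar>det (op_matrix (T' x))\<bar> * f (T x) * indicator B x)"] meas
    by simp
qed


section \<open>Gradients with respect to a positive definite form\<close>

definition posdef_form :: "('e::euclidean_space \<Rightarrow> 'e \<Rightarrow> real) \<Rightarrow> bool" where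
  "posdef_form g \<longleftrightarrow> bilinear g \<and> (\<forall>v w. g v w = g w v) \<and> (\<forall>v. v \<noteq> 0 \<longrightarrow> g v v > 0)"

text \<open>The description inside \<open>grad_coord\<close>, freed from chart and function so that
  its dependence on the form and on the functional can be studied.\<close>

definition riesz :: "('e::euclidean_space \<Rightarrow> 'e \<Rightarrow> real) \<Rightarrow> ('e \<Rightarrow> real) \<Rightarrow> 'e" where
  "riesz g \<omega> = (THE v. \<forall>w. g v w = \<omega> w)"

lemma posdef_formD:
  assumes "posdef_form g"
  shows "bilinear g" "g v w = g w v" "v \<noteq> 0 \<Longrightarrow> g v v > 0" "g v v \<ge> 0"
    "linear (g v)" "linear (\<lambda>v. g v w)"
  using assms bilinear_lzero[of g v] unfolding posdef_form_def bilinear_def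
  by (auto simp: less_imp_le) (cases "v = 0"; auto simp: less_imp_le)

lemma riesz_unique:
  assumes g: "posdef_form g" and v: "\<And>w. g v w = \<omega> w"
  shows "riesz g \<omega> = v"
  unfolding riesz_def
proof (rule the_equality)
  show "\<forall>w. g v w = \<omega> w" using v by simp
  fix v' assume "\<forall>w. g v' w = \<omega> w"
  then have "g (v' - v) (v' - v) = 0"
    using v bilinear_lsub[OF posdef_formD(1)[OF g]] by simp
  then show "v' = v" using posdef_formD(3)[OF g, of "v' - v"] by auto
qed

text \<open>Cramer's rule for the representing vector. The formula is rational in the entries of
  \<open>g\<close> and \<open>\<omega>\<close>, so it exhibits the smooth dependence on a parameter
  that the description in \<open>riesz\<close> hides.\<close>

definition cramer_solution :: "('e::euclidean_space \<Rightarrow> 'e \<Rightarrow> real) \<Rightarrow> ('e \<Rightarrow> real) \<Rightarrow> 'e" where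
  "cramer_solution g \<omega> = (\<Sum>k\<in>UNIV.
    (det (\<chi> i j. if j = k then \<omega> (basis_vec i) else g (basis_vec i) (basis_vec j)) *
      inverse (det (form_matrix g))) *\<^sub>R basis_vec k)"

lemma cramer_solution:
  assumes g: "posdef_form g" and lin: "linear \<omega>"
  shows "g (cramer_solution g \<omega>) w = \<omega> w"
proof -
  define b :: "real ^ 'a bidx" where "b = (\<chi> i. \<omega> (basis_vec i))"
  define x :: "real ^ 'a bidx" where "x = to_vec (cramer_solution g \<omega>)"
  have "x = (\<chi> k. det (\<chi> i j. if j = k then b $ i else form_matrix g $ i $ j) / det (form_matrix g))"
    unfolding x_def cramer_solution_def
    by (simp add: vec_eq_iff b_def form_matrix_def divide_inverse to_vec_def inner_sum_left inner_basis_vec if_distrib cong: if_cong)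
  then have "form_matrix g *v x = b"
    using cramer[of "form_matrix g" x b] det_form_matrix_nonzero posdef_formD[OF g] by blast
  then have "g w (cramer_solution g \<omega>) = to_vec w \<bullet> b"
    using bilinear_form_matrix[OF posdef_formD(1)[OF g]] by (simp add: x_def)
  also have "\<dots> = (\<Sum>i\<in>UNIV. (w \<bullet> basis_vec i) * \<omega> (basis_vec i))"
    by (simp add: inner_vec_def to_vec_def b_def)
  also have "\<dots> = \<omega> (\<Sum>b\<in>Basis. (w \<bullet> b) *\<^sub>R b)"
    using sum_basis_vec[of "\<lambda>b. (w \<bullet> b) * \<omega> b"] by (simp add: linear_sum[OF lin] linear_cmul[OF lin])
  finally show ?thesis
    using posdef_formD(2)[OF g] by (metis euclidean_representation)
qed

lemma riesz_eq_cramer_solution: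
  "posdef_form g \<Longrightarrow> linear \<omega> \<Longrightarrow> riesz g \<omega> = cramer_solution g \<omega>"
  by (rule riesz_unique[OF _ cramer_solution])

lemma riesz_works: "posdef_form g \<Longrightarrow> linear \<omega> \<Longrightarrow> g (riesz g \<omega>) w = \<omega> w"
  by (simp add: riesz_eq_cramer_solution cramer_solution)

lemma Ck_on_det:
  fixes A :: "'a::real_normed_vector \<Rightarrow> 'n::finite \<Rightarrow> 'n \<Rightarrow> real"
  assumes "open S" "\<And>i j. Ck_on k S (\<lambda>y. A y i j)"
  shows "Ck_on k S (\<lambda>y. det (\<chi> i j. A y i j))"
  unfolding det_def
  by (intro Ck_on_sum Ck_on_mult Ck_on_const Ck_on_prod assms(1)) (simp add: assms(2))

lemma Ck_on_gram_det:
  assumes "open S" "\<And>v w. Ck_on k S (\<lambda>y. g y v w)"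
  shows "Ck_on k S (\<lambda>y. gram_det (g y))"
  unfolding gram_det_def
  by (intro Ck_on_sum Ck_on_mult Ck_on_const Ck_on_prod assms)

lemma Ck_on_sqrt_gram_det:
  assumes "open S" "\<And>v w. Ck_on k S (\<lambda>y. g y v w)" "\<And>y. y \<in> S \<Longrightarrow> posdef_form (g y)"
  shows "Ck_on k S (\<lambda>y. sqrt (gram_det (g y)))"
  by (rule Ck_on_compose[OF assms(1) _ _ Ck_on_gram_det[OF assms(1,2)] Ck_on_sqrt])
    (use assms(3) in \<open>auto intro!: gram_det_pos dest: posdef_formD\<close>)

lemma Ck_on_riesz:
  assumes S: "open S" and g: "\<And>v w. Ck_on k S (\<lambda>y. g y v w)" "\<And>y. y \<in> S \<Longrightarrow> posdef_form (g y)"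
    and \<omega>: "\<And>w. Ck_on k S (\<lambda>y. \<omega> y w)" "\<And>y. y \<in> S \<Longrightarrow> linear (\<omega> y)"
  shows "Ck_on k S (\<lambda>y. riesz (g y) (\<omega> y))"
proof (rule Ck_on_cong_imp[OF S])
  show "\<forall>y\<in>S. cramer_solution (g y) (\<omega> y) = riesz (g y) (\<omega> y)"
    by (simp add: riesz_eq_cramer_solution g \<omega>)
  have "Ck_on k S (\<lambda>y. inverse (gram_det (g y)))"
    by (rule Ck_on_compose[OF S _ _ Ck_on_gram_det[OF S g(1)] Ck_on_inverse_real])
      (use g(2) in \<open>auto intro!: gram_det_pos dest: posdef_formD\<close>)
  moreover have "Ck_on k S (\<lambda>y. if j = l then \<omega> y (basis_vec i) else g y (basis_vec i) (basis_vec j))" for i j l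
    using \<omega>(1) g(1) by (cases "j = l") auto
  ultimately show "Ck_on k S (\<lambda>y. cramer_solution (g y) (\<omega> y))"
    unfolding cramer_solution_def
    by (intro Ck_on_sum Ck_on_scaleR Ck_on_mult Ck_on_det Ck_on_const S) (simp_all add: gram_det_eq)
qed

lemma riesz_add:
  assumes "posdef_form g" "linear \<omega>" "linear \<eta>"
  shows "riesz g (\<lambda>w. \<omega> w + t * \<eta> w) = riesz g \<omega> + t *\<^sub>R riesz g \<eta>"
  using assms
  by (intro riesz_unique)
    (simp_all add: bilinear_ladd[OF posdef_formD(1)] bilinear_lmul[OF posdef_formD(1)] riesz_works)

text \<open>A \<open>g\<close>-orthonormal set of maximal cardinality works: linear independence
  bounds the cardinality by the dimension, and a nonzero remainder \<open>r\<close>, once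
  normalised, would enlarge the set.\<close>

lemma posdef_form_orthonormal_basis:
  fixes g :: "'e::euclidean_space \<Rightarrow> 'e \<Rightarrow> real"
  assumes g: "posdef_form g"
  obtains E where "finite E" "\<And>w. w = (\<Sum>e\<in>E. g w e *\<^sub>R e)"
proof -
  define P where "P E \<longleftrightarrow> finite E \<and> (\<forall>e\<in>E. \<forall>e'\<in>E. g e e' = (if e = e' then 1 else 0))" for E :: "'e set"
  note gD = posdef_formD[OF g]
  have gsum: "g (\<Sum>x\<in>E. f x *\<^sub>R x) e = f e" if "P E" "e \<in> E" for E f e
  proof -
    have "g (\<Sum>x\<in>E. f x *\<^sub>R x) e = (\<Sum>x\<in>E. f x * g x e)"
      by (simp add: linear_sum[OF gD(6)[of e]] linear_cmul[OF gD(6)[of e]])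
    also have "\<dots> = (\<Sum>x\<in>E. if x = e then f x else 0)"
      by (rule sum.cong) (use that in \<open>auto simp: P_def\<close>)
    finally show ?thesis using that by (simp add: P_def)
  qed
  have "card E \<le> DIM('e)" if "P E" for E
  proof -
    have "independent E"
    proof (rule independent_if_scalars_zero)
      show "finite E" using that by (simp add: P_def)
      show "f x = 0" if "(\<Sum>x\<in>E. f x *\<^sub>R x) = 0" "x \<in> E" for f x
        using gsum[OF \<open>P E\<close> that(2), of f] that(1) linear_0[OF gD(6)[of x]] by simp
    qed
    then show ?thesis using independent_bound by blast
  qed
  then have bound: "\<forall>E. P E \<longrightarrow> card E < Suc DIM('e)" by (simp add: less_Suc_eq_le)
  have "P {}" by (simp add: P_def)
  from ex_has_greatest_nat[of P "{}" card "Suc DIM('e)", OF this bound]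
  obtain E where E: "P E" "\<And>E'. P E' \<Longrightarrow> card E' \<le> card E" by auto
  have "w = (\<Sum>e\<in>E. g w e *\<^sub>R e)" for w
  proof (rule ccontr)
    assume neq: "w \<noteq> (\<Sum>e\<in>E. g w e *\<^sub>R e)"
    define r where "r = w - (\<Sum>e\<in>E. g w e *\<^sub>R e)"
    have r: "g r r > 0" using neq gD(3)[of r] by (simp add: r_def)
    have rE: "g r e = 0" if "e \<in> E" for e
      using gsum[OF E(1) that] linear_diff[OF gD(6)[of e]] by (simp add: r_def)
    define n where "n = inverse (sqrt (g r r)) *\<^sub>R r"
    have "g n n = 1"
      using r by (simp add: n_def bilinear_lmul[OF gD(1)] bilinear_rmul[OF gD(1)] field_simps)
    moreover have nE: "g n e = 0" "g e n = 0" if "e \<in> E" for e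
      using rE[OF that] gD(2)[of e n] by (simp_all add: n_def bilinear_lmul[OF gD(1)])
    ultimately have "n \<notin> E" "P (insert n E)"
      using E(1) by (auto simp: P_def)
    then have "card (insert n E) \<le> card E" "n \<notin> E" using E(2) by auto
    then show False using E(1) by (simp add: P_def)
  qed
  then show thesis using that[of E] E(1) by (auto simp: P_def)
qed

text \<open>Expand each standard basis vector in \<open>E\<close> and exchange the two sums. This is
  how a divergence is moved into a frame adapted to \<open>g\<close>.\<close>

lemma trace_orthonormal:
  fixes g :: "'e::euclidean_space \<Rightarrow> 'e \<Rightarrow> real"
  assumes g: "posdef_form g" and A: "linear A" and E: "\<And>w. w = (\<Sum>e\<in>E. g w e *\<^sub>R e)"
  shows "(\<Sum>b\<in>Basis. A b \<bullet> b) = (\<Sum>e\<in>E. g (A e) e)"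
proof -
  note gD = posdef_formD[OF g]
  have "(\<Sum>b\<in>Basis. A b \<bullet> b) = (\<Sum>b\<in>Basis. \<Sum>e\<in>E. g b e * (A e \<bullet> b))"
  proof (rule sum.cong[OF refl])
    fix b :: 'e
    have "A b = (\<Sum>e\<in>E. g b e *\<^sub>R A e)"
      using arg_cong[OF E[of b], of A] by (simp add: linear_sum[OF A] linear_cmul[OF A])
    then show "A b \<bullet> b = (\<Sum>e\<in>E. g b e * (A e \<bullet> b))" by (simp add: inner_sum_left)
  qed
  also have "\<dots> = (\<Sum>e\<in>E. \<Sum>b\<in>Basis. g b e * (A e \<bullet> b))" by (rule sum.swap)
  also have "\<dots> = (\<Sum>e\<in>E. g (A e) e)"
  proof (rule sum.cong[OF refl])
    fix e
    have "g (\<Sum>b\<in>Basis. (A e \<bullet> b) *\<^sub>R b) e = (\<Sum>b\<in>Basis. g b e * (A e \<bullet> b))"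
      by (simp add: linear_sum[OF gD(6)[of e]] linear_cmul[OF gD(6)[of e]] mult.commute)
    then show "(\<Sum>b\<in>Basis. g b e * (A e \<bullet> b)) = g (A e) e" by (simp add: euclidean_representation)
  qed
  finally show ?thesis .
qed

section \<open>Charts\<close>

lemma chart_facts:
  assumes "is_chart X c"
  shows "openin X (cdom c)" "open (cimage c)" "inj_on (coord c) (cdom c)"
    and "cdom c \<subseteq> topspace X"
    and "continuous_map (subtopology X (cdom c)) euclidean (coord c)"
    and "continuous_map (top_of_set (cimage c)) X (param c)"
    and "U \<subseteq> cdom c \<Longrightarrow> openin X U \<Longrightarrow> open (coord c ` U)"
    and "V \<subseteq> cimage c \<Longrightarrow> open V \<Longrightarrow> openin X (param c ` V)"
proof -
  note c = assms[unfolded is_chart_def]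
  show o: "openin X (cdom c)" and oi: "open (cimage c)" using c by auto
  show s: "cdom c \<subseteq> topspace X" using o by (rule openin_subset)
  have ts: "topspace (subtopology X (cdom c)) = cdom c" using s by auto
  have h: "homeomorphic_map (subtopology X (cdom c)) (top_of_set (cimage c)) (coord c)" using c by auto
  show inj: "inj_on (coord c) (cdom c)" using homeomorphic_imp_injective_map[OF h] ts by simp
  show "continuous_map (subtopology X (cdom c)) euclidean (coord c)"
    using homeomorphic_imp_continuous_map[OF h] continuous_map_in_subtopology by blast
  obtain g where g: "homeomorphic_maps (subtopology X (cdom c)) (top_of_set (cimage c)) (coord c) g"
    using h homeomorphic_map_maps by blast
  \<comment> \<open>\<open>param c\<close> is an \<open>inv_into\<close> and carries no continuity
    by itself; on the image it coincides with the inverse \<open>g\<close> supplied by the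
    homeomorphism.\<close>
  have "g y = param c y" if "y \<in> cimage c" for y
  proof -
    have "g y \<in> cdom c" "coord c (g y) = y"
      using g that ts unfolding homeomorphic_maps_def continuous_map_def by (auto simp: Pi_iff)
    then show ?thesis using inj unfolding param_def by (metis inv_into_f_f)
  qed
  then have "continuous_map (top_of_set (cimage c)) (subtopology X (cdom c)) (param c)"
    using g unfolding homeomorphic_maps_def by (auto elim: continuous_map_eq)
  then show pc: "continuous_map (top_of_set (cimage c)) X (param c)"
    using continuous_map_in_subtopology by blast
  show "open (coord c ` U)" if "U \<subseteq> cdom c" "openin X U"
  proof -
    have "openin (subtopology X (cdom c)) U" using that by (metis openin_subset_topspace_eq openin_subtopology_Int2 inf.absorb_iff2 inf.commute openin_subtopology)
    then have "openin (top_of_set (cimage c)) (coord c ` U)"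
      using homeomorphic_imp_open_map[OF h] by (simp add: open_map_def)
    then show ?thesis using oi openin_open_trans by blast
  qed
  show "openin X (param c ` V)" if V: "V \<subseteq> cimage c" "open V"
  proof -
    have "param c ` V = cdom c \<inter> coord c -` V"
      using V inj by (auto simp: param_def cimage_def inv_into_into f_inv_into_f image_iff)
        (metis inv_into_f_f subsetD)
    moreover have "openin (subtopology X (cdom c)) {x \<in> topspace (subtopology X (cdom c)). coord c x \<in> V}"
      using openin_continuous_map_preimage[OF homeomorphic_imp_continuous_map[OF h], of V] V
      by (metis inf.absorb_iff2 openin_open)
    then have "openin (subtopology X (cdom c)) (cdom c \<inter> coord c -` V)"
      unfolding ts by (simp add: Collect_conj_eq vimage_def)
    ultimately show ?thesis using o by (metis openin_trans_full)
  qed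
qed

lemma param_coord: "is_chart X c \<Longrightarrow> p \<in> cdom c \<Longrightarrow> param c (coord c p) = p"
  using chart_facts(3) by (metis inv_into_f_f param_def)

lemma coord_param: "y \<in> cimage c \<Longrightarrow> coord c (param c y) = y"
  by (simp add: cimage_def param_def f_inv_into_f)

lemma param_in_cdom: "y \<in> cimage c \<Longrightarrow> param c y \<in> cdom c"
  by (simp add: cimage_def param_def inv_into_into)

lemma coord_in_cimage: "p \<in> cdom c \<Longrightarrow> coord c p \<in> cimage c"
  by (simp add: cimage_def)

lemma smooth_on_has_derivative:
  assumes "smooth_on S f" "x \<in> S"
  shows "(f has_derivative frechet_derivative f (at x)) (at x)"
  using assms Ck_on_SucD(1)[of 0 S f] unfolding smooth_on_def by blast

text \<open>Only the sigma-algebra of this measure matters: it is the one that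
  \<open>is_volume_measure\<close> prescribes.\<close>

definition borel_of_top :: "'a topology \<Rightarrow> 'a measure" where
  "borel_of_top X = sigma (topspace X) {U. openin X U}"

lemma space_borel_of_top [simp]: "space (borel_of_top X) = topspace X"
  by (simp add: borel_of_top_def space_measure_of_conv)

lemma sets_borel_of_top: "sets (borel_of_top X) = sigma_sets (topspace X) {U. openin X U}"
  unfolding borel_of_top_def by (rule sets_measure_of) (auto dest: openin_subset)

lemma openin_sets_borel_of_top: "openin X U \<Longrightarrow> U \<in> sets (borel_of_top X)"
  by (auto simp: sets_borel_of_top)

lemma continuous_map_borel_measurable:
  assumes "continuous_map X euclidean f"
  shows "f \<in> borel_measurable (borel_of_top X)"
proof (rule borel_measurableI)
  fix S :: "'b set" assume "open S"
  then have "openin X {x \<in> topspace X. f x \<in> S}"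
    using openin_continuous_map_preimage[OF assms] by simp
  moreover have "f -` S \<inter> space (borel_of_top X) = {x \<in> topspace X. f x \<in> S}" by auto
  ultimately show "f -` S \<inter> space (borel_of_top X) \<in> sets (borel_of_top X)"
    by (simp add: openin_sets_borel_of_top)
qed

lemma param_measurable:
  assumes c: "is_chart X c"
  shows "param c \<in> restrict_space borel (cimage c) \<rightarrow>\<^sub>M borel_of_top X"
  unfolding borel_of_top_def
proof (rule measurable_measure_of)
  show "{U. openin X U} \<subseteq> Pow (topspace X)" by (auto dest: openin_subset)
  show "param c \<in> space (restrict_space borel (cimage c)) \<rightarrow> topspace X"
    by (auto simp: space_restrict_space intro!: subsetD[OF chart_facts(4)[OF c]] param_in_cdom)
  fix U assume "U \<in> {U. openin X U}"
  then have "openin (top_of_set (cimage c)) {y \<in> topspace (top_of_set (cimage c)). param c y \<in> U}"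
    using openin_continuous_map_preimage[OF chart_facts(6)[OF c]] by blast
  then have "open {y \<in> cimage c. param c y \<in> U}"
    using chart_facts(2)[OF c] openin_open_trans by fastforce
  moreover have "param c -` U \<inter> space (restrict_space borel (cimage c)) = {y \<in> cimage c. param c y \<in> U}"
    by (auto simp: space_restrict_space)
  ultimately show "param c -` U \<inter> space (restrict_space borel (cimage c)) \<in> sets (restrict_space borel (cimage c))"
    using chart_facts(2)[OF c] by (auto simp: sets_restrict_space image_iff intro!: bexI[of _ "{y \<in> cimage c. param c y \<in> U}"])
qed

text \<open>Images of measurable sets are delicate in general; here the image under
  \<open>coord c\<close> is a preimage under \<open>param c\<close>.\<close>

lemma coord_image_borel:
  assumes c: "is_chart X c" and A: "A \<in> sets (borel_of_top X)" "A \<subseteq> cdom c"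
  shows "coord c ` A \<in> sets borel"
proof -
  have "coord c ` A = param c -` A \<inter> space (restrict_space borel (cimage c))"
    using A(2) by (auto simp: space_restrict_space param_coord[OF c] coord_in_cimage subset_iff image_iff)
      (metis coord_param)
  then have "coord c ` A \<in> sets (restrict_space borel (cimage c))"
    using measurable_sets[OF param_measurable[OF c] A(1)] by simp
  then show ?thesis
    using chart_facts(2)[OF c] by (auto simp: sets_restrict_space)
qed

lemma continuous_on_times_indicator_measurable:
  fixes f :: "'a::topological_space \<Rightarrow> real"
  assumes "continuous_on S f" "S \<in> sets borel" "B \<in> sets borel" "B \<subseteq> S"
  shows "(\<lambda>x. f x * indicator B x) \<in> borel_measurable borel"
proof -
  have "(\<lambda>x. indicator S x *\<^sub>R f x) \<in> borel_measurable borel"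
    using assms(1,2) by (intro borel_measurable_continuous_on_indicator)
  moreover have "(indicator B :: 'a \<Rightarrow> real) \<in> borel_measurable borel" using assms(3) by simp
  ultimately have "(\<lambda>x. (indicator S x *\<^sub>R f x) * indicator B x) \<in> borel_measurable borel" by measurable
  moreover have "(\<lambda>x. (indicator S x *\<^sub>R f x) * indicator B x) = (\<lambda>x. f x * indicator B x)"
    using assms(4) by (auto simp: fun_eq_iff indicator_def of_bool_def)
  ultimately show ?thesis by (simp only:)
qed

definition vol_density :: "('a, 'e::euclidean_space) rchart \<Rightarrow> 'e \<Rightarrow> real" where
  "vol_density c y = sqrt (gram_det (cmetric c y))"

section \<open>The volume measure\<close>

text \<open>The volume of the part of a set inside one chart domain, as a measure on the whole
  manifold: the building block of the global measure.\<close>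

definition chart_measure :: "'a topology \<Rightarrow> ('a, 'e::euclidean_space) rchart \<Rightarrow> 'a measure" where
  "chart_measure X c = distr (density (restrict_space lborel (cimage c)) (\<lambda>y. ennreal (vol_density c y)))
     (borel_of_top X) (param c)"

locale closed_riemannian =
  fixes M :: "('a, 'e::euclidean_space) rmanifold"
  assumes compact: "compact_space (mtop M)"
    and hausdorff: "Hausdorff_space (mtop M)"
    and cover: "(\<Union>c\<in>atlas M. cdom c) = points M"
    and is_chart: "c \<in> atlas M \<Longrightarrow> is_chart (mtop M) c"
    and metric_on_chart: "c \<in> atlas M \<Longrightarrow> metric_on_chart c"
    and compatible: "c \<in> atlas M \<Longrightarrow> d \<in> atlas M \<Longrightarrow> compatible c d"
begin

lemmas open_cdom = chart_facts(1)[OF is_chart]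
  and open_cimage = chart_facts(2)[OF is_chart]
  and cdom_subset = chart_facts(4)[OF is_chart]

lemma posdef: "c \<in> atlas M \<Longrightarrow> y \<in> cimage c \<Longrightarrow> posdef_form (cmetric c y)"
  using metric_on_chart unfolding metric_on_chart_def posdef_form_def by blast

lemma smooth_metric: "c \<in> atlas M \<Longrightarrow> Ck_on k (cimage c) (\<lambda>y. cmetric c y v w)"
  using metric_on_chart unfolding metric_on_chart_def smooth_on_def by blast

lemma chart_at: "p \<in> points M \<Longrightarrow> chart_at M p \<in> atlas M \<and> p \<in> cdom (chart_at M p)"
  unfolding chart_at_def using cover by (intro someI_ex[of "\<lambda>c. c \<in> atlas M \<and> p \<in> cdom c"]) blast

definition transition :: "('a, 'e) rchart \<Rightarrow> ('a, 'e) rchart \<Rightarrow> 'e \<Rightarrow> 'e" where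
  "transition c d = coord d \<circ> param c"

lemma transition_facts:
  assumes "c \<in> atlas M" "d \<in> atlas M"
  defines "S \<equiv> coord c ` (cdom c \<inter> cdom d)" and "T \<equiv> transition c d"
  shows "open S" "smooth_on S T" "inj_on T S" "S \<subseteq> cimage c"
    and "y \<in> S \<Longrightarrow> T y \<in> cimage d"
    and "y \<in> S \<Longrightarrow> param d (T y) = param c y"
    and "y \<in> S \<Longrightarrow> (T has_derivative frechet_derivative T (at y)) (at y)"
    and "y \<in> S \<Longrightarrow> cmetric c y v w =
           cmetric d (T y) (frechet_derivative T (at y) v) (frechet_derivative T (at y) w)"
proof -
  note ch = is_chart[OF assms(1)] is_chart[OF assms(2)]
  show "open S" unfolding S_def
    using chart_facts(1)[OF ch(1)] chart_facts(1)[OF ch(2)] by (intro chart_facts(7)[OF ch(1)]) auto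
  note compatible[OF assms(1,2)]
  then show sm: "smooth_on S T" and "y \<in> S \<Longrightarrow> cmetric c y v w =
           cmetric d (T y) (frechet_derivative T (at y) v) (frechet_derivative T (at y) w)"
    unfolding compatible_def Let_def S_def T_def transition_def by blast+
  show "S \<subseteq> cimage c" by (auto simp: S_def cimage_def)
  show "y \<in> S \<Longrightarrow> T y \<in> cimage d" "y \<in> S \<Longrightarrow> param d (T y) = param c y"
    by (auto simp: S_def T_def transition_def param_coord[OF ch(1)] param_coord[OF ch(2)] cimage_def)
  show "inj_on T S"
    by (rule inj_onI) (auto simp: S_def T_def transition_def param_coord[OF ch(1)]
        dest: inj_onD[OF chart_facts(3)[OF ch(2)]])
  show "y \<in> S \<Longrightarrow> (T has_derivative frechet_derivative T (at y)) (at y)"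
    by (rule smooth_on_has_derivative[OF sm])
qed

lemma Ck_vol_density: "c \<in> atlas M \<Longrightarrow> Ck_on k (cimage c) (vol_density c)"
  unfolding vol_density_def[abs_def]
  by (intro Ck_on_sqrt_gram_det open_cimage smooth_metric posdef)

lemma continuous_vol_density: "c \<in> atlas M \<Longrightarrow> continuous_on (cimage c) (vol_density c)"
  using Ck_vol_density[of c 0] by simp

lemma vol_density_measurable:
  assumes "c \<in> atlas M"
  shows "vol_density c \<in> borel_measurable (restrict_space lborel (cimage c))"
proof -
  have "sets (restrict_space lborel (cimage c)) = sets (restrict_space borel (cimage c))"
    by (simp add: sets_restrict_space)
  then show ?thesis
    using borel_measurable_continuous_on_restrict[OF continuous_vol_density[OF assms]]
    by (simp cong: measurable_cong_sets)
qed

lemma vol_density_pos: "c \<in> atlas M \<Longrightarrow> y \<in> cimage c \<Longrightarrow> vol_density c y > 0"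
  unfolding vol_density_def using posdef_formD[OF posdef] by (auto intro!: gram_det_pos)

lemma vol_density_transition:
  assumes "c \<in> atlas M" "d \<in> atlas M" "y \<in> coord c ` (cdom c \<inter> cdom d)"
  shows "vol_density c y =
    \<bar>det (op_matrix (frechet_derivative (transition c d) (at y)))\<bar> * vol_density d (transition c d y)"
proof -
  note T = transition_facts[OF assms(1,2)]
  have "cmetric c y = (\<lambda>v w. cmetric d (transition c d y)
      (frechet_derivative (transition c d) (at y) v) (frechet_derivative (transition c d) (at y) w))"
    using T(8)[OF assms(3)] by (intro ext)
  moreover have "bilinear (cmetric d (transition c d y))"
    using posdef_formD(1)[OF posdef[OF assms(2) T(5)[OF assms(3)]]] .
  ultimately show ?thesis
    using gram_det_pullback[of "cmetric d (transition c d y)" "frechet_derivative (transition c d) (at y)"]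
    by (simp add: vol_density_def real_sqrt_mult)
qed

lemma emeasure_chart_measure:
  assumes c: "c \<in> atlas M" and A: "A \<in> sets (borel_of_top (mtop M))"
  shows "emeasure (chart_measure (mtop M) c) A =
    (\<integral>\<^sup>+y. ennreal (vol_density c y * indicator (coord c ` (A \<inter> cdom c)) y) \<partial>lborel)"
proof -
  note ch = is_chart[OF c]
  have oi[measurable]: "cimage c \<in> sets borel" using open_cimage[OF c] by simp
  have pm: "param c \<in> density (restrict_space lborel (cimage c)) (\<lambda>y. ennreal (vol_density c y))
      \<rightarrow>\<^sub>M borel_of_top (mtop M)"
    using param_measurable[OF ch] by (simp cong: measurable_cong_sets add: sets_restrict_space)
  have vm: "(\<lambda>y. ennreal (vol_density c y)) \<in> borel_measurable (restrict_space lborel (cimage c))"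
    by (rule measurable_compose[OF vol_density_measurable[OF c] measurable_ennreal])
  let ?B = "param c -` A \<inter> space (restrict_space lborel (cimage c))"
  have B: "?B = coord c ` (A \<inter> cdom c)"
    by (auto simp: space_restrict_space param_coord[OF ch] coord_in_cimage image_iff)
      (metis coord_param param_in_cdom IntI)
  have Bs: "?B \<in> sets (restrict_space lborel (cimage c))"
    using measurable_sets[OF pm A] by simp
  have "emeasure (chart_measure (mtop M) c) A =
      (\<integral>\<^sup>+y. ennreal (vol_density c y) * indicator ?B y \<partial>restrict_space lborel (cimage c))"
    unfolding chart_measure_def
    using emeasure_distr[OF pm A] emeasure_density[OF vm Bs] by simp
  also have "\<dots> = (\<integral>\<^sup>+y. ennreal (vol_density c y) * indicator ?B y * indicator (cimage c) y \<partial>lborel)"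
    by (rule nn_integral_restrict_space) simp
  also have "\<dots> = (\<integral>\<^sup>+y. ennreal (vol_density c y * indicator (coord c ` (A \<inter> cdom c)) y) \<partial>lborel)"
    unfolding B by (rule nn_integral_cong) (auto simp: indicator_def cimage_def)
  finally show ?thesis .
qed

text \<open>The Jacobian factor in the change of variables is exactly the quotient of the two
  densities, by \<open>vol_density_transition\<close>.\<close>

lemma chart_measure_compatible:
  assumes c: "c \<in> atlas M" and d: "d \<in> atlas M"
    and A: "A \<in> sets (borel_of_top (mtop M))" "A \<subseteq> cdom c" "A \<subseteq> cdom d"
  shows "emeasure (chart_measure (mtop M) c) A = emeasure (chart_measure (mtop M) d) A"
proof -
  define T where "T = transition c d"
  define B where "B = coord c ` A"
  define T' where "T' = (\<lambda>y. frechet_derivative T (at y))"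
  note Tf = transition_facts[OF c d, folded T_def]
  have BS: "B \<subseteq> coord c ` (cdom c \<inter> cdom d)" using A by (auto simp: B_def)
  have TB: "T ` B = coord d ` A"
    using A(2) by (auto simp: B_def T_def transition_def param_coord[OF is_chart[OF c]] image_iff subset_iff)
  have Bb: "B \<in> sets borel" "T ` B \<in> sets borel"
    unfolding TB using coord_image_borel[OF is_chart[OF c] A(1,2)] coord_image_borel[OF is_chart[OF d] A(1,3)]
    by (simp_all add: B_def)
  have eq: "\<bar>det (op_matrix (T' y))\<bar> * vol_density d (T y) * indicator B y = vol_density c y * indicator B y" for y
    using vol_density_transition[OF c d, of y] BS by (auto simp: indicator_def T_def T'_def)
  have "(\<integral>\<^sup>+y. ennreal (vol_density d y * indicator (T ` B) y) \<partial>lborel) =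
    (\<integral>\<^sup>+y. ennreal (\<bar>det (op_matrix (T' y))\<bar> * vol_density d (T y) * indicator B y) \<partial>lborel)"
  proof (rule nn_integral_change_of_variables[OF Bb(1)])
    show "(T has_derivative T' y) (at y within B)" if "y \<in> B" for y
      using Tf(7)[of y] that BS by (auto simp: T'_def intro: has_derivative_at_withinI)
    show "inj_on T B" using Tf(3) BS inj_on_subset by blast
    show "(\<lambda>y. vol_density d y * indicator (T ` B) y) \<in> borel_measurable borel"
      using continuous_vol_density[OF d] Bb(2) open_cimage[OF d] A(3)
      by (intro continuous_on_times_indicator_measurable[where S = "cimage d"]) (auto simp: TB cimage_def)
    show "(\<lambda>y. \<bar>det (op_matrix (T' y))\<bar> * vol_density d (T y) * indicator B y) \<in> borel_measurable borel"
      unfolding eq using continuous_vol_density[OF c] Bb(1) open_cimage[OF c] A(2)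
      by (intro continuous_on_times_indicator_measurable[where S = "cimage c"]) (auto simp: B_def cimage_def)
    show "vol_density d y \<ge> 0" if "y \<in> T ` B" for y
      using vol_density_pos[OF d, of y] that A(3) by (auto simp: TB cimage_def image_subset_iff subset_iff less_imp_le)
  qed
  then show ?thesis
    unfolding emeasure_chart_measure[OF c A(1)] emeasure_chart_measure[OF d A(1)] eq TB
    using A(2,3) by (simp add: B_def Int_absorb2)
qed

lemma finite_atlas:
  obtains C where "finite C" "C \<subseteq> atlas M" "(\<Union>c\<in>C. cdom c) = points M"
proof -
  obtain F where F: "finite F" "F \<subseteq> cdom ` atlas M" "\<Union>F = points M"
    using compact cover open_cdom unfolding compact_space by (metis (no_types, lifting) imageE)
  then obtain C where "C \<subseteq> atlas M" "finite C" "F = cdom ` C"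
    using finite_subset_image by metis
  then show thesis using that[of C] F by auto
qed

text \<open>Finitely many chart domains, each with the earlier ones removed. On every piece a single
  chart determines the measure, so existence and uniqueness reduce to finite sums.\<close>

lemma borel_partition:
  obtains n :: nat and cs :: "nat \<Rightarrow> ('a, 'e) rchart" and B :: "nat \<Rightarrow> 'a set" where
    "\<forall>j<n. cs j \<in> atlas M" "\<forall>j<n. B j \<subseteq> cdom (cs j)"
    "\<forall>j<n. B j \<in> sets (borel_of_top (mtop M))" "disjoint_family_on B {..<n}"
    "(\<Union>j<n. B j) = points M"
proof -
  obtain C where C: "finite C" "C \<subseteq> atlas M" "(\<Union>c\<in>C. cdom c) = points M" by (rule finite_atlas)
  obtain cs where cs: "bij_betw cs {..<card C} C"
    using ex_bij_betw_nat_finite[OF C(1)] atLeast0LessThan by auto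
  define B where "B j = cdom (cs j) - (\<Union>i<j. cdom (cs i))" for j
  have csa: "cs j \<in> atlas M" if "j < card C" for j using cs that C(2) by (auto simp: bij_betw_def)
  have "(\<Union>j<card C. B j) = (\<Union>j<card C. cdom (cs j))"
  proof (intro equalityI subsetI)
    fix p assume "p \<in> (\<Union>j<card C. cdom (cs j))"
    then have ex: "\<exists>j. j < card C \<and> p \<in> cdom (cs j)" by auto
    define j where "j = (LEAST j. j < card C \<and> p \<in> cdom (cs j))"
    have "j < card C" "p \<in> cdom (cs j)" using LeastI_ex[OF ex] by (auto simp: j_def)
    moreover have "p \<notin> cdom (cs i)" if "i < j" for i
      using not_less_Least[of i "\<lambda>j. j < card C \<and> p \<in> cdom (cs j)"] that \<open>j < card C\<close> by (auto simp: j_def)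
    ultimately show "p \<in> (\<Union>j<card C. B j)" by (auto simp: B_def)
  qed (auto simp: B_def)
  also have "\<dots> = \<Union>(cdom ` (cs ` {..<card C}))" by (simp add: image_image)
  also have "\<dots> = points M" by (simp only: bij_betw_imp_surj_on[OF cs] C(3))
  finally have "(\<Union>j<card C. B j) = points M" .
  moreover have "disjoint_family_on B {..<card C}"
    unfolding disjoint_family_on_def B_def by (auto simp: nat_neq_iff)
  moreover have "B j \<in> sets (borel_of_top (mtop M))" if "j < card C" for j
    unfolding B_def using that csa
    by (intro sets.Diff sets.finite_UN openin_sets_borel_of_top open_cdom) auto
  ultimately show thesis using that[of "card C" cs B] csa by (auto simp: B_def)
qed

lemma sum_emeasure_partition:
  fixes B :: "nat \<Rightarrow> 'a set"
  assumes "\<And>j. j < n \<Longrightarrow> B j \<in> sets (borel_of_top (mtop M))" "disjoint_family_on B {..<n}"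
    "(\<Union>j<n. B j) = points M" "sets \<nu> = sets (borel_of_top (mtop M))" "A \<in> sets \<nu>"
  shows "emeasure \<nu> A = (\<Sum>j<n. emeasure \<nu> (A \<inter> B j))"
proof -
  have "A \<subseteq> points M" using assms(4,5) sets.sets_into_space[of A "borel_of_top (mtop M)"] by simp
  then have "A = (\<Union>j<n. A \<inter> B j)" using assms(3) by auto
  moreover have "emeasure \<nu> (\<Union>j<n. A \<inter> B j) = (\<Sum>j<n. emeasure \<nu> (A \<inter> B j))"
    using assms by (intro sum_emeasure[symmetric]) (auto simp: disjoint_family_on_def)
  ultimately show ?thesis by simp
qed

lemma is_volume_measure_iff:
  "is_volume_measure M \<mu> \<longleftrightarrow> space \<mu> = points M \<and> sets \<mu> = sets (borel_of_top (mtop M)) \<and>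
    (\<forall>c\<in>atlas M. \<forall>A\<in>sets \<mu>. A \<subseteq> cdom c \<longrightarrow> emeasure \<mu> A = emeasure (chart_measure (mtop M) c) A)"
proof -
  have "(\<integral>\<^sup>+y\<in>coord c ` A. ennreal (sqrt (gram_det (cmetric c y))) \<partial>lborel) =
      emeasure (chart_measure (mtop M) c) A"
    if "c \<in> atlas M" "A \<in> sets (borel_of_top (mtop M))" "A \<subseteq> cdom c" for c A
    unfolding emeasure_chart_measure[OF that(1,2)] using that(3)
    by (intro nn_integral_cong) (auto simp: vol_density_def indicator_def Int_absorb2)
  then show ?thesis
    unfolding is_volume_measure_def sets_borel_of_top[symmetric] by (metis (no_types, lifting))
qed

lemma is_volume_measure_unique:
  assumes "is_volume_measure M \<mu>" "is_volume_measure M \<nu>"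
  shows "\<mu> = \<nu>"
proof -
  note m = assms[unfolded is_volume_measure_iff]
  obtain n :: nat and cs :: "nat \<Rightarrow> ('a, 'e) rchart" and B :: "nat \<Rightarrow> 'a set" where
    part: "\<forall>j<n. cs j \<in> atlas M" "\<forall>j<n. B j \<subseteq> cdom (cs j)"
    "\<forall>j<n. B j \<in> sets (borel_of_top (mtop M))" "disjoint_family_on B {..<n}"
    "(\<Union>j<n. B j) = points M" by (rule borel_partition)
  note p = part(1-3)[rule_format] part(4,5)
  show ?thesis
  proof (rule measure_eqI)
    show "sets \<mu> = sets \<nu>" using m by simp
    fix A assume A: "A \<in> sets \<mu>"
    have "emeasure \<mu> (A \<inter> B j) = emeasure \<nu> (A \<inter> B j)" if "j < n" for j
    proof -
      have "A \<inter> B j \<in> sets \<mu>" "A \<inter> B j \<in> sets \<nu>" "A \<inter> B j \<subseteq> cdom (cs j)"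
        using A p(2,3)[OF that] m by auto
      then show ?thesis using m p(1)[OF that] by metis
    qed
    then show "emeasure \<mu> A = emeasure \<nu> A"
      using sum_emeasure_partition[OF p(3-5), of \<mu> A] sum_emeasure_partition[OF p(3-5), of \<nu> A] m A by simp
  qed
qed

text \<open>Sum the chart measures over the pieces. Agreement with the measure of any other chart
  holds piece by piece, by \<open>chart_measure_compatible\<close>.\<close>

lemma is_volume_measure_exists: "\<exists>\<mu>. is_volume_measure M \<mu>"
proof -
  obtain n :: nat and cs :: "nat \<Rightarrow> ('a, 'e) rchart" and B :: "nat \<Rightarrow> 'a set" where
    part: "\<forall>j<n. cs j \<in> atlas M" "\<forall>j<n. B j \<subseteq> cdom (cs j)"
    "\<forall>j<n. B j \<in> sets (borel_of_top (mtop M))" "disjoint_family_on B {..<n}"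
    "(\<Union>j<n. B j) = points M" by (rule borel_partition)
  note p = part(1-3)[rule_format] part(4,5)
  let ?S = "sets (borel_of_top (mtop M))"
  have cm: "sets (chart_measure (mtop M) c) = ?S" for c by (simp add: chart_measure_def)
  define h where "h A = (\<Sum>j<n. emeasure (chart_measure (mtop M) (cs j)) (A \<inter> B j))" for A
  define \<mu> where "\<mu> = measure_of (points M) ?S h"
  have sp: "?S \<subseteq> Pow (points M)" using sets.space_closed[of "borel_of_top (mtop M)"] by simp
  have sa: "sigma_algebra (points M) ?S" using sets.sigma_algebra_axioms[of "borel_of_top (mtop M)"] by simp
  have s\<mu>: "sets \<mu> = ?S" "space \<mu> = points M"
    using sets_measure_of[OF sp] sigma_algebra.sigma_sets_eq[OF sa] by (simp_all add: \<mu>_def space_measure_of_conv)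
  have e\<mu>: "emeasure \<mu> A = h A" if A: "A \<in> ?S" for A
  proof (rule emeasure_measure_of[OF \<mu>_def sp])
    show "positive (sets \<mu>) h" by (simp add: positive_def h_def)
    show "A \<in> sets \<mu>" using A s\<mu> by simp
    show "countably_additive (sets \<mu>) h"
    proof (rule countably_additiveI)
      fix F :: "nat \<Rightarrow> 'a set" assume F: "range F \<subseteq> sets \<mu>" "disjoint_family F"
      have "(\<Sum>i. h (F i)) = (\<Sum>j<n. \<Sum>i. emeasure (chart_measure (mtop M) (cs j)) (F i \<inter> B j))"
        unfolding h_def by (rule suminf_sum) simp
      also have "\<dots> = (\<Sum>j<n. emeasure (chart_measure (mtop M) (cs j)) (\<Union>i. F i \<inter> B j))"
      proof (rule sum.cong[OF refl])
        fix j assume "j \<in> {..<n}"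
        then show "(\<Sum>i. emeasure (chart_measure (mtop M) (cs j)) (F i \<inter> B j)) =
            emeasure (chart_measure (mtop M) (cs j)) (\<Union>i. F i \<inter> B j)"
          using F p(3)[of j] s\<mu> by (intro suminf_emeasure) (auto simp: cm disjoint_family_on_def)
      qed
      finally show "(\<Sum>i. h (F i)) = h (\<Union>i. F i)" by (simp add: h_def)
    qed
  qed
  have "is_volume_measure M \<mu>"
    unfolding is_volume_measure_iff
  proof (intro conjI s\<mu> ballI impI)
    fix c A assume c: "c \<in> atlas M" and A: "A \<in> sets \<mu>" "A \<subseteq> cdom c"
    have "emeasure (chart_measure (mtop M) (cs j)) (A \<inter> B j) = emeasure (chart_measure (mtop M) c) (A \<inter> B j)"
      if "j < n" for j
      using A p(2,3)[OF that] s\<mu> by (intro chart_measure_compatible c p(1)[OF that]) auto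
    then show "emeasure \<mu> A = emeasure (chart_measure (mtop M) c) A"
      using sum_emeasure_partition[OF p(3-5), of "chart_measure (mtop M) c" A] A s\<mu>(1)
      by (simp add: e\<mu> h_def cm)
  qed
  then show ?thesis by blast
qed

lemma is_volume_measure: "is_volume_measure M (volume_measure M)"
  unfolding volume_measure_def
  using is_volume_measure_exists is_volume_measure_unique by (metis the_equality)

lemma sets_volume_measure [simp]: "sets (volume_measure M) = sets (borel_of_top (mtop M))"
  and space_volume_measure [simp]: "space (volume_measure M) = points M"
  and emeasure_volume_measure: "c \<in> atlas M \<Longrightarrow> A \<in> sets (borel_of_top (mtop M)) \<Longrightarrow> A \<subseteq> cdom c \<Longrightarrow>
    emeasure (volume_measure M) A = emeasure (chart_measure (mtop M) c) A"
  using is_volume_measure unfolding is_volume_measure_iff by auto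

text \<open>The density is bounded on a closed ball inside the image of a chart, so every point has
  a neighbourhood of finite volume; compactness leaves finitely many of them.\<close>

lemma finite_volume_measure: "finite_measure (volume_measure M)"
proof
  have ex: "\<exists>V. openin (mtop M) V \<and> p \<in> V \<and> emeasure (volume_measure M) V < \<infinity>" if p: "p \<in> points M" for p
  proof -
    define c where "c = chart_at M p"
    have c: "c \<in> atlas M" "p \<in> cdom c" using chart_at[OF p] by (auto simp: c_def)
    note ch = is_chart[OF c(1)]
    obtain r where r: "r > 0" "cball (coord c p) r \<subseteq> cimage c"
      using open_cimage[OF c(1)] coord_in_cimage[OF c(2)] open_contains_cball by blast
    define U where "U = ball (coord c p) r"
    have U: "U \<subseteq> cimage c" "open U" using r(2) ball_subset_cball[of "coord c p" r] by (auto simp: U_def)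
    let ?V = "param c ` U"
    have oV: "openin (mtop M) ?V" by (rule chart_facts(8)[OF ch U])
    have Vc: "?V \<subseteq> cdom c" using U(1) by (auto intro!: param_in_cdom)
    have UV: "coord c ` (?V \<inter> cdom c) = U"
    proof -
      have "?V \<inter> cdom c = ?V" using Vc by blast
      moreover have "coord c ` ?V = U"
        unfolding image_image using U(1) coord_param by (metis (no_types, lifting) image_cong image_ident subsetD)
      ultimately show ?thesis by simp
    qed
    have "compact (vol_density c ` cball (coord c p) r)"
      using continuous_on_subset[OF continuous_vol_density[OF c(1)] r(2)] compact_cball
      by (rule compact_continuous_image)
    then obtain K where K: "\<forall>y\<in>cball (coord c p) r. \<bar>vol_density c y\<bar> \<le> K"
      using compact_imp_bounded[of "vol_density c ` cball (coord c p) r"] unfolding bounded_iff by auto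
    have KU: "vol_density c y \<le> K" if "y \<in> U" for y
      using K[rule_format, of y] that by (simp add: U_def)
    have "emeasure (volume_measure M) ?V = (\<integral>\<^sup>+y. ennreal (vol_density c y * indicator U y) \<partial>lborel)"
      using emeasure_volume_measure[OF c(1) openin_sets_borel_of_top[OF oV] Vc]
        emeasure_chart_measure[OF c(1) openin_sets_borel_of_top[OF oV]] unfolding UV by simp
    also have "\<dots> \<le> (\<integral>\<^sup>+y. ennreal K * indicator U y \<partial>lborel)"
      by (rule nn_integral_mono) (use KU in \<open>auto split: split_indicator intro!: ennreal_leI\<close>)
    also have "\<dots> = ennreal K * emeasure lborel U"
      using U(2) by (intro nn_integral_cmult_indicator) simp
    also have "\<dots> < \<infinity>"
      using emeasure_lborel_ball_finite[of "coord c p" r] by (simp add: U_def ennreal_mult_less_top)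
    finally show ?thesis
      using oV r(1) param_coord[OF ch c(2)] by (auto simp: U_def intro!: exI[of _ ?V] image_eqI[of p "param c" "coord c p"])
  qed
  define \<V> where "\<V> = {V. openin (mtop M) V \<and> emeasure (volume_measure M) V < \<infinity>}"
  have op: "\<forall>V\<in>\<V>. openin (mtop M) V" by (simp add: \<V>_def)
  have "\<Union>\<V> = points M"
  proof (intro equalityI subsetI)
    fix p assume "p \<in> points M"
    from ex[OF this] show "p \<in> \<Union>\<V>" unfolding \<V>_def by blast
  qed (use op openin_subset in blast)
  then obtain \<F> where F: "finite \<F>" "\<F> \<subseteq> \<V>" "\<Union>\<F> = points M"
    using compact op unfolding compact_space by meson
  have "emeasure (volume_measure M) (\<Union>V\<in>\<F>. V) \<le> (\<Sum>V\<in>\<F>. emeasure (volume_measure M) V)"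
    using F by (intro emeasure_subadditive_finite) (auto simp: \<V>_def intro: openin_sets_borel_of_top)
  also have "\<dots> < \<infinity>" using F by (auto simp: \<V>_def less_top[symmetric])
  finally show "emeasure (volume_measure M) (space (volume_measure M)) \<noteq> \<infinity>"
    using F(3) by (simp add: less_top[symmetric])
qed

text \<open>Restricted to \<open>cdom c\<close>, the volume measure is \<open>chart_measure\<close>,
  a pushforward of a density, and the integral unwinds through these constructions. The support
  condition permits the restriction.\<close>

lemma integral_in_chart:
  fixes F :: "'a \<Rightarrow> real"
  assumes c: "c \<in> atlas M" and F: "F \<in> borel_measurable (borel_of_top (mtop M))"
    and supp: "\<And>p. p \<in> points M \<Longrightarrow> p \<notin> cdom c \<Longrightarrow> F p = 0"
  shows "integral\<^sup>L (volume_measure M) F =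
    (\<integral>y. indicator (cimage c) y * (vol_density c y * F (param c y)) \<partial>lborel)"
proof -
  note ch = is_chart[OF c]
  have D: "cdom c \<in> sets (borel_of_top (mtop M))" by (rule openin_sets_borel_of_top[OF open_cdom[OF c]])
  have oi[measurable]: "cimage c \<in> sets borel" using open_cimage[OF c] by simp
  have pm: "param c \<in> density (restrict_space lborel (cimage c)) (\<lambda>y. ennreal (vol_density c y))
      \<rightarrow>\<^sub>M borel_of_top (mtop M)"
    using param_measurable[OF ch] by (simp cong: measurable_cong_sets add: sets_restrict_space)
  have pm2: "param c \<in> restrict_space lborel (cimage c) \<rightarrow>\<^sub>M borel_of_top (mtop M)"
    using param_measurable[OF ch] by (simp cong: measurable_cong_sets add: sets_restrict_space)
  note vm = vol_density_measurable[OF c]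
  have m: "(\<lambda>p. ennreal (indicator (cdom c) p)) \<in> borel_measurable (volume_measure M)"
    using D by (intro measurable_compose[OF borel_measurable_indicator measurable_ennreal]) simp
  have eq: "density (volume_measure M) (\<lambda>p. ennreal (indicator (cdom c) p)) = chart_measure (mtop M) c"
  proof (rule measure_eqI)
    show "sets (density (volume_measure M) (\<lambda>p. ennreal (indicator (cdom c) p))) = sets (chart_measure (mtop M) c)"
      by (simp add: chart_measure_def)
    fix A assume "A \<in> sets (density (volume_measure M) (\<lambda>p. ennreal (indicator (cdom c) p)))"
    then have A: "A \<in> sets (borel_of_top (mtop M))" by simp
    have "emeasure (density (volume_measure M) (\<lambda>p. ennreal (indicator (cdom c) p))) A =
        (\<integral>\<^sup>+p. indicator (A \<inter> cdom c) p \<partial>volume_measure M)"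
      using A m by (subst emeasure_density) (auto simp: ennreal_indicator intro!: nn_integral_cong split: split_indicator)
    also have "\<dots> = emeasure (volume_measure M) (A \<inter> cdom c)"
      using A D by (intro nn_integral_indicator) auto
    also have "\<dots> = emeasure (chart_measure (mtop M) c) (A \<inter> cdom c)"
      using A D by (intro emeasure_volume_measure[OF c]) auto
    also have "\<dots> = emeasure (chart_measure (mtop M) c) A"
      using A D by (simp add: emeasure_chart_measure[OF c])
    finally show "emeasure (density (volume_measure M) (\<lambda>p. ennreal (indicator (cdom c) p))) A =
        emeasure (chart_measure (mtop M) c) A" .
  qed
  have "integral\<^sup>L (volume_measure M) F = (\<integral>p. indicator (cdom c) p *\<^sub>R F p \<partial>volume_measure M)"
    by (rule Bochner_Integration.integral_cong) (use supp in \<open>auto simp: indicator_def\<close>)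
  also have "\<dots> = integral\<^sup>L (density (volume_measure M) (\<lambda>p. ennreal (indicator (cdom c) p))) F"
    using F D by (intro integral_density[symmetric]) (auto cong: measurable_cong_sets)
  also have "\<dots> = (\<integral>y. F (param c y) \<partial>density (restrict_space lborel (cimage c)) (\<lambda>y. ennreal (vol_density c y)))"
    unfolding eq chart_measure_def by (rule integral_distr[OF pm F])
  also have "\<dots> = (\<integral>y. vol_density c y *\<^sub>R F (param c y) \<partial>restrict_space lborel (cimage c))"
    using measurable_compose[OF pm2 F] vm vol_density_pos[OF c]
    by (intro integral_density) (auto simp: space_restrict_space less_imp_le intro!: AE_I2)
  also have "\<dots> = (\<integral>y. indicator (cimage c) y *\<^sub>R (vol_density c y *\<^sub>R F (param c y)) \<partial>lborel)"
    by (rule integral_restrict_space) simp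
  finally show ?thesis by simp
qed

end

section \<open>The divergence form of the Laplacian\<close>

lemma integral_lborel_translate:
  fixes h :: "'e::euclidean_space \<Rightarrow> real"
  assumes "h \<in> borel_measurable borel"
  shows "(\<integral>y. h (c + y) \<partial>lborel) = (\<integral>y. h y \<partial>lborel)"
proof -
  have "(\<integral>y. h y \<partial>distr lborel borel ((+) c)) = (\<integral>y. h (c + y) \<partial>lborel)"
    using assms by (intro integral_distr) auto
  then show ?thesis by (simp add: lborel_distr_plus)
qed

lemma integrable_continuous_compact_support:
  fixes h :: "'e::euclidean_space \<Rightarrow> real"
  assumes "continuous_on UNIV h" "\<And>y. y \<notin> cball a r \<Longrightarrow> h y = 0"
  shows "integrable lborel h"
proof -
  have "set_integrable lborel (cball a r) h"
    unfolding set_integrable_def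
    using borel_integrable_compact[of "cball a r" h] continuous_on_subset[OF assms(1)] by (auto simp: indicator_scaleR_eq_if)
  moreover have "(\<lambda>y. indicator (cball a r) y *\<^sub>R h y) = h"
    using assms(2) by (auto simp: fun_eq_iff indicator_def)
  ultimately show ?thesis by (simp add: set_integrable_def)
qed

text \<open>Translation invariance of the integral, differentiated under the integral sign.\<close>

lemma integral_derivative_compact_support:
  fixes h :: "'e::euclidean_space \<Rightarrow> real"
  assumes der: "\<And>y. (h has_derivative h' y) (at y)" and cont: "continuous_on UNIV (\<lambda>y. h' y b)"
    and supp: "\<And>y. y \<notin> cball a r \<Longrightarrow> h y = 0"
  shows "(\<integral>y. h' y b \<partial>lborel) = 0"
proof -
  have hc: "continuous_on UNIV h"
    using der by (meson continuous_at_imp_continuous_on has_derivative_continuous)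
  then have hm[measurable]: "h \<in> borel_measurable borel" by (rule borel_measurable_continuous_onI)
  have hm'[measurable]: "(\<lambda>y. h' y b) \<in> borel_measurable borel" by (rule borel_measurable_continuous_onI[OF cont])
  have supp': "h' y b = 0" if "y \<notin> cball a r" for y
  proof -
    have "(h has_derivative (\<lambda>v. 0)) (at y)"
      by (rule has_derivative_transform_within_open[of "\<lambda>y. 0" _ _ _ "- cball a r"]) (use supp that in auto)
    then have "h' y = (\<lambda>v. 0)" using has_derivative_unique der by blast
    then show ?thesis by simp
  qed
  have "compact ((\<lambda>y. h' y b) ` cball a r)"
    using continuous_on_subset[OF cont] by (intro compact_continuous_image) auto
  then obtain L0 where "\<forall>y\<in>cball a r. \<bar>h' y b\<bar> \<le> L0"
    using compact_imp_bounded[of "(\<lambda>y. h' y b) ` cball a r"] unfolding bounded_iff by auto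
  then have L: "\<bar>h' y b\<bar> \<le> \<bar>L0\<bar>" for y
    using supp'[of y] by (cases "y \<in> cball a r") force+
  define q where "q n y = (h (inverse (real (Suc n)) *\<^sub>R b + y) - h y) * real (Suc n)" for n y
  have line: "((\<lambda>t. h (y + t *\<^sub>R b)) has_real_derivative h' (y + t *\<^sub>R b) b) (at t)" for y t
  proof -
    have "((\<lambda>t. y + t *\<^sub>R b) has_derivative (\<lambda>s. s *\<^sub>R b)) (at t)"
      by (auto intro!: derivative_eq_intros)
    from has_derivative_compose[OF this der]
    have d: "((\<lambda>t. h (y + t *\<^sub>R b)) has_derivative (\<lambda>s. h' (y + t *\<^sub>R b) (s *\<^sub>R b))) (at t)" .
    have "(\<lambda>s. h' (y + t *\<^sub>R b) (s *\<^sub>R b)) = (*) (h' (y + t *\<^sub>R b) b)"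
      using linear_cmul[OF has_derivative_linear[OF der]] by (auto simp: fun_eq_iff mult.commute)
    with d show ?thesis unfolding has_field_derivative_def by simp
  qed
  have qb: "\<bar>q n y\<bar> \<le> \<bar>L0\<bar>" for n y
  proof -
    define t where "t = inverse (real (Suc n))"
    have t: "t > 0" by (simp add: t_def)
    obtain s where "h (y + t *\<^sub>R b) - h (y + 0 *\<^sub>R b) = (t - 0) * h' (y + s *\<^sub>R b) b"
      using MVT2[of 0 t "\<lambda>t. h (y + t *\<^sub>R b)" "\<lambda>t. h' (y + t *\<^sub>R b) b"] line t by blast
    then have "q n y = h' (y + s *\<^sub>R b) b" using t by (simp add: q_def t_def[symmetric] add.commute) (simp add: t_def)
    then show ?thesis using L by simp
  qed
  \<comment> \<open>The translations have length at most \<open>norm b\<close>, so all difference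
    quotients vanish outside one common ball; together with \<open>qb\<close> this gives an
    integrable majorant.\<close>
  have q0: "q n y = 0" if "y \<notin> cball a (\<bar>r\<bar> + norm b)" for n y
  proof -
    define t where "t = inverse (real (Suc n))"
    have t: "0 \<le> t" "t \<le> 1" by (auto simp: t_def field_simps)
    have "norm (t *\<^sub>R b) \<le> norm b" using t by (simp add: mult_left_le_one_le)
    moreover have "norm (a - y) > \<bar>r\<bar> + norm b" using that by (simp add: dist_norm)
    moreover have "norm (a - y) \<le> norm (a - (t *\<^sub>R b + y)) + norm (t *\<^sub>R b)"
      using norm_triangle_ineq[of "a - (t *\<^sub>R b + y)" "t *\<^sub>R b"] by (simp add: algebra_simps)
    ultimately have "norm (a - (t *\<^sub>R b + y)) > r" "norm (a - y) > r"
      using norm_ge_zero[of b] by linarith+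
    then have "h (t *\<^sub>R b + y) = 0" "h y = 0" by (auto intro!: supp simp: dist_norm)
    then show ?thesis unfolding q_def t_def[symmetric] by simp
  qed
  have "(\<lambda>n. integral\<^sup>L lborel (q n)) \<longlonglongrightarrow> (\<integral>y. h' y b \<partial>lborel)"
  proof (rule integral_dominated_convergence)
    show "integrable lborel (\<lambda>y. \<bar>L0\<bar> * indicator (cball a (\<bar>r\<bar> + norm b)) y)"
      by (intro integrable_mult_right integrable_real_indicator)
        (use emeasure_lborel_cball_finite[of a "\<bar>r\<bar> + norm b"] in auto)
    show "AE y in lborel. norm (q n y) \<le> \<bar>L0\<bar> * indicator (cball a (\<bar>r\<bar> + norm b)) y" for n
      using qb[of n] q0[of _ n] by (intro AE_I2) (auto simp: indicator_def)
    show "AE y in lborel. (\<lambda>n. q n y) \<longlonglongrightarrow> h' y b"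
    proof (intro AE_I2)
      fix y
      have "((\<lambda>t. (h (y + t *\<^sub>R b) - h y) / t) \<longlongrightarrow> h' y b) (at 0)"
        using line[of y 0] by (simp add: has_field_derivative_iff)
      moreover have "filterlim (\<lambda>n. inverse (real (Suc n))) (at 0) sequentially"
        using LIMSEQ_inverse_real_of_nat by (simp add: filterlim_at)
      ultimately have "(\<lambda>n. (h (y + inverse (real (Suc n)) *\<^sub>R b) - h y) / inverse (real (Suc n))) \<longlonglongrightarrow> h' y b"
        by (rule filterlim_compose)
      then show "(\<lambda>n. q n y) \<longlonglongrightarrow> h' y b" by (simp add: q_def field_simps)
    qed
  qed (auto simp: q_def[abs_def])
  moreover have "integral\<^sup>L lborel (q n) = 0" for n
  proof -
    have i: "integrable lborel h" by (rule integrable_continuous_compact_support[OF hc supp])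
    have s: "(\<integral>y. h (inverse (real (Suc n)) *\<^sub>R b + y) \<partial>lborel) = (\<integral>y. h y \<partial>lborel)"
      by (rule integral_lborel_translate[OF hm])
    have "integrable (distr lborel borel ((+) (inverse (real (Suc n)) *\<^sub>R b))) h"
      using i by (simp add: lborel_distr_plus)
    then have i2: "integrable lborel (\<lambda>y. h (inverse (real (Suc n)) *\<^sub>R b + y))"
      by (subst (asm) integrable_distr_eq) auto
    show ?thesis unfolding q_def using s i i2 by simp
  qed
  ultimately show ?thesis by (simp add: LIMSEQ_const_iff)
qed

text \<open>The flat divergence in coordinates. The metric enters only through the field it is
  applied to, the density times the gradient.\<close>

definition divergence :: "('e::euclidean_space \<Rightarrow> 'e) \<Rightarrow> 'e \<Rightarrow> real" where
  "divergence X y = (\<Sum>b\<in>Basis. frechet_derivative X (at y) b \<bullet> b)"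

lemma Ck_on_divergence:
  assumes "open S" "Ck_on (Suc k) S X"
  shows "Ck_on k S (divergence X)"
  unfolding divergence_def[abs_def]
  by (intro Ck_on_sum Ck_on_inner Ck_on_const assms(1) Ck_on_SucD(2)[OF assms(2)])

text \<open>The bump times \<open>X\<close>, extended by zero, is differentiable on the whole space,
  and the derivative of each component in its own direction integrates to zero. The product rule
  splits the sum of these derivatives into the two integrands.\<close>

lemma integration_by_parts_bump:
  fixes X :: "'e::euclidean_space \<Rightarrow> 'e"
  assumes S: "open S" and X: "Ck_on 1 S X" and r: "r > 0" "cball a r \<subseteq> S"
  shows "(\<integral>y. indicator S y * frechet_derivative (bump a r) (at y) (X y) \<partial>lborel) =
    - (\<integral>y. indicator S y * (bump a r y * divergence X y) \<partial>lborel)"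
    and "integrable lborel (\<lambda>y. indicator S y * frechet_derivative (bump a r) (at y) (X y))"
    and "integrable lborel (\<lambda>y. indicator S y * (bump a r y * divergence X y))"
proof -
  let ?\<psi> = "bump a r" and ?\<psi>' = "\<lambda>y. frechet_derivative (bump a r) (at y)"
  let ?X' = "\<lambda>y. frechet_derivative X (at y)"
  have b1: "Ck_on 1 UNIV ?\<psi>" by (rule Ck_on_bump)
  have \<psi>: "(?\<psi> has_derivative ?\<psi>' y) (at y)" for y using Ck_on_SucD(1)[of 0 UNIV ?\<psi>] b1 by simp
  have Xd: "(X has_derivative ?X' y) (at y)" if "y \<in> S" for y using Ck_on_SucD(1)[of 0 S X] X that by simp
  have out: "?\<psi> y = 0" "?\<psi>' y = (\<lambda>v. 0)" if "y \<notin> cball a r" for y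
  proof -
    show 0: "?\<psi> y = 0" using bump_eq_0[OF r(1), of y a] that by auto
    have "(?\<psi> has_derivative (\<lambda>v. 0)) (at y)"
      by (rule has_derivative_transform_within_open[of "\<lambda>y. 0" _ _ _ "- cball a r"])
        (use that bump_eq_0[OF r(1), of _ a] in auto)
    then show "?\<psi>' y = (\<lambda>v. 0)" using has_derivative_unique \<psi> by blast
  qed
  have glue: "continuous_on UNIV (\<lambda>y. if y \<in> S then f y else 0)" if f: "continuous_on S f" "\<And>y. y \<notin> cball a r \<Longrightarrow> f y = 0"
    for f :: "'e \<Rightarrow> real"
  proof -
    have "continuous_on (S \<union> - cball a r) (\<lambda>y. if y \<in> S then f y else 0)"
    proof (rule continuous_on_open_Un[OF S])
      show "continuous_on S (\<lambda>y. if y \<in> S then f y else 0)" using f(1) by (auto cong: continuous_on_cong)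
      have "continuous_on (- cball a r) (\<lambda>y. 0 :: real)" by simp
      then show "continuous_on (- cball a r) (\<lambda>y. if y \<in> S then f y else 0)"
        by (rule continuous_on_eq) (use f(2) in auto)
    qed auto
    moreover have "S \<union> - cball a r = UNIV" using r(2) by auto
    ultimately show ?thesis by simp
  qed
  define Y where "Y b y = (if y \<in> S then ?\<psi> y * (X y \<bullet> b) else 0)" for b y
  define Y' where "Y' b y v = (if y \<in> S then ?\<psi>' y v * (X y \<bullet> b) + ?\<psi> y * (?X' y v \<bullet> b) else 0)" for b y v
  have Yd: "(Y b has_derivative Y' b y) (at y)" for b y
  proof (cases "y \<in> S")
    case True
    have "((\<lambda>y. ?\<psi> y * (X y \<bullet> b)) has_derivative (\<lambda>v. ?\<psi> y * (?X' y v \<bullet> b) + ?\<psi>' y v * (X y \<bullet> b))) (at y)"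
      by (rule has_derivative_mult[OF \<psi> has_derivative_inner_left[OF Xd[OF True]]])
    then have "((\<lambda>y. ?\<psi> y * (X y \<bullet> b)) has_derivative Y' b y) (at y)"
      using True by (simp add: Y'_def[abs_def] add.commute)
    then show ?thesis
      by (rule has_derivative_transform_within_open[OF _ S True]) (simp add: Y_def)
  next
    case False
    then have "y \<in> - cball a r" using r(2) by auto
    have "((\<lambda>y. 0) has_derivative Y' b y) (at y)" using False by (simp add: Y'_def[abs_def])
    then show ?thesis
      by (rule has_derivative_transform_within_open[OF _ _ \<open>y \<in> - cball a r\<close>]) (auto simp: Y_def out)
  qed
  have c\<psi>: "continuous_on S (\<lambda>y. ?\<psi>' y v)" "continuous_on S ?\<psi>" for v
    using Ck_on_SucD(2)[of 0 UNIV ?\<psi> v] Ck_on_imp_continuous_on[OF b1] b1 continuous_on_subset by auto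
  have cX: "continuous_on S (\<lambda>y. ?X' y v)" "continuous_on S X" for v
    using Ck_on_SucD(2)[of 0 S X v] Ck_on_imp_continuous_on[OF X] X by auto
  have out': "?\<psi>' y v * (X y \<bullet> b) + ?\<psi> y * (?X' y v \<bullet> b) = 0" if "y \<notin> cball a r" for y v b
    using out[OF that] by simp
  have Yc: "continuous_on UNIV (\<lambda>y. Y' b y b)" for b
    unfolding Y'_def by (rule glue[OF _ out']) (intro continuous_intros c\<psi> cX)
  have Y0: "Y b y = 0" if "y \<notin> cball a r" for b y using out[OF that] by (simp add: Y_def)
  have Yi0: "(\<integral>y. Y' b y b \<partial>lborel) = 0" for b
    by (rule integral_derivative_compact_support[OF Yd Yc Y0])
  have Yi: "integrable lborel (\<lambda>y. Y' b y b)" for b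
    by (rule integrable_continuous_compact_support[OF Yc, where a = a and r = r]) (simp add: Y'_def out')
  have lin: "linear (?\<psi>' y)" for y using has_derivative_linear[OF \<psi>] .
  have e1: "(\<Sum>b\<in>Basis. ?\<psi>' y b * (X y \<bullet> b)) = ?\<psi>' y (X y)" for y
  proof -
    have "?\<psi>' y (\<Sum>b\<in>Basis. (X y \<bullet> b) *\<^sub>R b) = (\<Sum>b\<in>Basis. ?\<psi>' y b * (X y \<bullet> b))"
      by (simp add: linear_sum[OF lin] linear_cmul[OF lin] mult.commute)
    then show ?thesis by (simp add: euclidean_representation)
  qed
  let ?F = "\<lambda>y. indicator S y * ?\<psi>' y (X y)" and ?G = "\<lambda>y. indicator S y * (?\<psi> y * divergence X y)"
  have sum: "(\<Sum>b\<in>Basis. Y' b y b) = ?F y + ?G y" for y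
    by (cases "y \<in> S") (simp_all add: Y'_def sum.distrib e1 divergence_def sum_distrib_left)
  have G: "?G = (\<lambda>y. if y \<in> S then ?\<psi> y * divergence X y else 0)"
    by (auto simp: fun_eq_iff)
  show iG: "integrable lborel ?G"
    unfolding G
  proof (rule integrable_continuous_compact_support[OF glue])
    show "continuous_on S (\<lambda>y. ?\<psi> y * divergence X y)"
      using Ck_on_divergence[OF S, of 0 X] X by (intro continuous_intros c\<psi>) simp
  qed (use out in auto)
  have iFG: "integrable lborel (\<lambda>y. ?F y + ?G y)" "(\<integral>y. ?F y + ?G y \<partial>lborel) = 0"
    unfolding sum[symmetric] using Yi Yi0 by simp_all
  from iFG(1) iG have "integrable lborel (\<lambda>y. (?F y + ?G y) - ?G y)" by (rule Bochner_Integration.integrable_diff)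
  then show iF: "integrable lborel ?F" by simp
  show "integral\<^sup>L lborel ?F = - integral\<^sup>L lborel ?G"
    using iFG(2) Bochner_Integration.integral_add[OF iF iG] by simp
qed

text \<open>The fundamental lemma of the calculus of variations in one-sided form: if
  \<open>Q y0\<close> were positive, the integral against a small bump at \<open>y0\<close> would be
  positive. Applied to \<open>Q\<close> and \<open>- Q\<close> it yields equality.\<close>

lemma bump_test_zero:
  fixes Q :: "'e::euclidean_space \<Rightarrow> real"
  assumes S: "open S" "y0 \<in> S" and Q: "continuous_on S Q"
    and test: "\<And>r. r > 0 \<Longrightarrow> cball y0 r \<subseteq> S \<Longrightarrow> (\<integral>y. indicator S y * (bump y0 r y * Q y) \<partial>lborel) = 0"
  shows "Q y0 \<le> 0"
proof (rule ccontr)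
  assume "\<not> Q y0 \<le> 0"
  then have pos: "Q y0 > 0" by simp
  have o: "open (S \<inter> Q -` {0<..})" using continuous_open_preimage[OF Q S(1)] by auto
  have "y0 \<in> S \<inter> Q -` {0<..}" using pos S(2) by simp
  then obtain r where r: "r > 0" "cball y0 r \<subseteq> S \<inter> Q -` {0<..}"
    using open_contains_cball[THEN iffD1, OF o, rule_format] by metis
  define h where "h y = indicator S y * (bump y0 r y * Q y)" for y
  have zero: "bump y0 r y = 0" if "y \<notin> cball y0 r" for y using bump_eq_0[OF r(1), of y y0] that by auto
  have "continuous_on (S \<union> - cball y0 r) (\<lambda>y. if y \<in> S then bump y0 r y * Q y else 0)"
  proof (rule continuous_on_open_Un[OF S(1)])
    have "continuous_on S (bump y0 r)" using Ck_on_imp_continuous_on[OF Ck_on_bump] continuous_on_subset by blast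
    then have "continuous_on S (\<lambda>y. bump y0 r y * Q y)" using Q by (intro continuous_intros)
    then show "continuous_on S (\<lambda>y. if y \<in> S then bump y0 r y * Q y else 0)"
      by (auto cong: continuous_on_cong)
    have "continuous_on (- cball y0 r) (\<lambda>y. 0 :: real)" by simp
    then show "continuous_on (- cball y0 r) (\<lambda>y. if y \<in> S then bump y0 r y * Q y else 0)"
      by (rule continuous_on_eq) (use zero in auto)
  qed auto
  moreover have "S \<union> - cball y0 r = UNIV" using r(2) by auto
  moreover have "h = (\<lambda>y. if y \<in> S then bump y0 r y * Q y else 0)" by (auto simp: h_def fun_eq_iff)
  ultimately have "continuous_on UNIV h" by simp
  then have int: "integrable lborel h"
    by (rule integrable_continuous_compact_support[where a = y0 and r = r]) (simp add: h_def zero)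
  have nonneg: "h y \<ge> 0" for y
    using r(2) zero[of y] bump_nonneg[of y0 r y] by (cases "y \<in> cball y0 r") (auto simp: h_def subset_iff less_imp_le)
  have "integral\<^sup>L lborel h = 0" unfolding h_def using test r by auto
  then have "AE y in lborel. h y = 0"
    using integral_nonneg_eq_0_iff_AE[OF int] nonneg by simp
  then have "{y. h y \<noteq> 0} \<in> null_sets lborel"
    using int by (subst (asm) AE_iff_null) (auto dest!: borel_measurable_integrable)
  moreover have "ball y0 r \<subseteq> {y. h y \<noteq> 0}"
  proof
    fix y assume y: "y \<in> ball y0 r"
    then have "y \<in> S \<inter> Q -` {0<..}" using r(2) ball_subset_cball by blast
    then have "bump y0 r y > 0" "y \<in> S" "Q y > 0"
      using bump_pos_iff[OF r(1)] y by auto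
    then show "y \<in> {y. h y \<noteq> 0}" by (simp add: h_def)
  qed
  ultimately have "ball y0 r \<in> null_sets lborel"
    by (metis null_sets_subset open_ball borel_open sets_lborel)
  then have "negligible (ball y0 r)"
    by (simp add: negligible_iff_null_sets null_sets_completionI)
  then show False using open_not_negligible[of "ball y0 r"] r(1) by simp
qed

text \<open>Expanding \<open>divergence (D *\<^sub>R \<nabla>f)\<close> along a \<open>g\<close>-orthonormal basis at \<open>y\<close> leaves only second
  derivatives of \<open>f\<close> along straight lines and a first-order term.\<close>

definition drift_coeff ::
    "('e::euclidean_space \<Rightarrow> 'e \<Rightarrow> 'e \<Rightarrow> real) \<Rightarrow> ('e \<Rightarrow> real) \<Rightarrow> 'e set \<Rightarrow> 'e \<Rightarrow> 'e \<Rightarrow> real" where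
  "drift_coeff g D E y a = frechet_derivative D (at y) a / D y -
     (\<Sum>e\<in>E. frechet_derivative (\<lambda>z. g z a e) (at y) e)"

text \<open>Let \<open>v\<close> be the gradient of \<open>f\<close>. Differentiating the identity
  \<open>g z (v z) e = frechet_derivative f (at z) e\<close> at \<open>y\<close> in the direction
  \<open>e\<close> expresses \<open>g y (v' e) e\<close> as the second derivative of
  \<open>f\<close> along \<open>e\<close> minus a term from the derivative of \<open>g\<close>. That
  term is linear in the first derivatives of \<open>f\<close> and joins the derivative of
  \<open>D\<close> in the drift.\<close>

lemma divergence_gradient_expand:
  fixes g :: "'e::euclidean_space \<Rightarrow> 'e \<Rightarrow> 'e \<Rightarrow> real"
  assumes S: "open S" "y \<in> S" and g: "\<And>v w. Ck_on 1 S (\<lambda>z. g z v w)" "\<And>z. z \<in> S \<Longrightarrow> posdef_form (g z)"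
    and D: "Ck_on 1 S D" "D y \<noteq> 0" and f: "Ck_on 2 S f"
    and E: "\<And>w. w = (\<Sum>e\<in>E. g y w e *\<^sub>R e)"
  shows "divergence (\<lambda>z. D z *\<^sub>R riesz (g z) (frechet_derivative f (at z))) y =
    D y * ((\<Sum>e\<in>E. frechet_derivative (\<lambda>z. frechet_derivative f (at z) e) (at y) e) +
           (\<Sum>e\<in>E. frechet_derivative f (at y) e * drift_coeff g D E y e))"
proof -
  let ?f' = "\<lambda>z. frechet_derivative f (at z)"
  define v where "v z = riesz (g z) (?f' z)" for z
  have f2: "Ck_on (Suc 1) S f" using f by (simp add: numeral_2_eq_2)
  have fd: "(f has_derivative ?f' z) (at z)" if "z \<in> S" for z using Ck_on_SucD(1)[OF f2 that] .
  have flin: "linear (?f' z)" if "z \<in> S" for z using has_derivative_linear[OF fd[OF that]] .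
  have vC: "Ck_on 1 S v"
    unfolding v_def[abs_def] by (rule Ck_on_riesz[OF S(1) g Ck_on_SucD(2)[OF f2] flin])
  define v' where "v' = frechet_derivative v (at y)"
  define D' where "D' = frechet_derivative D (at y)"
  define g' where "g' a e = frechet_derivative (\<lambda>z. g z a e) (at y)" for a e
  have vd: "(v has_derivative v') (at y)" using Ck_on_SucD(1)[of 0 S v y] vC S(2) by (simp add: v'_def)
  have Dd: "(D has_derivative D') (at y)" using Ck_on_SucD(1)[of 0 S D y] D(1) S(2) by (simp add: D'_def)
  have gd: "((\<lambda>z. g z a e) has_derivative g' a e) (at y)" for a e
    using Ck_on_SucD(1)[of 0 S "\<lambda>z. g z a e" y] g(1) S(2) by (simp add: g'_def)
  note gD = posdef_formD[OF g(2)]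
  have fv: "g z (v z) w = ?f' z w" if "z \<in> S" for z w
    unfolding v_def by (rule riesz_works[OF g(2)[OF that] flin[OF that]])
  have lv': "linear v'" and lD': "linear D'" using vd Dd has_derivative_linear by blast+
  have "((\<lambda>z. D z *\<^sub>R v z) has_derivative (\<lambda>w. D y *\<^sub>R v' w + D' w *\<^sub>R v y)) (at y)"
    by (rule has_derivative_scaleR[OF Dd vd])
  then have "divergence (\<lambda>z. D z *\<^sub>R v z) y = (\<Sum>b\<in>Basis. (D y *\<^sub>R v' b + D' b *\<^sub>R v y) \<bullet> b)"
    by (simp add: divergence_def frechet_derivative_at[symmetric])
  also have "\<dots> = D y * (\<Sum>b\<in>Basis. v' b \<bullet> b) + (\<Sum>b\<in>Basis. (v y \<bullet> b) * D' b)"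
    by (simp add: inner_add_left sum.distrib sum_distrib_left mult.commute)
  also have "(\<Sum>b\<in>Basis. (v y \<bullet> b) * D' b) = D' (v y)"
  proof -
    have "D' (\<Sum>b\<in>Basis. (v y \<bullet> b) *\<^sub>R b) = (\<Sum>b\<in>Basis. (v y \<bullet> b) * D' b)"
      by (simp add: linear_sum[OF lD'] linear_cmul[OF lD'])
    then show ?thesis by (simp add: euclidean_representation)
  qed
  also have "(\<Sum>b\<in>Basis. v' b \<bullet> b) = (\<Sum>e\<in>E. g y (v' e) e)"
    by (rule trace_orthonormal[OF g(2)[OF S(2)] lv' E])
  finally have div: "divergence (\<lambda>z. D z *\<^sub>R v z) y = D y * (\<Sum>e\<in>E. g y (v' e) e) + D' (v y)" .
  have vE: "v y = (\<Sum>a\<in>E. ?f' y a *\<^sub>R a)" using E[of "v y"] by (simp only: fv[OF S(2)])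
  \<comment> \<open>In \<open>g z (v z) e\<close> both the form and its argument vary with
    \<open>z\<close>. The expansion in the standard basis separates them, since the derivative of
    \<open>g\<close> is known for fixed vectors.\<close>
  have gexp: "g z x e = (\<Sum>b\<in>Basis. (x \<bullet> b) * g z b e)" if "z \<in> S" for z x e
  proof -
    have "g z (\<Sum>b\<in>Basis. (x \<bullet> b) *\<^sub>R b) e = (\<Sum>b\<in>Basis. (x \<bullet> b) * g z b e)"
      by (simp add: linear_sum[OF gD(6)[OF that]] linear_cmul[OF gD(6)[OF that]])
    then show ?thesis by (simp add: euclidean_representation)
  qed
  have g'exp: "g' x e w = (\<Sum>b\<in>Basis. (x \<bullet> b) * g' b e w)" for x e w
  proof -
    have "((\<lambda>z. \<Sum>b\<in>Basis. (x \<bullet> b) * g z b e) has_derivative (\<lambda>w. \<Sum>b\<in>Basis. (x \<bullet> b) * g' b e w)) (at y)"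
      by (intro has_derivative_sum has_derivative_mult_right gd)
    then have "((\<lambda>z. g z x e) has_derivative (\<lambda>w. \<Sum>b\<in>Basis. (x \<bullet> b) * g' b e w)) (at y)"
      by (rule has_derivative_transform_within_open[OF _ S]) (simp add: gexp)
    then show ?thesis using has_derivative_unique[OF gd[of x e]] by metis
  qed
  have "g y (v' e) e = frechet_derivative (\<lambda>z. ?f' z e) (at y) e - (\<Sum>a\<in>E. ?f' y a * g' a e e)" for e
  proof -
    have "((\<lambda>z. \<Sum>b\<in>Basis. (v z \<bullet> b) * g z b e) has_derivative
        (\<lambda>w. \<Sum>b\<in>Basis. (v y \<bullet> b) * g' b e w + (v' w \<bullet> b) * g y b e)) (at y)"
      by (intro has_derivative_sum has_derivative_mult has_derivative_inner_left vd gd)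
    then have "((\<lambda>z. ?f' z e) has_derivative
        (\<lambda>w. \<Sum>b\<in>Basis. (v y \<bullet> b) * g' b e w + (v' w \<bullet> b) * g y b e)) (at y)"
      by (rule has_derivative_transform_within_open[OF _ S]) (simp add: gexp[symmetric] fv)
    then have "frechet_derivative (\<lambda>z. ?f' z e) (at y) e =
        (\<Sum>b\<in>Basis. (v y \<bullet> b) * g' b e e) + g y (v' e) e"
      unfolding gexp[OF S(2), of "v' e" e] by (simp add: frechet_derivative_at[symmetric] sum.distrib)
    moreover have "(\<Sum>b\<in>Basis. (v y \<bullet> b) * g' b e e) = (\<Sum>a\<in>E. ?f' y a * g' a e e)"
    proof -
      have "(\<Sum>b\<in>Basis. (v y \<bullet> b) * g' b e e) = (\<Sum>b\<in>Basis. \<Sum>a\<in>E. ?f' y a * ((a \<bullet> b) * g' b e e))"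
        unfolding vE by (simp add: inner_sum_left sum_distrib_right mult.assoc)
      also have "\<dots> = (\<Sum>a\<in>E. \<Sum>b\<in>Basis. ?f' y a * ((a \<bullet> b) * g' b e e))" by (rule sum.swap)
      also have "\<dots> = (\<Sum>a\<in>E. ?f' y a * g' a e e)"
      proof (rule sum.cong[OF refl])
        fix a
        show "(\<Sum>b\<in>Basis. ?f' y a * ((a \<bullet> b) * g' b e e)) = ?f' y a * g' a e e"
          unfolding sum_distrib_left[symmetric] by (rule arg_cong[OF g'exp[symmetric]])
      qed
      finally show ?thesis .
    qed
    ultimately show ?thesis by simp
  qed
  then have "(\<Sum>e\<in>E. g y (v' e) e) = (\<Sum>e\<in>E. frechet_derivative (\<lambda>z. ?f' z e) (at y) e) -
      (\<Sum>e\<in>E. \<Sum>a\<in>E. ?f' y a * g' a e e)" by (simp add: sum_subtractf)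
  also have "(\<Sum>e\<in>E. \<Sum>a\<in>E. ?f' y a * g' a e e) = (\<Sum>a\<in>E. ?f' y a * (\<Sum>e\<in>E. g' a e e))"
    by (subst sum.swap) (simp add: sum_distrib_left)
  finally have tr: "(\<Sum>e\<in>E. g y (v' e) e) = (\<Sum>e\<in>E. frechet_derivative (\<lambda>z. ?f' z e) (at y) e) -
      (\<Sum>a\<in>E. ?f' y a * (\<Sum>e\<in>E. g' a e e))" .
  have "D' (v y) = D y * (\<Sum>a\<in>E. ?f' y a * (D' a / D y))"
    unfolding vE by (simp add: linear_sum[OF lD'] linear_cmul[OF lD'] sum_distrib_left D(2))
  then show ?thesis
    using div unfolding tr v_def drift_coeff_def D'_def[symmetric] g'_def[symmetric]
    by (simp add: algebra_simps sum.distrib sum_subtractf)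
qed


section \<open>The Euler-Lagrange equation in a chart\<close>

lemma Ck_on_deriv:
  fixes W :: "real \<Rightarrow> real"
  assumes "Ck_on (Suc k) UNIV W"
  shows "(W has_real_derivative deriv W x) (at x)" "Ck_on k UNIV (deriv W)"
proof -
  have d: "(W has_derivative frechet_derivative W (at x)) (at x)" for x
    using Ck_on_SucD(1)[OF assms] by simp
  have "frechet_derivative W (at x) t = frechet_derivative W (at x) 1 * t" for x t
    using linear_cmul[OF has_derivative_linear[OF d[of x]], of t 1] by (simp add: mult.commute)
  then have e: "frechet_derivative W (at x) = (*) (frechet_derivative W (at x) 1)" for x
    by (rule ext)
  have "(W has_real_derivative frechet_derivative W (at x) 1) (at x)" for x
    unfolding has_field_derivative_def e[symmetric] by (rule d)
  then have i: "deriv W x = frechet_derivative W (at x) 1" for x by (rule DERIV_imp_deriv)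
  show "(W has_real_derivative deriv W x) (at x)"
    unfolding i by fact
  show "Ck_on k UNIV (deriv W)"
    using Ck_on_SucD(2)[OF assms, of 1] unfolding i[abs_def] .
qed

lemma abs_integral_le_integral:
  fixes f g :: "'a \<Rightarrow> real"
  assumes "integrable \<mu> f" "integrable \<mu> g" "\<And>x. x \<in> space \<mu> \<Longrightarrow> \<bar>f x\<bar> \<le> g x"
  shows "\<bar>integral\<^sup>L \<mu> f\<bar> \<le> integral\<^sup>L \<mu> g"
  using integral_abs_bound[of \<mu> f] integral_mono[OF integrable_abs[OF assms(1)] assms(2,3)] by linarith

text \<open>The mean value theorem, applied to \<open>W\<close> and then to \<open>deriv W\<close>.
  The second derivative is bounded on twice the range because \<open>a + h\<close> may reach
  \<open>2 * R\<close>.\<close>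

lemma taylor_second_order_bound:
  fixes W :: "real \<Rightarrow> real"
  assumes W: "Ck_on 2 UNIV W"
  obtains K where "K \<ge> 0" "\<And>a h. \<bar>a\<bar> \<le> R \<Longrightarrow> \<bar>h\<bar> \<le> R \<Longrightarrow> \<bar>W (a + h) - W a - h * deriv W a\<bar> \<le> K * h\<^sup>2"
proof -
  have W2: "Ck_on (Suc (Suc 0)) UNIV W" using W by (simp add: numeral_2_eq_2)
  note d1 = Ck_on_deriv(1)[OF W2] and d2 = Ck_on_deriv[OF Ck_on_deriv(2)[OF W2]]
  have "compact (deriv (deriv W) ` {-2*R..2*R})"
    using Ck_on_imp_continuous_on[OF d2(2)] continuous_on_subset by (intro compact_continuous_image) auto
  then obtain K0 where K0: "\<forall>x\<in>{-2*R..2*R}. \<bar>deriv (deriv W) x\<bar> \<le> K0"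
    using compact_imp_bounded[of "deriv (deriv W) ` {-2*R..2*R}"] unfolding bounded_iff by auto
  define K where "K = \<bar>K0\<bar>"
  have "\<bar>W (a + h) - W a - h * deriv W a\<bar> \<le> K * h\<^sup>2" if "\<bar>a\<bar> \<le> R" "\<bar>h\<bar> \<le> R" for a h
  proof -
    have mvt: "\<exists>z. min x y \<le> z \<and> z \<le> max x y \<and> f y - f x = (y - x) * f' z"
      if der: "\<And>z. (f has_real_derivative f' z) (at z)" for f f' :: "real \<Rightarrow> real" and x y
    proof -
      consider "x < y" | "y < x" | "x = y" by linarith
      then show ?thesis
      proof cases
        case 1
        then obtain z where "x < z" "z < y" "f y - f x = (y - x) * f' z" using MVT2[of x y f f', OF 1 der] by blast
        then show ?thesis using 1 by (intro exI[of _ z]) auto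
      next
        case 2
        then obtain z where "y < z" "z < x" "f x - f y = (x - y) * f' z" using MVT2[of y x f f', OF 2 der] by blast
        then show ?thesis using 2 by (intro exI[of _ z]) (auto simp: algebra_simps)
      qed auto
    qed
    obtain z where z: "min a (a+h) \<le> z" "z \<le> max a (a+h)" "W (a + h) - W a = h * deriv W z"
      using mvt[of W "deriv W" a "a + h"] d1 by auto
    obtain w where w: "min a z \<le> w" "w \<le> max a z" "deriv W z - deriv W a = (z - a) * deriv (deriv W) w"
      using mvt[of "deriv W" "deriv (deriv W)" a z] d2(1) by auto
    have wR: "w \<in> {-2*R..2*R}" using that z w by auto
    have "W (a + h) - W a - h * deriv W a = h * ((z - a) * deriv (deriv W) w)"
      unfolding z(3) w(3)[symmetric] by (simp add: algebra_simps)
    then have "\<bar>W (a + h) - W a - h * deriv W a\<bar> = \<bar>h\<bar> * (\<bar>z - a\<bar> * \<bar>deriv (deriv W) w\<bar>)"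
      by (simp add: abs_mult)
    also have "\<dots> \<le> \<bar>h\<bar> * (\<bar>h\<bar> * K)"
      using K0 wR z by (intro mult_left_mono mult_mono) (auto simp: K_def intro: order_trans[OF _ abs_ge_self])
    finally show ?thesis by (simp add: power2_eq_square abs_mult_self_eq algebra_simps flip: abs_mult)
  qed
  then show thesis using that[of K] by (simp add: K_def)
qed

context closed_riemannian
begin

section \<open>Gradients in charts, and their independence of the chart\<close>

lemma Ck_function: "smooth_function M u \<Longrightarrow> c \<in> atlas M \<Longrightarrow> Ck_on k (cimage c) (u \<circ> param c)"
  by (simp add: smooth_function_def smooth_on_def)

lemma function_has_derivative:
  assumes "smooth_function M u" "c \<in> atlas M" "y \<in> cimage c"
  shows "((u \<circ> param c) has_derivative frechet_derivative (u \<circ> param c) (at y)) (at y)"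
  using Ck_on_SucD(1)[of 0 "cimage c" "u \<circ> param c" y] Ck_function[OF assms(1,2), of "Suc 0"] assms(3) by simp

lemmas function_derivative_linear = has_derivative_linear[OF function_has_derivative]

lemma smooth_function_lincomb:
  assumes "smooth_function M u" "smooth_function M \<phi>"
  shows "smooth_function M (\<lambda>p. u p + t * \<phi> p)"
proof -
  have "Ck_on k (cimage c) (\<lambda>y. (u \<circ> param c) y + t * (\<phi> \<circ> param c) y)" if "c \<in> atlas M" for k c
    using that by (intro Ck_on_add Ck_on_mult Ck_on_const Ck_function assms open_cimage)
  then show ?thesis by (simp add: smooth_function_def smooth_on_def comp_def)
qed

definition cgrad :: "('a, 'e) rchart \<Rightarrow> ('a \<Rightarrow> real) \<Rightarrow> 'e \<Rightarrow> 'e" where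
  "cgrad c u y = riesz (cmetric c y) (frechet_derivative (u \<circ> param c) (at y))"

lemma cgrad_works:
  assumes "smooth_function M u" "c \<in> atlas M" "y \<in> cimage c"
  shows "cmetric c y (cgrad c u y) w = frechet_derivative (u \<circ> param c) (at y) w"
  unfolding cgrad_def using riesz_works[OF posdef[OF assms(2,3)] function_derivative_linear[OF assms]] .

lemma Ck_cgrad:
  assumes "smooth_function M u" "c \<in> atlas M"
  shows "Ck_on k (cimage c) (cgrad c u)"
  unfolding cgrad_def[abs_def]
  using Ck_on_SucD(2)[OF Ck_function[OF assms]]
  by (intro Ck_on_riesz open_cimage smooth_metric posdef function_derivative_linear assms) auto

lemma frechet_derivative_lincomb:
  assumes "smooth_function M u" "smooth_function M \<phi>" "c \<in> atlas M" "y \<in> cimage c"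
  shows "frechet_derivative ((\<lambda>p. u p + t * \<phi> p) \<circ> param c) (at y) =
    (\<lambda>w. frechet_derivative (u \<circ> param c) (at y) w + t * frechet_derivative (\<phi> \<circ> param c) (at y) w)"
  unfolding comp_def
  by (rule frechet_derivative_at[symmetric] has_derivative_add has_derivative_mult_right
      function_has_derivative[unfolded comp_def] assms)+

lemma cgrad_lincomb:
  assumes "smooth_function M u" "smooth_function M \<phi>" "c \<in> atlas M" "y \<in> cimage c"
  shows "cgrad c (\<lambda>p. u p + t * \<phi> p) y = cgrad c u y + t *\<^sub>R cgrad c \<phi> y"
  unfolding cgrad_def frechet_derivative_lincomb[OF assms]
  by (intro riesz_add posdef function_derivative_linear assms)

text \<open>The derivative of the transition preserves the metrics, so it is injective and, by
  dimension, onto. Hence the defining property of the gradient need only be tested on vectors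
  \<open>?L w'\<close>.\<close>

lemma cgrad_transition:
  assumes u: "smooth_function M u" and c: "c \<in> atlas M" and d: "d \<in> atlas M"
    and y: "y \<in> coord c ` (cdom c \<inter> cdom d)"
  shows "cgrad d u (transition c d y) = frechet_derivative (transition c d) (at y) (cgrad c u y)"
proof -
  let ?T = "transition c d"
  let ?L = "frechet_derivative ?T (at y)"
  note T = transition_facts[OF c d]
  have yc: "y \<in> cimage c" using T(4) y by auto
  have L: "linear ?L" using has_derivative_linear[OF T(7)[OF y]] .
  have "v = 0" if "?L v = 0" for v
  proof (rule ccontr)
    assume "v \<noteq> 0"
    then have "cmetric c y v v > 0" using posdef_formD(3)[OF posdef[OF c yc]] by simp
    moreover have "cmetric c y v v = 0"
      unfolding T(8)[OF y] that using bilinear_lzero[OF posdef_formD(1)[OF posdef[OF d T(5)[OF y]]]] .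
    ultimately show False by simp
  qed
  then have "inj ?L" using linear_injective_0[OF L] by blast
  then have surj: "surj ?L" using linear_injective_imp_surjective[OF L] by blast
  have "((u \<circ> param d) \<circ> ?T has_derivative frechet_derivative (u \<circ> param d) (at (?T y)) \<circ> ?L) (at y)"
    by (rule diff_chain_at[OF T(7)[OF y] function_has_derivative[OF u d T(5)[OF y]]])
  then have "((u \<circ> param c) has_derivative frechet_derivative (u \<circ> param d) (at (?T y)) \<circ> ?L) (at y)"
    by (rule has_derivative_transform_within_open[OF _ T(1) y]) (simp add: T(6))
  then have D: "frechet_derivative (u \<circ> param c) (at y) = frechet_derivative (u \<circ> param d) (at (?T y)) \<circ> ?L"
    by (rule frechet_derivative_at[symmetric])
  show ?thesis
    unfolding cgrad_def[of d]
  proof (rule riesz_unique[OF posdef[OF d T(5)[OF y]]])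
    fix w
    obtain w' where w: "w = ?L w'" using surj by blast
    show "cmetric d (?T y) (?L (cgrad c u y)) w = frechet_derivative (u \<circ> param d) (at (?T y)) w"
      unfolding w T(8)[OF y, symmetric] cgrad_works[OF u c yc] D by simp
  qed
qed

lemma grad_coord_eq: "grad_coord c u p = cgrad c u (coord c p)"
  by (simp add: grad_coord_def cgrad_def riesz_def)

text \<open>Frees the norm from the chart picked by \<open>chart_at\<close>, which may change from
  point to point without any regularity.\<close>

lemma grad_norm_sq_eq:
  assumes u: "smooth_function M u" and c: "c \<in> atlas M" "p \<in> cdom c"
  shows "grad_norm_sq M u p = cmetric c (coord c p) (cgrad c u (coord c p)) (cgrad c u (coord c p))"
proof -
  let ?d = "chart_at M p" and ?y = "coord c p"
  have d: "?d \<in> atlas M" "p \<in> cdom ?d" using chart_at[of p] cdom_subset[OF c(1)] c(2) by auto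
  have y: "?y \<in> coord c ` (cdom c \<inter> cdom ?d)" using c d by auto
  have T: "transition c ?d ?y = coord ?d p"
    by (simp add: transition_def param_coord[OF is_chart[OF c(1)] c(2)])
  show ?thesis
    unfolding grad_norm_sq_def Let_def grad_coord_eq T[symmetric] cgrad_transition[OF u c(1) d(1) y]
    by (rule transition_facts(8)[OF c(1) d(1) y, symmetric])
qed

lemma continuous_map_from_charts:
  fixes F :: "'a \<Rightarrow> real"
  assumes "\<And>c. c \<in> atlas M \<Longrightarrow> continuous_on (cimage c) (F \<circ> param c)"
  shows "continuous_map (mtop M) euclidean F"
proof (rule pasting_lemma[where I = "atlas M" and T = cdom and f = "\<lambda>_. F"])
  fix c assume c: "c \<in> atlas M"
  show "openin (mtop M) (cdom c)" by (rule open_cdom[OF c])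
  have ts: "topspace (subtopology (mtop M) (cdom c)) = cdom c" using cdom_subset[OF c] by auto
  have "continuous_map (subtopology (mtop M) (cdom c)) (top_of_set (cimage c)) (coord c)"
    using chart_facts(5)[OF is_chart[OF c]] by (simp add: continuous_map_in_subtopology cimage_def image_subset_iff ts Pi_iff)
  then have "continuous_map (subtopology (mtop M) (cdom c)) euclidean ((F \<circ> param c) \<circ> coord c)"
    by (rule continuous_map_compose) (simp only: continuous_map_iff_continuous assms[OF c])
  then show "continuous_map (subtopology (mtop M) (cdom c)) euclidean F"
    by (rule continuous_map_eq) (simp add: ts param_coord[OF is_chart[OF c]])
qed (use cover in auto)

lemma continuous_map_bounded:
  fixes F :: "'a \<Rightarrow> real"
  assumes "continuous_map (mtop M) euclidean F"
  obtains B where "B \<ge> 0" "\<And>p. p \<in> points M \<Longrightarrow> \<bar>F p\<bar> \<le> B"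
proof -
  have "compactin euclidean (F ` points M)"
    using compact image_compactin[OF _ assms] by (simp add: compact_space_def)
  then have "bounded (F ` points M)" using compact_imp_bounded by simp
  then obtain B where "\<forall>p\<in>points M. \<bar>F p\<bar> \<le> B" unfolding bounded_iff by auto
  then show thesis using that[of "\<bar>B\<bar>"] by force
qed

lemma integrable_continuous_map:
  fixes F :: "'a \<Rightarrow> real"
  assumes "continuous_map (mtop M) euclidean F"
  shows "integrable (volume_measure M) F"
proof -
  obtain B where "\<And>p. p \<in> points M \<Longrightarrow> \<bar>F p\<bar> \<le> B" using continuous_map_bounded[OF assms] by metis
  then show ?thesis
    using continuous_map_borel_measurable[OF assms]
    by (intro finite_measure.integrable_const_bound[OF finite_volume_measure, where B = B])
      (auto cong: measurable_cong_sets)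
qed

lemma continuous_map_smooth_function: "smooth_function M u \<Longrightarrow> continuous_map (mtop M) euclidean u"
  by (rule continuous_map_from_charts) (rule Ck_on_imp_continuous_on[OF Ck_function])

lemma continuous_map_grad_norm_sq:
  assumes u: "smooth_function M u"
  shows "continuous_map (mtop M) euclidean (grad_norm_sq M u)"
proof (rule continuous_map_from_charts)
  fix c assume c: "c \<in> atlas M"
  \<comment> \<open>The squared norm is the differential applied to the gradient; expanding the
    gradient in the basis leaves differentials in fixed directions, which are continuous.\<close>
  have "continuous_on (cimage c) (\<lambda>y. \<Sum>b\<in>Basis. (cgrad c u y \<bullet> b) * frechet_derivative (u \<circ> param c) (at y) b)"
    using Ck_on_imp_continuous_on[OF Ck_cgrad[OF u c]]
      Ck_on_imp_continuous_on[OF Ck_on_SucD(2)[OF Ck_function[OF u c]]]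
    by (intro continuous_intros) auto
  then show "continuous_on (cimage c) (grad_norm_sq M u \<circ> param c)"
  proof (rule continuous_on_eq)
    fix y assume y: "y \<in> cimage c"
    let ?D = "frechet_derivative (u \<circ> param c) (at y)"
    note lin = function_derivative_linear[OF u c y]
    have "?D (\<Sum>b\<in>Basis. (cgrad c u y \<bullet> b) *\<^sub>R b) = (\<Sum>b\<in>Basis. (cgrad c u y \<bullet> b) * ?D b)"
      by (simp add: linear_sum[OF lin] linear_cmul[OF lin])
    then have "(\<Sum>b\<in>Basis. (cgrad c u y \<bullet> b) * ?D b) = ?D (cgrad c u y)" by (simp add: euclidean_representation)
    also have "\<dots> = grad_norm_sq M u (param c y)"
      using grad_norm_sq_eq[OF u c param_in_cdom[OF y]] cgrad_works[OF u c y] by (simp add: coord_param[OF y])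
    finally show "(\<Sum>b\<in>Basis. (cgrad c u y \<bullet> b) * ?D b) = (grad_norm_sq M u \<circ> param c) y" by simp
  qed
qed

text \<open>Polarisation gives the inner product of two gradients without a chart, so its continuity
  follows from that of \<open>grad_norm_sq\<close>. The factor \<open>1\<close> matches the form of
  \<open>smooth_function_lincomb\<close>.\<close>

definition grad_inner :: "('a \<Rightarrow> real) \<Rightarrow> ('a \<Rightarrow> real) \<Rightarrow> 'a \<Rightarrow> real" where
  "grad_inner u \<phi> p = (grad_norm_sq M (\<lambda>p. u p + 1 * \<phi> p) p - grad_norm_sq M u p - grad_norm_sq M \<phi> p) / 2"

lemma grad_norm_sq_lincomb_chart:
  assumes u: "smooth_function M u" and \<phi>: "smooth_function M \<phi>" and c: "c \<in> atlas M" "p \<in> cdom c"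
  shows "grad_norm_sq M (\<lambda>p. u p + t * \<phi> p) p = grad_norm_sq M u p +
    2 * t * frechet_derivative (\<phi> \<circ> param c) (at (coord c p)) (cgrad c u (coord c p)) + t\<^sup>2 * grad_norm_sq M \<phi> p"
proof -
  have y: "coord c p \<in> cimage c" using coord_in_cimage[OF c(2)] .
  note g = posdef_formD[OF posdef[OF c(1) y]]
  have "cmetric c (coord c p) (cgrad c u (coord c p)) (cgrad c \<phi> (coord c p)) =
      frechet_derivative (\<phi> \<circ> param c) (at (coord c p)) (cgrad c u (coord c p))"
    unfolding g(2)[of "cgrad c u (coord c p)"] by (rule cgrad_works[OF \<phi> c(1) y])
  then show ?thesis
    unfolding grad_norm_sq_eq[OF smooth_function_lincomb[OF u \<phi>] c] grad_norm_sq_eq[OF u c] grad_norm_sq_eq[OF \<phi> c]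
      cgrad_lincomb[OF u \<phi> c(1) y]
    using g(2)[of "cgrad c u (coord c p)" "cgrad c \<phi> (coord c p)"]
    by (simp add: bilinear_ladd[OF g(1)] bilinear_radd[OF g(1)] bilinear_lmul[OF g(1)] bilinear_rmul[OF g(1)]
        power2_eq_square algebra_simps)
qed

lemma grad_inner_chart:
  assumes "smooth_function M u" "smooth_function M \<phi>" "c \<in> atlas M" "p \<in> cdom c"
  shows "grad_inner u \<phi> p = frechet_derivative (\<phi> \<circ> param c) (at (coord c p)) (cgrad c u (coord c p))"
  unfolding grad_inner_def grad_norm_sq_lincomb_chart[OF assms] by simp

lemma grad_norm_sq_lincomb:
  assumes "smooth_function M u" "smooth_function M \<phi>" "p \<in> points M"
  shows "grad_norm_sq M (\<lambda>p. u p + t * \<phi> p) p =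
    grad_norm_sq M u p + 2 * t * grad_inner u \<phi> p + t\<^sup>2 * grad_norm_sq M \<phi> p"
proof -
  obtain c where "c \<in> atlas M" "p \<in> cdom c" using cover assms(3) by blast
  then show ?thesis using grad_norm_sq_lincomb_chart[OF assms(1,2)] grad_inner_chart[OF assms(1,2)] by simp
qed

lemma continuous_map_grad_inner:
  assumes "smooth_function M u" "smooth_function M \<phi>"
  shows "continuous_map (mtop M) euclidean (grad_inner u \<phi>)"
  unfolding grad_inner_def[abs_def]
  by (intro continuous_map_real_divide continuous_map_diff continuous_map_grad_norm_sq
      smooth_function_lincomb assms continuous_map_const[THEN iffD2]) auto

text \<open>Along \<open>u + t * \<phi>\<close> the gradient part of the energy is a quadratic
  polynomial in \<open>t\<close>. The potential part \<open>J\<close> is differentiated at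
  \<open>0\<close> by a uniform quadratic Taylor bound, which survives integration because the
  volume is finite.\<close>

lemma weak_equation:
  assumes W: "Ck_on 2 UNIV W" and u: "smooth_function M u" and crit: "critical_point M W \<epsilon> u"
    and \<phi>: "smooth_function M \<phi>"
  shows "(\<integral>p. \<epsilon> * grad_inner u \<phi> p + inverse \<epsilon> * (deriv W (u p) * \<phi> p) \<partial>volume_measure M) = 0"
proof -
  let ?\<mu> = "volume_measure M"
  have W2: "Ck_on (Suc (Suc 0)) UNIV W" using W by (simp add: numeral_2_eq_2)
  have comp: "continuous_map (mtop M) euclidean (\<lambda>p. h (f p))"
    if "continuous_on UNIV h" "continuous_map (mtop M) euclidean f" for h f :: "_ \<Rightarrow> real"
    using continuous_map_compose[OF that(2), of euclidean h] that(1) by (simp add: comp_def)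
  have Wc: "continuous_on UNIV W" "continuous_on UNIV (deriv W)"
    using Ck_on_imp_continuous_on[OF W] Ck_on_imp_continuous_on[OF Ck_on_deriv(2)[OF W2]] by auto
  note cu = continuous_map_smooth_function[OF u] and c\<phi> = continuous_map_smooth_function[OF \<phi>]
  note int = integrable_continuous_map
  obtain Bu where Bu: "Bu \<ge> 0" "\<And>p. p \<in> points M \<Longrightarrow> \<bar>u p\<bar> \<le> Bu" using continuous_map_bounded[OF cu] by metis
  obtain Bp where Bp: "Bp \<ge> 0" "\<And>p. p \<in> points M \<Longrightarrow> \<bar>\<phi> p\<bar> \<le> Bp" using continuous_map_bounded[OF c\<phi>] by metis
  obtain K where K: "K \<ge> 0" "\<And>a h. \<bar>a\<bar> \<le> Bu + Bp \<Longrightarrow> \<bar>h\<bar> \<le> Bu + Bp \<Longrightarrow>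
      \<bar>W (a + h) - W a - h * deriv W a\<bar> \<le> K * h\<^sup>2"
    using taylor_second_order_bound[OF W] by metis
  define G where "G = integral\<^sup>L ?\<mu> (grad_norm_sq M u)"
  define H where "H = integral\<^sup>L ?\<mu> (grad_inner u \<phi>)"
  define P where "P = integral\<^sup>L ?\<mu> (grad_norm_sq M \<phi>)"
  define J where "J t = (\<integral>p. W (u p + t * \<phi> p) \<partial>?\<mu>)" for t
  define J' where "J' = (\<integral>p. deriv W (u p) * \<phi> p \<partial>?\<mu>)"
  have cW: "continuous_map (mtop M) euclidean (\<lambda>p. W (u p + t * \<phi> p))" for t
    by (rule comp[OF Wc(1)]) (intro continuous_map_add continuous_map_real_mult cu c\<phi> continuous_map_const[THEN iffD2]; simp)
  have cW': "continuous_map (mtop M) euclidean (\<lambda>p. deriv W (u p) * \<phi> p)"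
    by (intro continuous_map_real_mult comp[OF Wc(2)] cu c\<phi>)
  note i1 = int[OF continuous_map_grad_norm_sq[OF u]] int[OF continuous_map_grad_inner[OF u \<phi>]]
    int[OF continuous_map_grad_norm_sq[OF \<phi>]] int[OF cW] int[OF cW']
  have E: "energy M W \<epsilon> (\<lambda>p. u p + t * \<phi> p) = \<epsilon> / 2 * (G + 2 * t * H + t\<^sup>2 * P) + inverse \<epsilon> * J t" for t
  proof -
    have "energy M W \<epsilon> (\<lambda>p. u p + t * \<phi> p) =
      (\<integral>p. \<epsilon> / 2 * (grad_norm_sq M u p + (2 * t) * grad_inner u \<phi> p + t\<^sup>2 * grad_norm_sq M \<phi> p) +
        inverse \<epsilon> * W (u p + t * \<phi> p) \<partial>?\<mu>)"
      unfolding energy_def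
      by (rule Bochner_Integration.integral_cong) (simp_all add: grad_norm_sq_lincomb[OF u \<phi>])
    then show ?thesis using i1 by (simp add: G_def H_def P_def J_def)
  qed
  have J: "(J has_real_derivative J') (at 0)"
  proof -
    define m where "m = measure ?\<mu> (points M)"
    have bound: "\<bar>J t - J 0 - t * J'\<bar> \<le> (K * Bp\<^sup>2 * m) * t\<^sup>2" if t: "\<bar>t\<bar> \<le> 1" for t
    proof -
      have "J t - J 0 - t * J' = (\<integral>p. W (u p + t * \<phi> p) - W (u p + 0 * \<phi> p) - t * (deriv W (u p) * \<phi> p) \<partial>?\<mu>)"
        unfolding J_def J'_def using i1(4)[of t] i1(4)[of 0] i1(5) by simp
      also have "\<bar>\<dots>\<bar> \<le> (\<integral>p. K * Bp\<^sup>2 * t\<^sup>2 \<partial>?\<mu>)"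
      proof (rule abs_integral_le_integral)
        show "integrable ?\<mu> (\<lambda>p. W (u p + t * \<phi> p) - W (u p + 0 * \<phi> p) - t * (deriv W (u p) * \<phi> p))"
          using i1 by (intro Bochner_Integration.integrable_diff integrable_mult_right)
        show "integrable ?\<mu> (\<lambda>p. K * Bp\<^sup>2 * t\<^sup>2)"
          by (rule finite_measure.integrable_const[OF finite_volume_measure])
        fix p assume "p \<in> space ?\<mu>"
        then have p: "p \<in> points M" by simp
        have le: "\<bar>t * \<phi> p\<bar> \<le> Bp"
          using mult_mono[OF t Bp(2)[OF p]] by (simp add: abs_mult)
        have "\<bar>W (u p + t * \<phi> p) - W (u p) - t * \<phi> p * deriv W (u p)\<bar> \<le> K * (t * \<phi> p)\<^sup>2"
          using le Bu Bp p by (intro K(2)) (auto intro: order_trans add_increasing2 add_increasing)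
        also have "\<dots> \<le> K * (Bp\<^sup>2 * t\<^sup>2)"
          using K(1) abs_le_square_iff[of "\<phi> p" Bp] Bp p
          unfolding power_mult_distrib mult.commute[of "t\<^sup>2"]
          by (intro mult_left_mono mult_right_mono) auto
        finally show "\<bar>W (u p + t * \<phi> p) - W (u p + 0 * \<phi> p) - t * (deriv W (u p) * \<phi> p)\<bar> \<le> K * Bp\<^sup>2 * t\<^sup>2"
          by (simp add: mult_ac)
      qed
      also have "\<dots> = (K * Bp\<^sup>2 * m) * t\<^sup>2" by (simp add: m_def)
      finally show ?thesis .
    qed
    define C where "C = K * Bp\<^sup>2 * m"
    have "((\<lambda>t. (J t - J 0) / t - J') \<longlongrightarrow> 0) (at 0)"
    proof (rule Lim_null_comparison)
      show "((\<lambda>t. C * \<bar>t\<bar>) \<longlongrightarrow> 0) (at 0)" by (auto intro!: tendsto_eq_intros)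
      have "norm ((J t - J 0) / t - J') \<le> C * \<bar>t\<bar>" if "t \<noteq> 0" "dist t 0 < 1" for t
      proof -
        have "(J t - J 0) / t - J' = (J t - J 0 - t * J') / t" using that by (simp add: field_simps)
        then have "norm ((J t - J 0) / t - J') = \<bar>J t - J 0 - t * J'\<bar> / \<bar>t\<bar>" by (simp add: abs_divide)
        also have "\<dots> \<le> C * t\<^sup>2 / \<bar>t\<bar>" using bound[of t] that by (intro divide_right_mono) (auto simp: C_def)
        also have "\<dots> = C * \<bar>t\<bar>" using that by (cases "t > 0") (auto simp: power2_eq_square abs_if)
        finally show ?thesis .
      qed
      then show "\<forall>\<^sub>F t in at 0. norm ((J t - J 0) / t - J') \<le> C * \<bar>t\<bar>"
        unfolding eventually_at by (intro exI[of _ 1]) auto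
    qed
    then have "((\<lambda>t. (J t - J 0) / t) \<longlongrightarrow> J') (at 0)" by (rule LIM_zero_cancel)
    then show ?thesis by (simp add: has_field_derivative_iff)
  qed
  have "((\<lambda>t. energy M W \<epsilon> (\<lambda>p. u p + t * \<phi> p)) has_real_derivative \<epsilon> * H + inverse \<epsilon> * J') (at 0)"
    unfolding E by (auto intro!: derivative_eq_intros J)
  moreover have "((\<lambda>t. energy M W \<epsilon> (\<lambda>p. u p + t * \<phi> p)) has_real_derivative 0) (at 0)"
    using crit \<phi> unfolding critical_point_def by blast
  ultimately have "\<epsilon> * H + inverse \<epsilon> * J' = 0" by (rule DERIV_unique)
  then show ?thesis using i1 by (simp add: H_def J'_def)
qed

section \<open>Test functions supported in a chart, and the pointwise equation\<close>

definition chart_bump :: "('a, 'e) rchart \<Rightarrow> 'e \<Rightarrow> real \<Rightarrow> 'a \<Rightarrow> real" where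
  "chart_bump c a r p = (if p \<in> cdom c then bump a r (coord c p) else 0)"

text \<open>The bump vanishes off the image of a closed ball, which is compact and therefore closed
  by the Hausdorff property. A point outside \<open>cdom c\<close> thus has a whole neighbourhood on
  which the extension by zero vanishes.\<close>

lemma chart_bump_vanishes:
  assumes c: "c \<in> atlas M" and r: "r > 0" "cball a r \<subseteq> cimage c" and d: "d \<in> atlas M"
    and y: "y \<in> cimage d" "param d y \<notin> cdom c"
  obtains V where "open V" "y \<in> V" "\<And>z. z \<in> V \<Longrightarrow> z \<in> cimage d" "\<And>z. z \<in> V \<Longrightarrow> chart_bump c a r (param d z) = 0"
proof -
  have cc: "continuous_map (top_of_set (cball a r)) (mtop M) (param c)"
    using continuous_map_from_subtopology[OF chart_facts(6)[OF is_chart[OF c]], of "cball a r"] r(2)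
    by (simp add: subtopology_subtopology inf.absorb2)
  have "compactin (mtop M) (param c ` cball a r)"
    by (rule image_compactin[OF _ cc]) (simp add: compactin_subtopology)
  then have cl: "closedin (mtop M) (param c ` cball a r)"
    using compactin_imp_closedin hausdorff by auto
  define V where "V = {z \<in> cimage d. param d z \<in> points M - param c ` cball a r}"
  have "openin (top_of_set (cimage d)) V"
    using openin_continuous_map_preimage[OF chart_facts(6)[OF is_chart[OF d]], of "points M - param c ` cball a r"] cl
    by (simp add: V_def closedin_def)
  then have oV: "open V" using open_cimage[OF d] openin_open_trans by blast
  have "param d y \<in> points M" using cdom_subset[OF d] param_in_cdom[OF y(1)] by auto
  moreover have "param c ` cball a r \<subseteq> cdom c" using r(2) by (auto intro!: param_in_cdom)
  ultimately have "y \<in> V" using y by (auto simp: V_def)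
  moreover have "chart_bump c a r (param d z) = 0" if "z \<in> V" for z
  proof (cases "param d z \<in> cdom c")
    case True
    have "param d z \<notin> param c ` cball a r" using that by (simp add: V_def)
    then have "coord c (param d z) \<notin> cball a r"
      using param_coord[OF is_chart[OF c] True] by (metis imageI)
    then show ?thesis using True bump_eq_0[OF r(1), of "coord c (param d z)" a] by (simp add: chart_bump_def)
  qed (simp add: chart_bump_def)
  moreover have "z \<in> cimage d" if "z \<in> V" for z using that by (simp add: V_def)
  ultimately show thesis using that[OF oV] by metis
qed

lemma smooth_chart_bump:
  assumes c: "c \<in> atlas M" and r: "r > 0" "cball a r \<subseteq> cimage c"
  shows "smooth_function M (chart_bump c a r)"
  unfolding smooth_function_def smooth_on_def
proof (intro ballI allI Ck_on_locally)
  fix d k y assume d: "d \<in> atlas M" and y: "y \<in> cimage d"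
  show "\<exists>T. open T \<and> y \<in> T \<and> Ck_on k T (chart_bump c a r \<circ> param d)"
  proof (cases "param d y \<in> cdom c")
    case True
    let ?S = "coord d ` (cdom d \<inter> cdom c)"
    note T = transition_facts[OF d c]
    have "Ck_on k ?S (\<lambda>z. bump a r (transition d c z))"
      using T(2) by (intro Ck_on_compose[OF T(1) open_UNIV subset_UNIV _ Ck_on_bump]) (simp add: smooth_on_def)
    then have "Ck_on k ?S (chart_bump c a r \<circ> param d)"
      by (rule Ck_on_cong_imp[OF T(1), rotated])
        (auto simp: chart_bump_def transition_def param_coord[OF is_chart[OF d]])
    moreover have "y \<in> ?S" using True y coord_param[OF y] param_in_cdom[OF y] by (metis IntI image_eqI)
    ultimately show ?thesis using T(1) by blast
  next
    case False
    obtain V where V: "open V" "y \<in> V" "\<And>z. z \<in> V \<Longrightarrow> chart_bump c a r (param d z) = 0"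
      using chart_bump_vanishes[OF c r d y False] by metis
    then have "\<forall>z\<in>V. 0 = (chart_bump c a r \<circ> param d) z" by simp
    then have "Ck_on k V (chart_bump c a r \<circ> param d)"
      by (rule Ck_on_cong_imp[OF V(1) _ Ck_on_const[OF V(1)]])
    then show ?thesis using V by blast
  qed
qed

lemma grad_inner_chart_bump_outside:
  assumes u: "smooth_function M u" and c: "c \<in> atlas M" and r: "r > 0" "cball a r \<subseteq> cimage c"
    and p: "p \<in> points M" "p \<notin> cdom c"
  shows "grad_inner u (chart_bump c a r) p = 0"
proof -
  obtain d where d: "d \<in> atlas M" "p \<in> cdom d" using cover p(1) by blast
  let ?y = "coord d p"
  have y: "?y \<in> cimage d" "param d ?y \<notin> cdom c"
    using p d coord_in_cimage param_coord[OF is_chart[OF d(1)] d(2)] by auto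
  obtain V where V: "open V" "?y \<in> V" "\<And>z. z \<in> V \<Longrightarrow> chart_bump c a r (param d z) = 0"
    using chart_bump_vanishes[OF c r d(1) y] by metis
  have "((chart_bump c a r \<circ> param d) has_derivative (\<lambda>v. 0)) (at ?y)"
    by (rule has_derivative_transform_within_open[of "\<lambda>y. 0" _ _ _ V]) (use V in auto)
  then have "frechet_derivative (chart_bump c a r \<circ> param d) (at ?y) = (\<lambda>v. 0)"
    by (rule frechet_derivative_at[symmetric])
  then show ?thesis using grad_inner_chart[OF u smooth_chart_bump[OF c r] d] by simp
qed

text \<open>Testing the weak equation with a bump turns it into an integral over the chart, where
  integration by parts moves the derivative from the bump to the field. Bumps shrinking to
  \<open>y0\<close> then force the remaining factor \<open>Q\<close> to vanish there.\<close>

theorem euler_lagrange: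
  assumes W: "Ck_on 2 UNIV W" and u: "smooth_function M u" and crit: "critical_point M W \<epsilon> u"
    and eps: "\<epsilon> > 0" and c: "c \<in> atlas M" and y0: "y0 \<in> cimage c"
  shows "\<epsilon>\<^sup>2 * divergence (\<lambda>y. vol_density c y *\<^sub>R cgrad c u y) y0 = vol_density c y0 * deriv W (u (param c y0))"
proof -
  define X where "X y = vol_density c y *\<^sub>R cgrad c u y" for y
  define Q where "Q y = inverse \<epsilon> * (vol_density c y * deriv W (u (param c y))) - \<epsilon> * divergence X y" for y
  let ?S = "cimage c"
  note S = open_cimage[OF c]
  have X: "Ck_on k ?S X" for k
    unfolding X_def[abs_def] by (intro Ck_on_scaleR S Ck_vol_density Ck_cgrad c u)
  have W2: "Ck_on (Suc (Suc 0)) UNIV W" using W by (simp add: numeral_2_eq_2)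
  have W'c: "continuous_on UNIV (deriv W)" using Ck_on_imp_continuous_on[OF Ck_on_deriv(2)[OF W2]] .
  have uc: "continuous_on ?S (\<lambda>y. u (param c y))"
    using Ck_on_imp_continuous_on[OF Ck_function[OF u c]] by (simp add: comp_def)
  have W'u: "continuous_on ?S (\<lambda>y. vol_density c y * deriv W (u (param c y)))"
    using continuous_vol_density[OF c] continuous_on_compose2[OF W'c uc] by (intro continuous_intros) auto
  have div: "continuous_on ?S (divergence X)" using Ck_on_imp_continuous_on[OF Ck_on_divergence[OF S X]] .
  have Qc: "continuous_on ?S Q" unfolding Q_def[abs_def] by (intro continuous_intros W'u div)
  have test: "(\<integral>y. indicator ?S y * (bump y0 r y * Q y) \<partial>lborel) = 0"
    if r: "r > 0" "cball y0 r \<subseteq> ?S" for r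
  proof -
    let ?\<phi> = "chart_bump c y0 r" and ?\<psi> = "bump y0 r"
    note \<phi> = smooth_chart_bump[OF c r]
    define F where "F p = \<epsilon> * grad_inner u ?\<phi> p + inverse \<epsilon> * (deriv W (u p) * ?\<phi> p)" for p
    have "continuous_map (mtop M) euclidean (\<lambda>p. deriv W (u p))"
      using continuous_map_compose[OF continuous_map_smooth_function[OF u], of euclidean "deriv W"] W'c
      by (simp add: comp_def)
    then have Fm: "F \<in> borel_measurable (borel_of_top (mtop M))"
      unfolding F_def[abs_def]
      by (intro continuous_map_borel_measurable continuous_map_add continuous_map_real_mult
          continuous_map_grad_inner[OF u \<phi>] continuous_map_smooth_function[OF \<phi>] continuous_map_const[THEN iffD2]) auto
    have F0: "F p = 0" if "p \<in> points M" "p \<notin> cdom c" for p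
      using grad_inner_chart_bump_outside[OF u c r that] that by (simp add: F_def chart_bump_def)
    have eq: "indicator ?S y * (vol_density c y * F (param c y)) =
      \<epsilon> * (indicator ?S y * frechet_derivative ?\<psi> (at y) (X y)) +
      inverse \<epsilon> * (indicator ?S y * (?\<psi> y * (vol_density c y * deriv W (u (param c y)))))" for y
    proof (cases "y \<in> ?S")
      case True
      have \<psi>d: "(?\<psi> has_derivative frechet_derivative ?\<psi> (at y)) (at y)"
        using Ck_on_SucD(1)[OF Ck_on_bump[of "Suc 0"]] by simp
      then have "((?\<phi> \<circ> param c) has_derivative frechet_derivative ?\<psi> (at y)) (at y)"
        by (rule has_derivative_transform_within_open[OF _ S True])
          (simp add: chart_bump_def param_in_cdom coord_param)
      then have "frechet_derivative (?\<phi> \<circ> param c) (at y) = frechet_derivative ?\<psi> (at y)"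
        by (rule frechet_derivative_at[symmetric])
      then have "grad_inner u ?\<phi> (param c y) = frechet_derivative ?\<psi> (at y) (cgrad c u y)"
        using grad_inner_chart[OF u \<phi> c param_in_cdom[OF True]] by (simp add: coord_param[OF True])
      then show ?thesis
        using True linear_cmul[OF has_derivative_linear[OF \<psi>d], of "vol_density c y" "cgrad c u y"]
        by (simp add: F_def X_def chart_bump_def param_in_cdom coord_param algebra_simps)
    qed simp
    have X1: "Ck_on 1 ?S X" by (rule X)
    note ibp = integration_by_parts_bump[OF S X1 r]
    have i3: "integrable lborel (\<lambda>y. indicator ?S y * (?\<psi> y * (vol_density c y * deriv W (u (param c y)))))"
    proof -
      have "set_integrable lborel (cball y0 r) (\<lambda>y. ?\<psi> y * (vol_density c y * deriv W (u (param c y))))"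
        unfolding set_integrable_def
        using Ck_on_imp_continuous_on[OF Ck_on_bump[of 0 y0 r]]
        by (intro borel_integrable_compact continuous_on_mult[OF _ continuous_on_subset[OF W'u r(2)]])
          (auto intro: continuous_on_subset)
      moreover have "(\<lambda>y. indicator (cball y0 r) y *\<^sub>R (?\<psi> y * (vol_density c y * deriv W (u (param c y))))) =
          (\<lambda>y. indicator ?S y * (?\<psi> y * (vol_density c y * deriv W (u (param c y)))))"
        using bump_eq_0[OF r(1), of _ y0] r(2) by (auto simp: indicator_def fun_eq_iff)
      ultimately show ?thesis by (simp only: set_integrable_def)
    qed
    have "0 = integral\<^sup>L (volume_measure M) F"
      using weak_equation[OF W u crit \<phi>] by (simp add: F_def[abs_def])
    also have "\<dots> = (\<integral>y. indicator ?S y * (vol_density c y * F (param c y)) \<partial>lborel)"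
      by (rule integral_in_chart[OF c Fm F0])
    also have "\<dots> = \<epsilon> * (\<integral>y. indicator ?S y * frechet_derivative ?\<psi> (at y) (X y) \<partial>lborel) +
      inverse \<epsilon> * (\<integral>y. indicator ?S y * (?\<psi> y * (vol_density c y * deriv W (u (param c y)))) \<partial>lborel)"
      unfolding eq using ibp(2) i3 by simp
    also have "\<dots> = (\<integral>y. inverse \<epsilon> * (indicator ?S y * (?\<psi> y * (vol_density c y * deriv W (u (param c y))))) -
      \<epsilon> * (indicator ?S y * (?\<psi> y * divergence X y)) \<partial>lborel)"
      unfolding ibp(1) using ibp(3) i3 by simp
    also have "\<dots> = (\<integral>y. indicator ?S y * (?\<psi> y * Q y) \<partial>lborel)"
      by (rule Bochner_Integration.integral_cong) (simp_all add: Q_def algebra_simps)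
    finally show ?thesis by simp
  qed
  have "Q y0 \<le> 0" by (rule bump_test_zero[OF S y0 Qc test])
  moreover have "- Q y0 \<le> 0"
    using bump_test_zero[OF S y0 continuous_on_minus[OF Qc]] test by simp
  ultimately have "Q y0 = 0" by simp
  then have "inverse \<epsilon> * (vol_density c y0 * deriv W (u (param c y0))) = \<epsilon> * divergence X y0"
    by (simp add: Q_def)
  then show ?thesis using eps by (simp add: X_def[abs_def] power2_eq_square field_simps)
qed

end

section \<open>The circle and Riemannian products\<close>

lemma cdom_angle_chart: "cdom (angle_chart a) = sphere 0 1 - {cis a}"
  and coord_angle_chart: "coord (angle_chart a) z = a + Arg2pi (z * cis (- a))"
  and cmetric_angle_chart: "cmetric (angle_chart a) y v w = v * w"
  by (simp_all add: angle_chart_def)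

lemma cis_sphere [simp]: "cis t \<in> sphere 0 1"
  by simp

lemma Arg2pi_cis: "0 \<le> t \<Longrightarrow> t < 2 * pi \<Longrightarrow> Arg2pi (cis t) = t"
  using Arg2pi_exp[of "\<i> * of_real t"] by (simp add: cis_conv_exp)

lemma cis_inj_2pi: "cis s = cis t \<Longrightarrow> \<bar>s - t\<bar> < 2 * pi \<Longrightarrow> s = t"
proof -
  assume eq: "cis s = cis t" and lt: "\<bar>s - t\<bar> < 2 * pi"
  have wlog: "s = t" if "cis s = cis t" "s \<le> t" "t - s < 2 * pi" for s t
  proof -
    have "cis (t - s) = 1" using that(1) by (simp add: cis_divide[symmetric])
    then have "Arg2pi (cis (t - s)) = 0" by (simp add: Arg2pi_eq_0)
    then show ?thesis using Arg2pi_cis[of "t - s"] that by simp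
  qed
  show "s = t" using wlog[of s t] wlog[of t s] eq lt by (cases "s \<le> t") auto
qed

lemma coord_angle_chart_cis:
  assumes "a < s" "s < a + 2 * pi"
  shows "coord (angle_chart a) (cis s) = s"
proof -
  have "cis s * cis (- a) = cis (s - a)" by (simp add: cis_mult)
  then show ?thesis using Arg2pi_cis[of "s - a"] assms by (simp add: coord_angle_chart)
qed

lemma cis_in_cdom_angle_chart:
  assumes "a < s" "s < a + 2 * pi"
  shows "cis s \<in> cdom (angle_chart a)"
proof -
  have "cis s \<noteq> cis a" using cis_inj_2pi[of s a] assms by auto
  then show ?thesis by (simp add: cdom_angle_chart)
qed

lemma coord_angle_chart_props:
  assumes "z \<in> cdom (angle_chart a)"
  shows "cis (coord (angle_chart a) z) = z" "a < coord (angle_chart a) z" "coord (angle_chart a) z < a + 2 * pi"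
proof -
  have n: "norm (z * cis (- a)) = 1" using assms by (simp add: cdom_angle_chart norm_mult)
  then have "cis (Arg2pi (z * cis (- a))) = z * cis (- a)"
    by (simp add: complex_norm_eq_1_exp cis_conv_exp)
  then have "cis (a + Arg2pi (z * cis (- a))) = cis a * (z * cis (- a))"
    by (simp add: cis_mult[symmetric])
  then show c: "cis (coord (angle_chart a) z) = z"
    by (simp add: coord_angle_chart cis_mult mult.left_commute[of "cis a"])
  have "coord (angle_chart a) z \<noteq> a" using c assms by (auto simp: cdom_angle_chart)
  then show "a < coord (angle_chart a) z" "coord (angle_chart a) z < a + 2 * pi"
    using Arg2pi[of "z * cis (- a)"] by (auto simp: coord_angle_chart)
qed

lemma cimage_angle_chart: "cimage (angle_chart a) = {a<..<a + 2 * pi}"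
proof (intro equalityI subsetI)
  fix s assume "s \<in> {a<..<a + 2 * pi}"
  then show "s \<in> cimage (angle_chart a)"
    using coord_angle_chart_cis[of a s] cis_in_cdom_angle_chart[of a s] unfolding cimage_def by force
qed (use coord_angle_chart_props in \<open>auto simp: cimage_def\<close>)

lemma is_chart_angle_chart: "is_chart (top_of_set (sphere 0 1)) (angle_chart a)"
proof -
  let ?D = "sphere 0 1 - {cis a}" and ?I = "{a<..<a + 2 * pi}"
  have "homeomorphic_maps (top_of_set ?D) (top_of_set ?I) (coord (angle_chart a)) cis"
    unfolding homeomorphic_maps_def
  proof (intro conjI ballI)
    have c: "isCont Arg2pi (z * cis (- a))" if "z \<in> ?D" for z
    proof (rule continuous_at_Arg2pi)
      have "norm (z * cis (- a)) = 1" using that by (simp add: norm_mult)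
      moreover have "z * cis (- a) \<noteq> 1"
      proof
        assume "z * cis (- a) = 1"
        then have "z * cis (- a) * cis a = cis a" by simp
        then show False using that by (simp add: mult.assoc cis_mult)
      qed
      ultimately show "z * cis (- a) \<notin> \<real>\<^sub>\<ge>\<^sub>0" by (auto simp: nonneg_Reals_def)
    qed
    have "isCont (\<lambda>z. Arg2pi (z * cis (- a))) z" if "z \<in> ?D" for z
      by (rule isCont_o2[where f = "\<lambda>z. z * cis (- a)" and g = Arg2pi and a = z, OF _ c[OF that]]) (intro continuous_intros)
    then have "continuous_on ?D (\<lambda>z. Arg2pi (z * cis (- a)))"
      by (intro continuous_at_imp_continuous_on) blast
    then have "continuous_on ?D (coord (angle_chart a))"
      unfolding coord_angle_chart[abs_def] by (rule continuous_on_add[OF continuous_on_const])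
    moreover have "coord (angle_chart a) ` ?D \<subseteq> ?I"
      using cimage_angle_chart[of a] by (simp add: cimage_def cdom_angle_chart)
    ultimately show "continuous_map (top_of_set ?D) (top_of_set ?I) (coord (angle_chart a))"
      by (simp add: continuous_map_in_subtopology image_subset_iff Pi_iff)
    show "continuous_map (top_of_set ?I) (top_of_set ?D) cis"
      using cis_in_cdom_angle_chart[of a]
      by (auto simp: continuous_map_in_subtopology cdom_angle_chart cis_conv_exp[abs_def] intro!: continuous_intros)
    show "cis (coord (angle_chart a) z) = z" if "z \<in> topspace (top_of_set ?D)" for z
      using coord_angle_chart_props(1)[of z a] that by (simp add: cdom_angle_chart)
    show "coord (angle_chart a) (cis s) = s" if "s \<in> topspace (top_of_set ?I)" for s
      using coord_angle_chart_cis that by simp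
  qed
  then have "homeomorphic_map (top_of_set ?D) (top_of_set ?I) (coord (angle_chart a))"
    by (rule homeomorphic_maps_imp_map)
  moreover have "sphere 0 1 \<inter> ?D = ?D" by auto
  moreover have "openin (top_of_set (sphere 0 1)) ?D"
    by (rule openin_delete) simp
  ultimately show ?thesis
    unfolding is_chart_def cimage_angle_chart cdom_angle_chart subtopology_subtopology by simp
qed

lemma param_angle_chart:
  assumes "a < s" "s < a + 2 * pi"
  shows "param (angle_chart a) s = cis s"
  using param_coord[OF is_chart_angle_chart cis_in_cdom_angle_chart[OF assms]] coord_angle_chart_cis[OF assms] by simp

lemma cis_eq_cis_iff: "cis s = cis t \<longleftrightarrow> (\<exists>k::int. s = t + 2 * pi * k)"
proof -
  have "cis s = cis t \<longleftrightarrow> exp (\<i> * s) = exp (\<i> * t)" by (simp add: cis_conv_exp)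
  also have "\<dots> \<longleftrightarrow> (\<exists>k::int. \<i> * s = \<i> * t + (of_int (2 * k) * pi) * \<i>)" by (simp add: exp_eq)
  also have "\<dots> \<longleftrightarrow> (\<exists>k::int. s = t + 2 * pi * k)"
  proof (rule ex_cong1)
    fix k :: int
    have "\<i> * s = \<i> * t + (of_int (2 * k) * pi) * \<i> \<longleftrightarrow> complex_of_real s = complex_of_real (t + 2 * pi * k)"
      by (simp add: complex_eq_iff algebra_simps)
    then show "\<i> * s = \<i> * t + (of_int (2 * k) * pi) * \<i> \<longleftrightarrow> s = t + 2 * pi * k"
      using of_real_eq_iff by metis
  qed
  finally show ?thesis .
qed

text \<open>The two angles differ by a multiple of \<open>2 * pi\<close> that is constant near each
  point but not globally, since the overlap of two angle charts may be disconnected.\<close>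

lemma angle_transition:
  assumes "s0 \<in> coord (angle_chart a) ` (cdom (angle_chart a) \<inter> cdom (angle_chart b))"
  obtains V k where "open V" "s0 \<in> V" "\<And>s. s \<in> V \<Longrightarrow> (coord (angle_chart b) \<circ> param (angle_chart a)) s = s + k"
proof -
  let ?T = "coord (angle_chart b) \<circ> param (angle_chart a)"
  have s0: "a < s0" "s0 < a + 2 * pi" "cis s0 \<in> cdom (angle_chart b)"
    using assms coord_angle_chart_props[of _ a] by auto
  then have T0: "?T s0 = coord (angle_chart b) (cis s0)" by (simp add: param_angle_chart)
  note p = coord_angle_chart_props[OF s0(3)]
  obtain m :: int where m: "coord (angle_chart b) (cis s0) = s0 + 2 * pi * m"
    using p(1) cis_eq_cis_iff by blast
  define V where "V = {a<..<a + 2 * pi} \<inter> {b - 2 * pi * m<..<b + 2 * pi - 2 * pi * m}"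
  have "?T s = s + 2 * pi * m" if "s \<in> V" for s
  proof -
    have "cis (s + 2 * pi * m) = cis s" using cis_eq_cis_iff by blast
    moreover have "coord (angle_chart b) (cis (s + 2 * pi * m)) = s + 2 * pi * m"
      using that by (intro coord_angle_chart_cis) (auto simp: V_def)
    ultimately show ?thesis using that by (simp add: V_def param_angle_chart)
  qed
  moreover have "s0 \<in> V" using s0 p m by (simp add: V_def)
  moreover have "open V" by (auto simp: V_def)
  ultimately show thesis using that by blast
qed

lemma compatible_angle_chart: "compatible (angle_chart a) (angle_chart b)"
  unfolding compatible_def Let_def smooth_on_def
proof (intro conjI allI ballI Ck_on_locally)
  let ?S = "coord (angle_chart a) ` (cdom (angle_chart a) \<inter> cdom (angle_chart b))"
  let ?T = "coord (angle_chart b) \<circ> param (angle_chart a)"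
  fix s assume s: "s \<in> ?S"
  obtain V k where V: "open V" "s \<in> V" "\<And>s. s \<in> V \<Longrightarrow> ?T s = s + k"
    using angle_transition[OF s] by metis
  have "\<forall>s\<in>V. s + k = ?T s" using V by simp
  moreover have "Ck_on n V (\<lambda>s. s + k)" for n
    by (intro Ck_on_add Ck_on_const Ck_on_bounded_linear V bounded_linear_ident)
  ultimately have "Ck_on n V ?T" for n by (rule Ck_on_cong_imp[OF V(1)])
  then show "\<exists>V. open V \<and> s \<in> V \<and> Ck_on n V ?T" for n using V by blast
  fix v w
  have "((\<lambda>s. s + k) has_derivative (\<lambda>v. v)) (at s)" by (auto intro!: derivative_eq_intros)
  then have "(?T has_derivative (\<lambda>v. v)) (at s)"
    by (rule has_derivative_transform_within_open[OF _ V(1,2)]) (use V in auto)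
  then have "frechet_derivative ?T (at s) = (\<lambda>v. v)" by (rule frechet_derivative_at[symmetric])
  then show "cmetric (angle_chart a) s v w = cmetric (angle_chart b) (?T s)
      (frechet_derivative ?T (at s) v) (frechet_derivative ?T (at s) w)"
    by (simp add: cmetric_angle_chart)
qed

lemma metric_on_angle_chart: "metric_on_chart (angle_chart a)"
proof -
  have e: "cmetric (angle_chart a) y = (*)" for y by (simp add: angle_chart_def)
  have "bilinear ((*) :: real \<Rightarrow> real \<Rightarrow> real)"
    unfolding bilinear_def by (intro conjI allI linearI) (simp_all add: algebra_simps)
  moreover have "v * v > 0" if "v \<noteq> 0" for v :: real
    using that zero_less_power2[of v] by (simp add: power2_eq_square)
  ultimately show ?thesis
    unfolding metric_on_chart_def smooth_on_def e cimage_angle_chart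
    by (simp add: Ck_on_const mult.commute)
qed

lemma closed_riemannian_unit_circle: "closed_riemannian unit_circle"
proof
  have "\<exists>a. z \<noteq> cis a" for z
  proof -
    have "cis 0 \<noteq> cis 1" using cis_inj_2pi[of 0 1] pi_ge_two by auto
    then show ?thesis by metis
  qed
  then show "(\<Union>c\<in>atlas unit_circle. cdom c) = points unit_circle"
    by (auto simp: unit_circle_def cdom_angle_chart)
  show "compact_space (mtop unit_circle)"
    by (simp add: unit_circle_def compact_space_subtopology)
  show "Hausdorff_space (mtop unit_circle)"
    by (simp add: unit_circle_def Hausdorff_space_subtopology)
qed (auto simp: unit_circle_def is_chart_angle_chart metric_on_angle_chart compatible_angle_chart)

section \<open>Products of closed Riemannian manifolds\<close>

lemma cdom_product_chart: "cdom (product_chart c d) = cdom c \<times> cdom d"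
  and coord_product_chart: "coord (product_chart c d) = (\<lambda>(p, q). (coord c p, coord d q))"
  and cmetric_product_chart: "cmetric (product_chart c d) z v w =
    cmetric c (fst z) (fst v) (fst w) + cmetric d (snd z) (snd v) (snd w)"
  by (auto simp: product_chart_def split: prod.split)

lemma cimage_product_chart: "cimage (product_chart c d) = cimage c \<times> cimage d"
  by (force simp: cimage_def cdom_product_chart coord_product_chart)

lemma is_chart_product_chart:
  assumes "is_chart X c" "is_chart Y d"
  shows "is_chart (prod_topology X Y) (product_chart c d)"
proof -
  obtain f where f: "homeomorphic_maps (subtopology X (cdom c)) (top_of_set (cimage c)) (coord c) f"
    using assms(1) homeomorphic_map_maps unfolding is_chart_def by blast
  obtain g where g: "homeomorphic_maps (subtopology Y (cdom d)) (top_of_set (cimage d)) (coord d) g"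
    using assms(2) homeomorphic_map_maps unfolding is_chart_def by blast
  have "homeomorphic_map (prod_topology (subtopology X (cdom c)) (subtopology Y (cdom d)))
      (prod_topology (top_of_set (cimage c)) (top_of_set (cimage d))) (coord (product_chart c d))"
    unfolding coord_product_chart using f g homeomorphic_maps_prod homeomorphic_maps_imp_map by blast
  then show ?thesis
    using assms unfolding is_chart_def cdom_product_chart cimage_product_chart subtopology_Times[symmetric]
    by (auto simp: openin_prod_Times_iff open_Times)
qed

lemma param_product_chart:
  assumes "is_chart X c" "is_chart Y d" "y \<in> cimage c" "z \<in> cimage d"
  shows "param (product_chart c d) (y, z) = (param c y, param d z)"
proof -
  have "coord (product_chart c d) (param c y, param d z) = (y, z)"
    using assms by (simp add: coord_product_chart coord_param)
  moreover have "(param c y, param d z) \<in> cdom (product_chart c d)"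
    using assms by (simp add: cdom_product_chart param_in_cdom)
  ultimately show ?thesis
    using param_coord[OF is_chart_product_chart[OF assms(1,2)]] by metis
qed

lemma Ck_on_fst:
  fixes f :: "'a::euclidean_space \<Rightarrow> 'c::real_normed_vector"
  assumes "open S" "open T" "Ck_on k S f"
  shows "Ck_on k (S \<times> (T :: 'b::real_normed_vector set)) (\<lambda>z. f (fst z))"
  using assms
  by (intro Ck_on_compose[of _ S fst k f]) (auto intro!: open_Times Ck_on_bounded_linear bounded_linear_fst)

lemma Ck_on_snd:
  fixes f :: "'b::euclidean_space \<Rightarrow> 'c::real_normed_vector"
  assumes "open S" "open T" "Ck_on k T f"
  shows "Ck_on k ((S :: 'a::real_normed_vector set) \<times> T) (\<lambda>z. f (snd z))"
  using assms
  by (intro Ck_on_compose[of _ T snd k f]) (auto intro!: open_Times Ck_on_bounded_linear bounded_linear_snd)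

lemma metric_on_product_chart:
  assumes "open (cimage c)" "open (cimage d)" "metric_on_chart c" "metric_on_chart d"
  shows "metric_on_chart (product_chart c d)"
proof -
  have "Ck_on k (cimage c \<times> cimage d) (\<lambda>y. cmetric (product_chart c d) y v w)" for k v w
    unfolding cmetric_product_chart using assms unfolding metric_on_chart_def smooth_on_def
    by (intro Ck_on_add Ck_on_fst[where f = "\<lambda>y. cmetric c y _ _"] Ck_on_snd[where f = "\<lambda>y. cmetric d y _ _"] open_Times) auto
  moreover have "bilinear (cmetric (product_chart c d) z) \<and>
      (\<forall>v w. cmetric (product_chart c d) z v w = cmetric (product_chart c d) z w v) \<and>
      (\<forall>v. v \<noteq> 0 \<longrightarrow> 0 < cmetric (product_chart c d) z v v)" if "z \<in> cimage c \<times> cimage d" for z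
  proof -
    have z: "posdef_form (cmetric c (fst z))" "posdef_form (cmetric d (snd z))"
      using assms that by (auto simp: metric_on_chart_def posdef_form_def)
    have "bilinear (cmetric (product_chart c d) z)"
      unfolding bilinear_def
      by (auto intro!: linearI simp: cmetric_product_chart bilinear_ladd[OF posdef_formD(1)[OF z(1)]]
          bilinear_ladd[OF posdef_formD(1)[OF z(2)]] bilinear_radd[OF posdef_formD(1)[OF z(1)]]
          bilinear_radd[OF posdef_formD(1)[OF z(2)]] bilinear_lmul[OF posdef_formD(1)[OF z(1)]]
          bilinear_lmul[OF posdef_formD(1)[OF z(2)]] bilinear_rmul[OF posdef_formD(1)[OF z(1)]]
          bilinear_rmul[OF posdef_formD(1)[OF z(2)]] algebra_simps)
    moreover have "0 < cmetric (product_chart c d) z v v" if "v \<noteq> 0" for v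
    proof (cases "fst v = 0")
      case True
      then have "snd v \<noteq> 0" using that by (simp add: prod_eq_iff)
      then show ?thesis
        unfolding cmetric_product_chart using posdef_formD(4)[OF z(1)] posdef_formD(3)[OF z(2)]
        by (intro add_nonneg_pos)
    next
      case False
      then show ?thesis
        unfolding cmetric_product_chart using posdef_formD(3)[OF z(1)] posdef_formD(4)[OF z(2)] by (intro add_pos_nonneg)
    qed
    ultimately show ?thesis
      using posdef_formD(2)[OF z(1)] posdef_formD(2)[OF z(2)] by (simp add: cmetric_product_chart)
  qed
  ultimately show ?thesis by (simp add: metric_on_chart_def smooth_on_def cimage_product_chart)
qed

lemma closed_riemannian_product:
  assumes "closed_riemannian M" "closed_riemannian N"
  shows "closed_riemannian (riemannian_product M N)"
proof -
  interpret M: closed_riemannian M by fact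
  interpret N: closed_riemannian N by fact
  have at: "atlas (riemannian_product M N) = {product_chart c d |c d. c \<in> atlas M \<and> d \<in> atlas N}"
    and mt: "mtop (riemannian_product M N) = prod_topology (mtop M) (mtop N)"
    by (simp_all add: riemannian_product_def)
  show ?thesis
  proof
    show "compact_space (mtop (riemannian_product M N))"
      using M.compact N.compact by (simp add: mt compact_space_prod_topology)
    show "Hausdorff_space (mtop (riemannian_product M N))"
      using M.hausdorff N.hausdorff by (simp add: mt Hausdorff_space_prod_topology)
    show "(\<Union>c\<in>atlas (riemannian_product M N). cdom c) = points (riemannian_product M N)"
      unfolding mt topspace_prod_topology M.cover[symmetric] N.cover[symmetric] at
      by (fastforce simp: cdom_product_chart)
  next
    fix C assume "C \<in> atlas (riemannian_product M N)"
    then obtain c d where C: "C = product_chart c d" "c \<in> atlas M" "d \<in> atlas N" by (auto simp: at)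
    show "is_chart (mtop (riemannian_product M N)) C"
      unfolding mt C(1) by (intro is_chart_product_chart M.is_chart N.is_chart C)
    show "metric_on_chart C"
      unfolding C(1) by (intro metric_on_product_chart M.open_cimage N.open_cimage M.metric_on_chart N.metric_on_chart C)
    fix C' assume "C' \<in> atlas (riemannian_product M N)"
    then obtain c' d' where C': "C' = product_chart c' d'" "c' \<in> atlas M" "d' \<in> atlas N" by (auto simp: at)
    define S1 where "S1 = coord c ` (cdom c \<inter> cdom c')"
    define S2 where "S2 = coord d ` (cdom d \<inter> cdom d')"
    define T1 where "T1 = M.transition c c'"
    define T2 where "T2 = N.transition d d'"
    note t1 = M.transition_facts[OF C(2) C'(2), folded S1_def T1_def]
    note t2 = N.transition_facts[OF C(3) C'(3), folded S2_def T2_def]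
    let ?T = "coord C' \<circ> param C"
    have S: "coord C ` (cdom C \<inter> cdom C') = S1 \<times> S2"
      unfolding C C' cdom_product_chart coord_product_chart S1_def S2_def by force
    have T: "?T z = (T1 (fst z), T2 (snd z))" if "z \<in> S1 \<times> S2" for z
    proof -
      have "fst z \<in> cimage c" "snd z \<in> cimage d" using that t1(4) t2(4) by auto
      then show ?thesis
        using param_product_chart[OF M.is_chart[OF C(2)] N.is_chart[OF C(3)], of "fst z" "snd z"]
        by (simp add: C C' coord_product_chart T1_def T2_def M.transition_def N.transition_def)
    qed
    have oS: "open (S1 \<times> S2)" using t1(1) t2(1) by (rule open_Times)
    have "Ck_on k (S1 \<times> S2) (\<lambda>z. (T1 (fst z), T2 (snd z)))" for k
      using t1(1,2) t2(1,2) by (intro Ck_on_Pair oS Ck_on_fst Ck_on_snd) (auto simp: smooth_on_def)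
    then have sm: "smooth_on (S1 \<times> S2) ?T"
      unfolding smooth_on_def using Ck_on_cong_imp[OF oS] T by (metis (no_types, lifting))
    \<comment> \<open>The derivative of the product transition is block diagonal, so the
      compatibility identities of the two factors simply add.\<close>
    have D: "frechet_derivative ?T (at z) v =
        (frechet_derivative T1 (at (fst z)) (fst v), frechet_derivative T2 (at (snd z)) (snd v))"
      if z: "z \<in> S1 \<times> S2" for z v
    proof -
      have "((\<lambda>z. T1 (fst z)) has_derivative (\<lambda>v. frechet_derivative T1 (at (fst z)) (fst v))) (at z)"
        using z by (intro has_derivative_compose[OF has_derivative_fst[OF has_derivative_ident]] t1(7)) auto
      moreover have "((\<lambda>z. T2 (snd z)) has_derivative (\<lambda>v. frechet_derivative T2 (at (snd z)) (snd v))) (at z)"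
        using z by (intro has_derivative_compose[OF has_derivative_snd[OF has_derivative_ident]] t2(7)) auto
      ultimately have "((\<lambda>z. (T1 (fst z), T2 (snd z))) has_derivative
         (\<lambda>v. (frechet_derivative T1 (at (fst z)) (fst v), frechet_derivative T2 (at (snd z)) (snd v)))) (at z)"
        by (rule has_derivative_Pair)
      then have "(?T has_derivative
         (\<lambda>v. (frechet_derivative T1 (at (fst z)) (fst v), frechet_derivative T2 (at (snd z)) (snd v)))) (at z)"
        by (rule has_derivative_transform_within_open[OF _ oS z]) (simp only: T)
      from frechet_derivative_at[OF this] show ?thesis by metis
    qed
    show "compatible C C'"
      unfolding compatible_def Let_def S
    proof (intro conjI sm ballI allI)
      fix z v w assume z: "z \<in> S1 \<times> S2"
      then have z': "fst z \<in> S1" "snd z \<in> S2" by auto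
      show "cmetric C z v w = cmetric C' (?T z) (frechet_derivative ?T (at z) v) (frechet_derivative ?T (at z) w)"
        unfolding D[OF z] T[OF z] unfolding C(1) C'(1) cmetric_product_chart fst_conv snd_conv
        using t1(8)[OF z'(1)] t2(8)[OF z'(2)] by simp
    qed
  qed
qed

section \<open>A maximum principle on a line times a compact space\<close>

text \<open>The data that a second derivative test at \<open>0\<close> needs: a first derivative
  near \<open>0\<close> which is itself differentiable at \<open>0\<close>. Both values are
  arguments, so jets of sums and reflections can be computed from given ones.\<close>

definition jet2 :: "(real \<Rightarrow> real) \<Rightarrow> real \<Rightarrow> real \<Rightarrow> bool" where
  "jet2 \<phi> d1 d2 \<longleftrightarrow> (\<exists>\<phi>'. (\<forall>\<^sub>F s in nhds 0. (\<phi> has_real_derivative \<phi>' s) (at s)) \<and> \<phi>' 0 = d1 \<and>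
     (\<phi>' has_real_derivative d2) (at 0))"

lemma jet2I:
  assumes "r > 0" "\<And>s. \<bar>s\<bar> < r \<Longrightarrow> (\<phi> has_real_derivative \<phi>' s) (at s)" "\<phi>' 0 = d1"
    "(\<phi>' has_real_derivative d2) (at 0)"
  shows "jet2 \<phi> d1 d2"
  unfolding jet2_def eventually_nhds_metric using assms by (intro exI[of _ \<phi>']) auto

lemma jet2_const: "jet2 (\<lambda>s. c) 0 0"
  by (rule jet2I[of 1 _ "\<lambda>s. 0"]) auto

lemma jet2_lincomb:
  assumes "jet2 \<phi> a b" "jet2 \<psi> a' b'"
  shows "jet2 (\<lambda>s. p * \<phi> s + q * \<psi> s) (p * a + q * a') (p * b + q * b')"
proof -
  obtain \<phi>' \<psi>' where d: "\<forall>\<^sub>F s in nhds 0. (\<phi> has_real_derivative \<phi>' s) (at s)" "\<phi>' 0 = a"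
      "(\<phi>' has_real_derivative b) (at 0)"
    "\<forall>\<^sub>F s in nhds 0. (\<psi> has_real_derivative \<psi>' s) (at s)" "\<psi>' 0 = a'"
      "(\<psi>' has_real_derivative b') (at 0)"
    using assms unfolding jet2_def by blast
  have "\<forall>\<^sub>F s in nhds 0. ((\<lambda>s. p * \<phi> s + q * \<psi> s) has_real_derivative p * \<phi>' s + q * \<psi>' s) (at s)"
    using d(1,4) by eventually_elim (auto intro!: derivative_eq_intros)
  moreover have "((\<lambda>s. p * \<phi>' s + q * \<psi>' s) has_real_derivative p * b + q * b') (at 0)"
    using d(3,6) by (auto intro!: derivative_eq_intros)
  ultimately show ?thesis
    unfolding jet2_def using d(2,5) by (intro exI[of _ "\<lambda>s. p * \<phi>' s + q * \<psi>' s"]) auto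
qed

lemma jet2_reflect:
  assumes "jet2 \<phi> a b"
  shows "jet2 (\<lambda>s. \<phi> (- s)) (- a) b"
proof -
  obtain \<phi>' r where d: "r > 0" "\<And>s. \<bar>s\<bar> < r \<Longrightarrow> (\<phi> has_real_derivative \<phi>' s) (at s)" "\<phi>' 0 = a"
      "(\<phi>' has_real_derivative b) (at 0)"
    using assms unfolding jet2_def eventually_nhds_metric dist_real_def by force
  have m: "((\<lambda>s. - s) has_real_derivative -1) (at s)" for s :: real
    by (auto intro!: derivative_eq_intros)
  show ?thesis
  proof (rule jet2I[OF d(1), of _ "\<lambda>s. - \<phi>' (- s)"])
    show "((\<lambda>s. \<phi> (- s)) has_real_derivative - \<phi>' (- s)) (at s)" if "\<bar>s\<bar> < r" for s
      using DERIV_chain2[OF d(2)[of "- s"] m] that by simp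
    show "((\<lambda>s. - \<phi>' (- s)) has_real_derivative b) (at 0)"
      using DERIV_minus[OF DERIV_chain2[where g = "\<lambda>s. - s" and x = 0 and f = \<phi>', OF _ m]] d(4) by simp
  qed (use d(3) in simp)
qed

text \<open>If the second derivative were negative, the first derivative, zero at \<open>0\<close>,
  would be negative just to the right, and the mean value theorem would push \<open>\<phi>\<close>
  below its minimum.\<close>

lemma jet2_local_min:
  assumes "jet2 \<phi> a b" "\<forall>\<^sub>F s in nhds 0. \<phi> 0 \<le> \<phi> s"
  shows "a = 0" "b \<ge> 0"
proof -
  obtain \<phi>' where d: "\<forall>\<^sub>F s in nhds 0. (\<phi> has_real_derivative \<phi>' s) (at s)" "\<phi>' 0 = a"
      "(\<phi>' has_real_derivative b) (at 0)"
    using assms(1) unfolding jet2_def by blast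
  obtain r where r: "r > 0" "\<And>s. \<bar>s\<bar> < r \<Longrightarrow> (\<phi> has_real_derivative \<phi>' s) (at s) \<and> \<phi> 0 \<le> \<phi> s"
    using eventually_conj[OF d(1) assms(2)] unfolding eventually_nhds_metric dist_real_def by force
  show a: "a = 0"
    using DERIV_local_min[of \<phi> "\<phi>' 0" 0 r] r(1) r(2)[of 0] r(2) d(2) by auto
  show "b \<ge> 0"
  proof (rule ccontr)
    assume "\<not> b \<ge> 0"
    then obtain q where q: "q > 0" "\<And>h. 0 < h \<Longrightarrow> h < q \<Longrightarrow> \<phi>' (0 + h) < \<phi>' 0"
      using DERIV_neg_dec_right[OF d(3)] by auto
    define h where "h = min q r / 2"
    have h: "0 < h" "h < q" "h < r" using q r by (auto simp: h_def)
    obtain z where z: "0 < z" "z < h" "\<phi> h - \<phi> 0 = (h - 0) * \<phi>' z"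
      using MVT2[of 0 h \<phi> \<phi>'] h r(2) by auto
    have "\<phi>' z < 0" using q(2)[of z] z h a d(2) by simp
    then have "h * \<phi>' z < 0" using h by (simp add: mult_pos_neg)
    then have "\<phi> h < \<phi> 0" using z by simp
    moreover have "\<phi> 0 \<le> \<phi> h" using r(2)[of h] h by auto
    ultimately show False by simp
  qed
qed

lemma compactin_attains_sup:
  assumes "compactin T K" "K \<noteq> {}" "continuous_map (subtopology T K) euclideanreal f"
  obtains p where "p \<in> K" "\<forall>q\<in>K. f q \<le> f p"
proof -
  have "compactin (subtopology T K) K" using assms(1) by (simp add: compactin_subtopology)
  then have "compact (f ` K)" using image_compactin[OF _ assms(3)] by simp
  then obtain y where "y \<in> f ` K" "\<forall>z\<in>f ` K. z \<le> y" using compact_attains_sup assms(2) by blast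
  then show thesis using that by auto
qed

text \<open>The operator \<open>\<partial>\<^sub>\<theta>\<^sup>2 + L\<close>, where \<open>L\<close> at \<open>x\<close> is a sum of first and second derivatives along
  curves \<open>\<gamma> x i\<close> starting at \<open>x\<close>.\<close>

locale line_operator =
  fixes X :: "'a topology" and I :: "'a \<Rightarrow> 'i set" and \<gamma> :: "'a \<Rightarrow> 'i \<Rightarrow> real \<Rightarrow> 'a" and k :: "'a \<Rightarrow> 'i \<Rightarrow> real"
  assumes compact_X: "compact_space X"
    and curve_start: "x \<in> topspace X \<Longrightarrow> i \<in> I x \<Longrightarrow> \<gamma> x i 0 = x"
    and curve_continuous: "x \<in> topspace X \<Longrightarrow> i \<in> I x \<Longrightarrow> openin X V \<Longrightarrow> x \<in> V \<Longrightarrow> \<forall>\<^sub>F s in nhds 0. \<gamma> x i s \<in> V"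
begin

text \<open>A relation, so that existence of all jets is part of saying that the operator has the
  value \<open>l\<close>. The first derivative \<open>d0\<close> in the line direction has no weight
  in \<open>l\<close>.\<close>

definition has_lapl :: "(real \<Rightarrow> 'a \<Rightarrow> real) \<Rightarrow> real \<Rightarrow> 'a \<Rightarrow> real \<Rightarrow> bool" where
  "has_lapl F \<theta> x l \<longleftrightarrow> (\<exists>d0 d2 e1 e2. jet2 (\<lambda>s. F (\<theta> + s) x) d0 d2 \<and>
     (\<forall>i\<in>I x. jet2 (\<lambda>s. F \<theta> (\<gamma> x i s)) (e1 i) (e2 i)) \<and> l = d2 + (\<Sum>i\<in>I x. e2 i + k x i * e1 i))"

lemma has_lapl_lincomb:
  assumes "has_lapl F \<theta> x l" "has_lapl G \<theta> x m"
  shows "has_lapl (\<lambda>\<theta> x. p * F \<theta> x + q * G \<theta> x) \<theta> x (p * l + q * m)"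
proof -
  obtain d0 d2 e1 e2 where F: "jet2 (\<lambda>s. F (\<theta> + s) x) d0 d2"
    "\<forall>i\<in>I x. jet2 (\<lambda>s. F \<theta> (\<gamma> x i s)) (e1 i) (e2 i)" "l = d2 + (\<Sum>i\<in>I x. e2 i + k x i * e1 i)"
    using assms(1) unfolding has_lapl_def by blast
  obtain d0' d2' e1' e2' where G: "jet2 (\<lambda>s. G (\<theta> + s) x) d0' d2'"
    "\<forall>i\<in>I x. jet2 (\<lambda>s. G \<theta> (\<gamma> x i s)) (e1' i) (e2' i)" "m = d2' + (\<Sum>i\<in>I x. e2' i + k x i * e1' i)"
    using assms(2) unfolding has_lapl_def by blast
  show ?thesis
    unfolding has_lapl_def
  proof (intro exI conjI ballI)
    show "jet2 (\<lambda>s. p * F (\<theta> + s) x + q * G (\<theta> + s) x) (p * d0 + q * d0') (p * d2 + q * d2')"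
      by (rule jet2_lincomb[OF F(1) G(1)])
    show "jet2 (\<lambda>s. p * F \<theta> (\<gamma> x i s) + q * G \<theta> (\<gamma> x i s)) (p * e1 i + q * e1' i) (p * e2 i + q * e2' i)"
      if "i \<in> I x" for i using F(2) G(2) that by (intro jet2_lincomb) auto
    show "p * l + q * m = (p * d2 + q * d2') +
        (\<Sum>i\<in>I x. (p * e2 i + q * e2' i) + k x i * (p * e1 i + q * e1' i))"
      unfolding F(3) G(3) by (simp add: sum.distrib sum_distrib_left algebra_simps)
  qed
qed

lemma has_lapl_line:
  assumes "jet2 (\<lambda>s. h (\<theta> + s)) d1 d2"
  shows "has_lapl (\<lambda>\<theta> x. h \<theta>) \<theta> x d2"
  unfolding has_lapl_def
  by (rule exI[of _ d1], rule exI[of _ d2], rule exI[of _ "\<lambda>i. 0"], rule exI[of _ "\<lambda>i. 0"])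
    (use assms jet2_const in auto)

text \<open>A reflection reverses \<open>d0\<close> and keeps \<open>d2\<close>; as
  \<open>d0\<close> does not enter \<open>l\<close>, the value is unchanged. This makes the
  reflected function a solution again.\<close>

lemma has_lapl_reflect:
  assumes "has_lapl F (c - \<theta>) x l"
  shows "has_lapl (\<lambda>\<theta> x. F (c - \<theta>) x) \<theta> x l"
proof -
  obtain d0 d2 e1 e2 where F: "jet2 (\<lambda>s. F (c - \<theta> + s) x) d0 d2"
    "\<forall>i\<in>I x. jet2 (\<lambda>s. F (c - \<theta>) (\<gamma> x i s)) (e1 i) (e2 i)" "l = d2 + (\<Sum>i\<in>I x. e2 i + k x i * e1 i)"
    using assms unfolding has_lapl_def by blast
  have "jet2 (\<lambda>s. F (c - (\<theta> + s)) x) (- d0) d2"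
    using jet2_reflect[OF F(1)] by (simp add: algebra_simps)
  then show ?thesis unfolding has_lapl_def using F by blast
qed

text \<open>At a minimum every first derivative along a curve vanishes, so the drift
  \<open>k\<close> contributes nothing, whatever its sign.\<close>

lemma has_lapl_local_min:
  assumes x: "x \<in> topspace X" and F: "has_lapl F \<theta> x l" and V: "openin X V" "x \<in> V" and r: "r > 0"
    and min: "\<And>s. \<bar>s - \<theta>\<bar> < r \<Longrightarrow> F \<theta> x \<le> F s x" "\<And>y. y \<in> V \<Longrightarrow> F \<theta> x \<le> F \<theta> y"
  shows "l \<ge> 0"
proof -
  obtain d0 d2 e1 e2 where F: "jet2 (\<lambda>s. F (\<theta> + s) x) d0 d2"
    "\<forall>i\<in>I x. jet2 (\<lambda>s. F \<theta> (\<gamma> x i s)) (e1 i) (e2 i)" "l = d2 + (\<Sum>i\<in>I x. e2 i + k x i * e1 i)"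
    using F unfolding has_lapl_def by blast
  have "\<forall>\<^sub>F s in nhds 0. F (\<theta> + 0) x \<le> F (\<theta> + s) x"
    unfolding eventually_nhds_metric using r min(1) by (intro exI[of _ r]) (auto simp: dist_real_def)
  then have d2: "d2 \<ge> 0" using jet2_local_min[OF F(1)] by simp
  have "e1 i = 0 \<and> e2 i \<ge> 0" if i: "i \<in> I x" for i
  proof -
    have "\<forall>\<^sub>F s in nhds 0. F \<theta> (\<gamma> x i 0) \<le> F \<theta> (\<gamma> x i s)"
      using curve_continuous[OF x i V] by eventually_elim (use min(2) curve_start[OF x i] in simp)
    then show ?thesis using jet2_local_min F(2) i by blast
  qed
  then have "(\<Sum>i\<in>I x. e2 i + k x i * e1 i) \<ge> 0" by (intro sum_nonneg) auto
  then show ?thesis using d2 F(3) by simp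
qed

abbreviation "LX \<equiv> prod_topology euclideanreal X"

lemma compactin_slab:
  assumes "closedin X Q"
  shows "compactin LX ({a..b} \<times> Q)"
  using assms compact_X by (simp add: compactin_Times closedin_compact_space)

lemma continuous_map_reflect:
  assumes "continuous_map LX euclideanreal (\<lambda>(\<theta>, x). F \<theta> x)"
  shows "continuous_map LX euclideanreal (\<lambda>(\<theta>, x). F (c - \<theta>) x)"
proof -
  have "continuous_map LX LX (\<lambda>p. (c - fst p, snd p))"
    by (intro continuous_map_pairedI continuous_map_diff continuous_map_const[THEN iffD2] continuous_map_fst continuous_map_snd) auto
  from continuous_map_compose[OF this assms] show ?thesis by (simp add: comp_def case_prod_unfold)
qed

lemma continuous_in_line:
  assumes "continuous_map LX euclideanreal (\<lambda>(\<theta>, x). F \<theta> x)" "x \<in> topspace X"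
  shows "continuous_on UNIV (\<lambda>\<theta>. F \<theta> x)"
proof -
  have "continuous_map euclideanreal LX (\<lambda>\<theta>. (\<theta>, x))"
    using assms(2) by (intro continuous_map_pairedI) auto
  from continuous_map_compose[OF this assms(1)] show ?thesis by (simp add: comp_def)
qed

end

text \<open>\<open>w\<close> stands for the derivative of the potential. The ratio condition
  includes \<open>t = 1\<close> because comparison functions may attain that value; the Lipschitz
  bound serves the linear comparison after reflection.\<close>

locale allen_cahn_operator = line_operator +
  fixes w :: "real \<Rightarrow> real" and K :: real
  assumes w_odd: "w (- t) = - w t"
    and w_ratio: "0 < s \<Longrightarrow> s < t \<Longrightarrow> t \<le> 1 \<Longrightarrow> w s / s < w t / t"
    and w_lipschitz: "\<bar>s\<bar> \<le> 1 \<Longrightarrow> \<bar>t\<bar> \<le> 1 \<Longrightarrow> \<bar>w s - w t\<bar> \<le> K * \<bar>s - t\<bar>"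
    and K_nonneg: "K \<ge> 0"
    and w_1: "w 1 = 0"
begin

definition solution :: "real \<Rightarrow> (real \<Rightarrow> 'a \<Rightarrow> real) \<Rightarrow> bool" where
  "solution \<epsilon> U \<longleftrightarrow> continuous_map LX euclideanreal (\<lambda>(\<theta>, x). U \<theta> x) \<and>
     (\<forall>\<theta>. \<forall>x\<in>topspace X. \<bar>U \<theta> x\<bar> \<le> 1 \<and> has_lapl U \<theta> x (w (U \<theta> x) / \<epsilon>\<^sup>2))"

lemma solution_uminus:
  assumes "solution \<epsilon> U"
  shows "solution \<epsilon> (\<lambda>\<theta> x. - U \<theta> x)"
proof -
  have c: "continuous_map LX euclideanreal (\<lambda>p. - (case p of (\<theta>, x) \<Rightarrow> U \<theta> x))"
    using assms unfolding solution_def by (intro continuous_map_minus) auto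
  have "has_lapl (\<lambda>\<theta> x. - U \<theta> x) \<theta> x (w (- U \<theta> x) / \<epsilon>\<^sup>2)" if "x \<in> topspace X" for \<theta> x
  proof -
    have "has_lapl U \<theta> x (w (U \<theta> x) / \<epsilon>\<^sup>2)" using assms that by (simp add: solution_def)
    from has_lapl_lincomb[OF this this, of "-1" 0] show ?thesis by (simp add: w_odd)
  qed
  then show ?thesis using assms c unfolding solution_def by (simp add: case_prod_unfold)
qed

text \<open>If \<open>\<Phi> / U\<close> had a maximum \<open>t > 1\<close>, then \<open>t * U\<close> would touch \<open>\<Phi>\<close> from above at an interior
  point; but \<open>t * U\<close> is a strict supersolution because \<open>w x / x\<close> is strictly increasing.\<close>

lemma subsolution_le_solution:
  assumes U: "solution \<epsilon> U" and \<epsilon>: "\<epsilon> > 0" and Q: "openin X Q" "closedin X Q"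
    and pos: "\<And>\<theta> x. \<theta> \<in> {a..b} \<Longrightarrow> x \<in> Q \<Longrightarrow> U \<theta> x > 0"
    and \<Phi>c: "continuous_map LX euclideanreal (\<lambda>(\<theta>, x). \<Phi> \<theta> x)"
    and \<Phi>1: "\<And>\<theta> x. \<theta> \<in> {a..b} \<Longrightarrow> x \<in> Q \<Longrightarrow> \<Phi> \<theta> x \<le> 1"
    and \<Phi>end: "\<And>x. x \<in> Q \<Longrightarrow> \<Phi> a x \<le> 0" "\<And>x. x \<in> Q \<Longrightarrow> \<Phi> b x \<le> 0"
    and sub: "\<And>\<theta> x. a < \<theta> \<Longrightarrow> \<theta> < b \<Longrightarrow> x \<in> Q \<Longrightarrow> \<Phi> \<theta> x > 0 \<Longrightarrow> \<exists>l. has_lapl \<Phi> \<theta> x l \<and> l \<ge> w (\<Phi> \<theta> x) / \<epsilon>\<^sup>2"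
    and \<theta>: "\<theta> \<in> {a..b}" and x: "x \<in> Q"
  shows "\<Phi> \<theta> x \<le> U \<theta> x"
proof (rule ccontr)
  assume not: "\<not> \<Phi> \<theta> x \<le> U \<theta> x"
  define S where "S = {a..b} \<times> Q"
  have QX: "Q \<subseteq> topspace X" using Q(1) openin_subset by blast
  have Uc: "continuous_map LX euclideanreal (\<lambda>(\<theta>, x). U \<theta> x)" using U by (simp add: solution_def)
  have "continuous_map (subtopology LX S) euclideanreal (\<lambda>p. (case p of (\<theta>, x) \<Rightarrow> \<Phi> \<theta> x) / (case p of (\<theta>, x) \<Rightarrow> U \<theta> x))"
    using Uc \<Phi>c pos by (intro continuous_map_real_divide continuous_map_from_subtopology) (fastforce simp: S_def)+
  \<comment> \<open>\<open>Q\<close> is closed, so the quotient attains its maximum on the slab;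
    \<open>Q\<close> is open, so this maximum is interior in the direction of
    \<open>X\<close>.\<close>
  moreover have "compactin LX S" unfolding S_def by (rule compactin_slab[OF Q(2)])
  moreover have "S \<noteq> {}" using \<theta> x by (auto simp: S_def)
  ultimately obtain p where p: "p \<in> S" "\<forall>q\<in>S.
      (case q of (\<theta>, x) \<Rightarrow> \<Phi> \<theta> x) / (case q of (\<theta>, x) \<Rightarrow> U \<theta> x) \<le> (case p of (\<theta>, x) \<Rightarrow> \<Phi> \<theta> x) / (case p of (\<theta>, x) \<Rightarrow> U \<theta> x)"
    by (metis (no_types, lifting) compactin_attains_sup)
  obtain \<theta>0 x0 where p0: "p = (\<theta>0, x0)" by fastforce
  have in0: "\<theta>0 \<in> {a..b}" "x0 \<in> Q" using p(1) by (auto simp: p0 S_def)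
  define t where "t = \<Phi> \<theta>0 x0 / U \<theta>0 x0"
  have max: "\<Phi> s y / U s y \<le> t" if "s \<in> {a..b}" "y \<in> Q" for s y
    using p(2)[rule_format, of "(s, y)"] that by (simp add: S_def p0 t_def)
  have U0: "U \<theta>0 x0 > 0" by (rule pos[OF in0])
  have t1: "t > 1"
  proof -
    have "1 < \<Phi> \<theta> x / U \<theta> x" using not pos[OF \<theta> x] by (simp add: field_simps)
    then show ?thesis using max[OF \<theta> x] by simp
  qed
  have tU: "\<Phi> \<theta>0 x0 = t * U \<theta>0 x0" using U0 by (simp add: t_def)
  have \<Phi>0: "\<Phi> \<theta>0 x0 > U \<theta>0 x0" "\<Phi> \<theta>0 x0 > 0" using U0 t1 by (simp_all add: tU)
  \<comment> \<open>At the maximum \<open>\<Phi>\<close> is positive, which the end conditions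
    exclude on the two end slices; for the same reason \<open>sub\<close> is needed only where
    \<open>\<Phi>\<close> is positive.\<close>
  have int: "a < \<theta>0" "\<theta>0 < b" using \<Phi>0(2) \<Phi>end[OF in0(2)] in0(1) by (force simp: less_le)+
  have nonneg: "0 \<le> t * U s y + (-1) * \<Phi> s y" if "s \<in> {a..b}" "y \<in> Q" for s y
    using max[OF that] pos[OF that] by (simp add: field_simps)
  obtain l where l: "has_lapl \<Phi> \<theta>0 x0 l" "l \<ge> w (\<Phi> \<theta>0 x0) / \<epsilon>\<^sup>2"
    using sub[OF int in0(2) \<Phi>0(2)] by blast
  have x0X: "x0 \<in> topspace X" using in0 QX by auto
  have "has_lapl U \<theta>0 x0 (w (U \<theta>0 x0) / \<epsilon>\<^sup>2)" using U x0X by (simp add: solution_def)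
  from has_lapl_lincomb[OF this l(1), of t "-1"]
  have "0 \<le> t * (w (U \<theta>0 x0) / \<epsilon>\<^sup>2) + (-1) * l"
  proof (rule has_lapl_local_min[OF x0X _ Q(1) in0(2), where r = "min (\<theta>0 - a) (b - \<theta>0)"])
    show "0 < min (\<theta>0 - a) (b - \<theta>0)" using int by simp
    show "t * U \<theta>0 x0 + - 1 * \<Phi> \<theta>0 x0 \<le> t * U s x0 + - 1 * \<Phi> s x0"
      if "\<bar>s - \<theta>0\<bar> < min (\<theta>0 - a) (b - \<theta>0)" for s
    proof -
      have "s \<in> {a..b}" using that by (auto simp: abs_less_iff)
      then show ?thesis using nonneg[of s x0] in0 by (simp add: tU)
    qed
    show "t * U \<theta>0 x0 + - 1 * \<Phi> \<theta>0 x0 \<le> t * U \<theta>0 y + - 1 * \<Phi> \<theta>0 y" if "y \<in> Q" for y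
      using nonneg[of \<theta>0 y] that in0 by (auto simp: tU)
  qed
  then have "w (\<Phi> \<theta>0 x0) / \<epsilon>\<^sup>2 \<le> t * w (U \<theta>0 x0) / \<epsilon>\<^sup>2" using l(2) by simp
  then have "w (\<Phi> \<theta>0 x0) \<le> t * w (U \<theta>0 x0)" using \<epsilon> by (simp add: divide_le_cancel)
  \<comment> \<open>At the touching point \<open>\<Phi> = t * U\<close> and
    \<open>U < \<Phi> \<le> 1\<close>, so strict monotonicity of \<open>w x / x\<close> contradicts
    the inequality just obtained.\<close>
  moreover have "t * w (U \<theta>0 x0) < w (\<Phi> \<theta>0 x0)"
    using w_ratio[OF U0 \<Phi>0(1) \<Phi>1[OF in0]] U0 \<Phi>0 by (simp add: t_def field_simps)
  ultimately show False by simp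
qed

text \<open>The arch \<open>(1 - \<eta>) * cos (a * (\<theta> - c))\<close> with
  \<open>a = pi / L\<close> vanishes at both ends of an interval of length \<open>L\<close>, and its
  second derivative is \<open>- a^2\<close> times itself. Since \<open>w h / h\<close> is largest at
  the top of the arch, the condition \<open>small\<close> makes the arch a subsolution at every
  height.\<close>

lemma solution_barrier:
  assumes U: "solution \<epsilon> U" and \<epsilon>: "\<epsilon> > 0" and Q: "openin X Q" "closedin X Q"
    and \<eta>: "0 < \<eta>" "\<eta> < 1" and L: "L > 0" and small: "\<epsilon>\<^sup>2 * (pi / L)\<^sup>2 \<le> - w (1 - \<eta>) / (1 - \<eta>)"
    and pos: "\<And>\<theta> x. \<theta> \<in> {c - L / 2..c + L / 2} \<Longrightarrow> x \<in> Q \<Longrightarrow> U \<theta> x > 0" and x: "x \<in> Q"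
  shows "1 - \<eta> \<le> U c x"
proof -
  define a where "a = pi / L"
  define h where "h \<theta> = (1 - \<eta>) * cos (a * (\<theta> - c))" for \<theta>
  have h_le: "h \<theta> \<le> 1 - \<eta>" for \<theta> using \<eta> by (simp add: h_def mult_left_le)
  have "h c \<le> U c x"
  proof (rule subsolution_le_solution[OF U \<epsilon> Q pos])
    have "continuous_map LX euclideanreal (h \<circ> fst)"
      by (rule continuous_map_compose[OF continuous_map_fst]) (auto simp: h_def[abs_def] intro!: continuous_intros)
    then show "continuous_map LX euclideanreal (\<lambda>(\<theta>, x). h \<theta>)" by (simp add: comp_def case_prod_unfold)
    show "h \<theta> \<le> 1" for \<theta> using h_le[of \<theta>] \<eta> by simp
    have "a * (c - L / 2 - c) = - (pi / 2)" "a * (c + L / 2 - c) = pi / 2" using L by (simp_all add: a_def divide_simps)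
    then show "h (c - L / 2) \<le> 0" "h (c + L / 2) \<le> 0" by (simp_all add: h_def)
    show "\<exists>l. has_lapl (\<lambda>\<theta> x. h \<theta>) \<theta> x l \<and> w (h \<theta>) / \<epsilon>\<^sup>2 \<le> l" if "h \<theta> > 0" for \<theta> x
    proof (intro exI conjI)
      have d: "((\<lambda>s. h (\<theta> + s)) has_real_derivative - (1 - \<eta>) * a * sin (a * (\<theta> + s - c))) (at s)" for s
        unfolding h_def by (auto intro!: derivative_eq_intros simp: algebra_simps)
      have d2: "((\<lambda>s. - (1 - \<eta>) * a * sin (a * (\<theta> + s - c))) has_real_derivative - (a\<^sup>2 * h \<theta>)) (at 0)"
        unfolding h_def by (auto intro!: derivative_eq_intros simp: power2_eq_square algebra_simps)
      show "has_lapl (\<lambda>\<theta> x. h \<theta>) \<theta> x (- (a\<^sup>2 * h \<theta>))"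
        by (rule has_lapl_line, rule jet2I[OF zero_less_one d refl d2])
      have "w (h \<theta>) / h \<theta> \<le> w (1 - \<eta>) / (1 - \<eta>)"
        using w_ratio[of "h \<theta>" "1 - \<eta>"] that h_le[of \<theta>] \<eta> by (cases "h \<theta> = 1 - \<eta>") auto
      also have "\<dots> \<le> - (\<epsilon>\<^sup>2 * a\<^sup>2)" using small by (simp add: a_def)
      finally have "w (h \<theta>) \<le> - (\<epsilon>\<^sup>2 * a\<^sup>2) * h \<theta>" using that by (simp add: pos_divide_le_eq)
      then show "w (h \<theta>) / \<epsilon>\<^sup>2 \<le> - (a\<^sup>2 * h \<theta>)" using \<epsilon> by (simp add: pos_divide_le_eq mult_ac)
    qed
  qed (use x L in auto)
  then show ?thesis by (simp add: h_def)
qed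

text \<open>Reflect in the slice \<open>c\<close>: sliding the mirror down to \<open>c\<close> from the right, the previous comparison
  gives \<open>U \<theta> + U (2 * c - \<theta>) \<ge> 0\<close>. This sum solves a linear equation, and a multiple of \<open>cosh\<close>
  is a strict subsolution below it.\<close>

lemma positive_across:
  assumes U: "solution \<epsilon> U" and \<epsilon>: "\<epsilon> > 0" and Q: "openin X Q" "closedin X Q"
    and ce: "c < e" "e < e2"
    and pos: "\<And>\<theta> x. c < \<theta> \<Longrightarrow> \<theta> \<le> e2 \<Longrightarrow> x \<in> Q \<Longrightarrow> U \<theta> x > 0"
    and nonneg: "\<And>x. x \<in> Q \<Longrightarrow> U (2 * c - e) x \<ge> 0" and x: "x \<in> Q"
  shows "U c x > 0"
proof -
  have QX: "Q \<subseteq> topspace X" using Q(1) openin_subset by blast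
  have Uc: "continuous_map LX euclideanreal (\<lambda>(\<theta>, x). U \<theta> x)" using U by (simp add: solution_def)
  have Ul: "has_lapl U \<theta> x (w (U \<theta> x) / \<epsilon>\<^sup>2)" "\<bar>U \<theta> x\<bar> \<le> 1" if "x \<in> Q" for \<theta> x
    using U QX that by (auto simp: solution_def)
  define v where "v \<theta> x = 1 * U \<theta> x + 1 * U (2 * c - \<theta>) x" for \<theta> x
  \<comment> \<open>The mirror stands at \<open>c + \<eta>\<close>, because positivity of
    \<open>U\<close> is known only strictly to the right of \<open>c\<close>. It carries the right
    end \<open>e + 2 * \<eta>\<close> to the slice \<open>2 * c - e\<close>, where
    \<open>nonneg\<close> applies; \<open>e < e2\<close> leaves room for small
    \<open>\<eta>\<close>.\<close>
  have step: "0 \<le> U \<theta> y + U (2 * (c + \<eta>) - \<theta>) y"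
    if \<eta>: "0 < \<eta>" "e + 2 * \<eta> \<le> e2" and \<theta>: "c + \<eta> \<le> \<theta>" "\<theta> \<le> e + 2 * \<eta>" and y: "y \<in> Q" for \<eta> \<theta> y
  proof -
    have "- U (2 * (c + \<eta>) - \<theta>) y \<le> U \<theta> y"
    proof (rule subsolution_le_solution[OF U \<epsilon> Q, where a = "c + \<eta>" and b = "e + 2 * \<eta>"])
      show "U \<theta> x > 0" if "\<theta> \<in> {c + \<eta>..e + 2 * \<eta>}" "x \<in> Q" for \<theta> x
        using that \<eta> by (intro pos) auto
      have "continuous_map LX euclideanreal (\<lambda>p. - (case p of (\<theta>, x) \<Rightarrow> U (2 * (c + \<eta>) - \<theta>) x))"
        by (intro continuous_map_minus continuous_map_reflect Uc)
      then show "continuous_map LX euclideanreal (\<lambda>(\<theta>, x). - U (2 * (c + \<eta>) - \<theta>) x)"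
        by (simp add: case_prod_unfold)
      show "- U (2 * (c + \<eta>) - \<theta>) x \<le> 1" if "x \<in> Q" for \<theta> x
        using Ul(2)[OF that, of "2 * (c + \<eta>) - \<theta>"] by linarith
      have e: "2 * (c + \<eta>) - (c + \<eta>) = c + \<eta>" "2 * (c + \<eta>) - (e + 2 * \<eta>) = 2 * c - e" by simp_all
      show "- U (2 * (c + \<eta>) - (c + \<eta>)) x \<le> 0" if "x \<in> Q" for x
        unfolding e using pos[of "c + \<eta>" x] that \<eta> ce by simp
      show "- U (2 * (c + \<eta>) - (e + 2 * \<eta>)) x \<le> 0" if "x \<in> Q" for x
        unfolding e using nonneg[OF that] by simp
      show "\<exists>l. has_lapl (\<lambda>\<theta> x. - U (2 * (c + \<eta>) - \<theta>) x) \<theta> x l \<and> w (- U (2 * (c + \<eta>) - \<theta>) x) / \<epsilon>\<^sup>2 \<le> l"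
        if "x \<in> Q" for \<theta> x
      proof -
        have "has_lapl (\<lambda>\<theta> x. U (2 * (c + \<eta>) - \<theta>) x) \<theta> x (w (U (2 * (c + \<eta>) - \<theta>) x) / \<epsilon>\<^sup>2)"
          by (rule has_lapl_reflect) (rule Ul(1)[OF that])
        from has_lapl_lincomb[OF this this, of "-1" 0] show ?thesis by (auto simp: w_odd)
      qed
    qed (use \<theta> y in auto)
    then show ?thesis by simp
  qed
  \<comment> \<open>Letting \<open>\<eta>\<close> tend to \<open>0\<close> brings the mirror to
    \<open>c\<close> itself, at the price of a weak inequality.\<close>
  have v0: "v \<theta> y \<ge> 0" if \<theta>: "c < \<theta>" "\<theta> \<le> e" and y: "y \<in> Q" for \<theta> y
  proof -
    have "continuous_on UNIV (\<lambda>s. U s y)" using continuous_in_line[OF Uc] y QX by blast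
    then have "isCont (\<lambda>s. U s y) (2 * c - \<theta>)" by (simp add: continuous_on_eq_continuous_at)
    moreover have "((\<lambda>\<eta>. 2 * (c + \<eta>) - \<theta>) \<longlongrightarrow> 2 * (c + 0) - \<theta>) (at_right 0)" by (intro tendsto_intros)
    ultimately have "((\<lambda>\<eta>. U (2 * (c + \<eta>) - \<theta>) y) \<longlongrightarrow> U (2 * c - \<theta>) y) (at_right 0)"
      by (simp add: isCont_tendsto_compose[where g = "\<lambda>s. U s y"])
    then have "((\<lambda>\<eta>. U \<theta> y + U (2 * (c + \<eta>) - \<theta>) y) \<longlongrightarrow> U \<theta> y + U (2 * c - \<theta>) y) (at_right 0)"
      by (intro tendsto_intros)
    moreover have "\<forall>\<^sub>F \<eta> in at_right 0. 0 \<le> U \<theta> y + U (2 * (c + \<eta>) - \<theta>) y"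
      unfolding eventually_at_right_field
    proof (intro exI[of _ "min (\<theta> - c) ((e2 - e) / 2)"] conjI allI impI)
      show "0 < min (\<theta> - c) ((e2 - e) / 2)" using \<theta> ce by simp
      show "0 \<le> U \<theta> y + U (2 * (c + \<eta>) - \<theta>) y" if "0 < \<eta>" "\<eta> < min (\<theta> - c) ((e2 - e) / 2)" for \<eta>
        by (rule step) (use that \<theta> y in auto)
    qed
    ultimately have "0 \<le> U \<theta> y + U (2 * c - \<theta>) y" by (rule tendsto_lowerbound) simp
    then show ?thesis by (simp add: v_def)
  qed
  have vsym: "v (2 * c - \<theta>) y = v \<theta> y" for \<theta> y by (simp add: v_def)
  have vcontl: "continuous_on UNIV (\<lambda>s. v s y)" if "y \<in> Q" for y
  proof -
    have "y \<in> topspace X" using that QX by auto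
    from continuous_in_line[OF Uc this] continuous_in_line[OF continuous_map_reflect[OF Uc, of "2 * c"] this]
    show ?thesis unfolding v_def by (intro continuous_intros)
  qed
  have v0': "v \<theta> y \<ge> 0" if "2 * c - e \<le> \<theta>" "\<theta> \<le> e" "y \<in> Q" for \<theta> y
  proof -
    consider "\<theta> > c" | "\<theta> < c" | "\<theta> = c" by linarith
    then show ?thesis
    proof cases
      case 1 then show ?thesis using v0 that by simp
    next
      case 2 then show ?thesis using v0[of "2 * c - \<theta>" y] that by (simp add: vsym)
    next
      case 3
      have "((\<lambda>s. v s y) \<longlongrightarrow> v c y) (at_right c)"
        using vcontl[OF that(3)] by (simp add: continuous_on_eq_continuous_at continuous_within filterlim_at_split)
      moreover have "\<forall>\<^sub>F s in at_right c. 0 \<le> v s y"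
        unfolding eventually_at_right_field by (intro exI[of _ e]) (use ce that v0 in auto)
      ultimately show ?thesis unfolding 3 by (rule tendsto_lowerbound) simp
    qed
  qed
  have vC: "continuous_map LX euclideanreal (\<lambda>(\<theta>, x). v \<theta> x)"
    using continuous_map_add[OF Uc continuous_map_reflect[OF Uc, of "2 * c"]]
    by (simp add: v_def case_prod_unfold)
  \<comment> \<open>On the slice \<open>e\<close> the first summand of \<open>v\<close> is positive
    and the second nonnegative; compactness of \<open>Q\<close> makes the lower bound
    uniform.\<close>
  obtain \<mu> where \<mu>: "\<mu> > 0" "\<And>y. y \<in> Q \<Longrightarrow> v e y \<ge> \<mu>"
  proof -
    have "continuous_map X LX (\<lambda>y. (e, y))" by (intro continuous_map_pairedI) auto
    from continuous_map_compose[OF this vC] have "continuous_map X euclideanreal (\<lambda>y. v e y)" by (simp add: comp_def)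
    then have "continuous_map (subtopology X Q) euclideanreal (\<lambda>y. - v e y)"
      by (intro continuous_map_minus continuous_map_from_subtopology)
    moreover have "compactin X Q" using Q(2) compact_X by (simp add: closedin_compact_space)
    ultimately obtain y0 where y0: "y0 \<in> Q" "\<forall>y\<in>Q. - v e y \<le> - v e y0"
      using compactin_attains_sup[of X Q] x by (metis empty_iff)
    have "v e y0 > 0" using pos[of e y0] nonneg[of y0] y0(1) ce by (simp add: v_def)
    then show thesis using that[of "v e y0"] y0(2) by auto
  qed
  \<comment> \<open>\<open>\<kappa>^2 * \<epsilon>^2 = K + 1\<close> exceeds the Lipschitz constant
    of \<open>w\<close>, which makes \<open>h\<close> a strict subsolution of the linear
    equation.\<close>
  define \<kappa> where "\<kappa> = sqrt (K + 1) / \<epsilon>"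
  have \<kappa>2: "\<kappa>\<^sup>2 = (K + 1) / \<epsilon>\<^sup>2" using K_nonneg by (simp add: \<kappa>_def power_divide)
  \<comment> \<open>Normalised so that \<open>h\<close> equals \<open>\<mu> / 2\<close> on both end
    slices and lies strictly below \<open>v\<close> there.\<close>
  define \<alpha> where "\<alpha> = \<mu> / (2 * cosh (\<kappa> * (e - c)))"
  have \<alpha>: "\<alpha> > 0" using \<mu> by (simp add: \<alpha>_def)
  define h where "h \<theta> = \<alpha> * cosh (\<kappa> * (\<theta> - c))" for \<theta>
  have hpos: "h \<theta> > 0" for \<theta> using \<alpha> by (simp add: h_def)
  have he: "h e < \<mu>" "h (2 * c - e) < \<mu>"
  proof -
    have "h e = \<mu> / 2" by (simp add: h_def \<alpha>_def)
    moreover have "h (2 * c - e) = h e"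
    proof -
      have "\<kappa> * (2 * c - e - c) = - (\<kappa> * (e - c))" by (simp add: algebra_simps)
      then show ?thesis by (simp add: h_def)
    qed
    ultimately show "h e < \<mu>" "h (2 * c - e) < \<mu>" using \<mu> by auto
  qed
  have "h c \<le> v c x"
  proof (rule ccontr)
    assume not: "\<not> h c \<le> v c x"
    define S where "S = {2 * c - e..e} \<times> Q"
    have hC: "continuous_map LX euclideanreal (h \<circ> fst)"
      by (rule continuous_map_compose[OF continuous_map_fst]) (auto simp: h_def[abs_def] intro!: continuous_intros)
    have "continuous_map (subtopology LX S) euclideanreal (\<lambda>p. (h \<circ> fst) p - (case p of (\<theta>, x) \<Rightarrow> v \<theta> x))"
      by (intro continuous_map_diff continuous_map_from_subtopology vC hC)
    moreover have "compactin LX S" unfolding S_def by (rule compactin_slab[OF Q(2)])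
    moreover have "S \<noteq> {}" using x ce by (auto simp: S_def)
    ultimately obtain p where p: "p \<in> S" "\<forall>q\<in>S. (h \<circ> fst) q - (case q of (\<theta>, x) \<Rightarrow> v \<theta> x) \<le>
        (h \<circ> fst) p - (case p of (\<theta>, x) \<Rightarrow> v \<theta> x)"
      by (metis (no_types, lifting) compactin_attains_sup)
    obtain \<theta>0 x0 where p0: "p = (\<theta>0, x0)" by fastforce
    have in0: "2 * c - e \<le> \<theta>0" "\<theta>0 \<le> e" "x0 \<in> Q" using p(1) by (auto simp: p0 S_def)
    have max: "h s - v s y \<le> h \<theta>0 - v \<theta>0 x0" if "2 * c - e \<le> s" "s \<le> e" "y \<in> Q" for s y
      using p(2)[rule_format, of "(s, y)"] that by (simp add: S_def p0)
    have neg: "v \<theta>0 x0 < h \<theta>0" using max[of c x] not x ce by simp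
    have "\<theta>0 \<noteq> e" "\<theta>0 \<noteq> 2 * c - e" using neg he \<mu>(2)[OF in0(3)] vsym[of e x0] by auto
    then have int: "2 * c - e < \<theta>0" "\<theta>0 < e" using in0 by auto
    have x0X: "x0 \<in> topspace X" using in0 QX by auto
    define l where "l = 1 * (w (U \<theta>0 x0) / \<epsilon>\<^sup>2) + 1 * (w (U (2 * c - \<theta>0) x0) / \<epsilon>\<^sup>2)"
    have vl: "has_lapl v \<theta>0 x0 l"
      unfolding v_def l_def by (intro has_lapl_lincomb Ul(1) in0 has_lapl_reflect)
    have d: "((\<lambda>s. h (\<theta>0 + s)) has_real_derivative \<alpha> * \<kappa> * sinh (\<kappa> * (\<theta>0 + s - c))) (at s)" for s
      unfolding h_def by (auto intro!: derivative_eq_intros)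
    have d2: "((\<lambda>s. \<alpha> * \<kappa> * sinh (\<kappa> * (\<theta>0 + s - c))) has_real_derivative \<kappa>\<^sup>2 * h \<theta>0) (at 0)"
      unfolding h_def by (auto intro!: derivative_eq_intros simp: power2_eq_square)
    have hl: "has_lapl (\<lambda>\<theta> x. h \<theta>) \<theta>0 x0 (\<kappa>\<^sup>2 * h \<theta>0)"
      by (rule has_lapl_line, rule jet2I[OF zero_less_one d refl d2])
    from has_lapl_lincomb[OF vl hl, of 1 "-1"]
    have "0 \<le> 1 * l + (-1) * (\<kappa>\<^sup>2 * h \<theta>0)"
    proof (rule has_lapl_local_min[OF x0X _ Q(1) in0(3), where r = "min (\<theta>0 - (2 * c - e)) (e - \<theta>0)"])
      show "0 < min (\<theta>0 - (2 * c - e)) (e - \<theta>0)" using int by simp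
      show "1 * v \<theta>0 x0 + - 1 * h \<theta>0 \<le> 1 * v s x0 + - 1 * h s"
        if "\<bar>s - \<theta>0\<bar> < min (\<theta>0 - (2 * c - e)) (e - \<theta>0)" for s
      proof -
        have "2 * c - e \<le> s" "s \<le> e" using that by (auto simp: abs_less_iff)
        then show ?thesis using max[of s x0] in0 by simp
      qed
      show "1 * v \<theta>0 x0 + - 1 * h \<theta>0 \<le> 1 * v \<theta>0 y + - 1 * h \<theta>0" if "y \<in> Q" for y
        using max[of \<theta>0 y] that in0 by auto
    qed
    then have "(K + 1) / \<epsilon>\<^sup>2 * h \<theta>0 \<le> l" by (simp add: \<kappa>2)
    then have "(K + 1) * h \<theta>0 \<le> l * \<epsilon>\<^sup>2" using \<epsilon> by (simp add: pos_divide_le_eq)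
    \<comment> \<open>Oddness of \<open>w\<close> turns the sum of the two nonlinear terms into a
      difference, which the Lipschitz condition bounds linearly in \<open>v\<close>;
      \<open>v \<ge> 0\<close> then removes the absolute value.\<close>
    also have "l * \<epsilon>\<^sup>2 = w (U \<theta>0 x0) - w (- U (2 * c - \<theta>0) x0)"
      using \<epsilon> by (simp add: l_def w_odd field_simps)
    also have "\<dots> \<le> K * \<bar>U \<theta>0 x0 - - U (2 * c - \<theta>0) x0\<bar>"
      using w_lipschitz[of "U \<theta>0 x0" "- U (2 * c - \<theta>0) x0"] Ul(2)[OF in0(3)] by (simp add: abs_le_iff)
    also have "\<dots> = K * v \<theta>0 x0" using v0'[OF in0] by (simp add: v_def)
    also have "\<dots> \<le> K * h \<theta>0" using neg K_nonneg by (intro mult_left_mono) auto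
    finally show False using hpos[of \<theta>0] by (simp add: distrib_right)
  qed
  then show ?thesis using hpos[of c] by (simp add: v_def)
qed

end

section \<open>The equation on the product as a line operator\<close>

lemma jet2_cong:
  assumes "\<forall>\<^sub>F s in nhds 0. \<phi> s = \<psi> s" "jet2 \<phi> a b"
  shows "jet2 \<psi> a b"
proof -
  obtain \<phi>' where d: "\<forall>\<^sub>F s in nhds 0. (\<phi> has_real_derivative \<phi>' s) (at s)" "\<phi>' 0 = a"
      "(\<phi>' has_real_derivative b) (at 0)"
    using assms(2) unfolding jet2_def by blast
  have "\<forall>\<^sub>F s in nhds 0. \<forall>\<^sub>F r in nhds s. \<phi> r = \<psi> r"
    using assms(1) by (simp add: eventually_eventually)
  with d(1) have "\<forall>\<^sub>F s in nhds 0. (\<psi> has_real_derivative \<phi>' s) (at s)"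
  proof eventually_elim
    case (elim s)
    then show ?case using DERIV_cong_ev[OF refl elim(2) refl] by blast
  qed
  then show ?thesis using d unfolding jet2_def by blast
qed

lemma jet2_line:
  fixes f :: "'e::euclidean_space \<Rightarrow> real"
  assumes S: "open S" "p \<in> S" and f: "Ck_on 2 S f"
  shows "jet2 (\<lambda>s. f (p + s *\<^sub>R e)) (frechet_derivative f (at p) e)
    (frechet_derivative (\<lambda>z. frechet_derivative f (at z) e) (at p) e)"
proof -
  have f2: "Ck_on (Suc (Suc 0)) S f" using f by (simp add: numeral_2_eq_2)
  have line: "((\<lambda>s. p + s *\<^sub>R e) has_derivative (\<lambda>t. t *\<^sub>R e)) (at s)" for s
    by (auto intro!: derivative_eq_intros)
  have der: "((\<lambda>s. h (p + s *\<^sub>R e)) has_real_derivative frechet_derivative h (at (p + s *\<^sub>R e)) e) (at s)"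
    if h: "Ck_on (Suc 0) S h" and s: "p + s *\<^sub>R e \<in> S" for h :: "'e \<Rightarrow> real" and s
  proof -
    note hd = Ck_on_SucD(1)[OF h s]
    have "((\<lambda>s. h (p + s *\<^sub>R e)) has_derivative (\<lambda>t. frechet_derivative h (at (p + s *\<^sub>R e)) (t *\<^sub>R e))) (at s)"
      by (rule has_derivative_compose[OF line hd])
    moreover have "(\<lambda>t. frechet_derivative h (at (p + s *\<^sub>R e)) (t *\<^sub>R e)) = (*) (frechet_derivative h (at (p + s *\<^sub>R e)) e)"
      using linear_cmul[OF has_derivative_linear[OF hd]] by (auto simp: fun_eq_iff mult.commute)
    ultimately show ?thesis by (simp add: has_field_derivative_def)
  qed
  have "open ((\<lambda>s. p + s *\<^sub>R e) -` S)"
    by (rule open_vimage[OF S(1)]) (intro continuous_intros)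
  moreover have "0 \<in> (\<lambda>s. p + s *\<^sub>R e) -` S" using S(2) by simp
  ultimately have "\<forall>\<^sub>F s in nhds 0. s \<in> (\<lambda>s. p + s *\<^sub>R e) -` S" by (rule eventually_nhds_in_open)
  then have "\<forall>\<^sub>F s in nhds 0. ((\<lambda>s. f (p + s *\<^sub>R e)) has_real_derivative frechet_derivative f (at (p + s *\<^sub>R e)) e) (at s)"
    by eventually_elim (auto intro!: der[OF Ck_on_Suc_imp[OF f2]])
  moreover have "((\<lambda>s. frechet_derivative f (at (p + s *\<^sub>R e)) e) has_real_derivative
      frechet_derivative (\<lambda>z. frechet_derivative f (at z) e) (at p) e) (at 0)"
    using der[OF Ck_on_SucD(2)[OF f2], of 0] S(2) by simp
  ultimately show ?thesis
    unfolding jet2_def by (intro exI[of _ "\<lambda>s. frechet_derivative f (at (p + s *\<^sub>R e)) e"]) simp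
qed

text \<open>Lets the coefficients at an arbitrary angle be read off at angle \<open>0\<close>, so
  that the operator on \<open>M\<close> does not depend on \<open>\<theta>\<close>.\<close>

lemma frechet_derivative_translation_invariant:
  fixes h :: "real \<times> 'e::real_normed_vector \<Rightarrow> 'f::real_normed_vector"
  assumes "\<And>s t z. h (s, z) = h (t, z)"
  shows "frechet_derivative h (at (\<theta>, y)) = frechet_derivative h (at (0, y))"
proof -
  have *: "(h has_derivative L) (at (s, y))" if "(h has_derivative L) (at (t, y))" for L s t
  proof -
    have g: "((\<lambda>z. z + (t - s, 0)) has_derivative (\<lambda>v. v)) (at (s, y))"
      by (auto intro!: derivative_eq_intros)
    have "(h has_derivative L) (at ((s, y) + (t - s, 0)))" using that by simp
    from has_derivative_compose[OF g this]
    have "((\<lambda>z. h (z + (t - s, 0))) has_derivative L) (at (s, y))" .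
    moreover have "h (z + (t - s, 0)) = h z" for z
      using assms by (cases z) simp
    ultimately show ?thesis by simp
  qed
  have "(h has_derivative L) (at (\<theta>, y)) \<longleftrightarrow> (h has_derivative L) (at (0, y))" for L
    using * by blast
  then show ?thesis by (simp add: frechet_derivative_def)
qed

lemma frechet_derivative_translation_direction:
  fixes h :: "real \<times> 'e::real_normed_vector \<Rightarrow> 'f::real_normed_vector"
  assumes "\<And>s t z. h (s, z) = h (t, z)" "h differentiable (at p)"
  shows "frechet_derivative h (at p) (1, 0) = 0"
proof -
  have "(h has_derivative frechet_derivative h (at p)) (at (p + 0 *\<^sub>R (1, 0)))"
    using assms(2) frechet_derivative_works[of h "at p"] by (simp add: zero_prod_def[symmetric])
  moreover have "((\<lambda>s. p + s *\<^sub>R (1 :: real, 0 :: 'e)) has_derivative (\<lambda>t. t *\<^sub>R (1, 0))) (at 0)"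
    by (auto intro!: derivative_eq_intros)
  ultimately have "((\<lambda>s. h (p + s *\<^sub>R (1, 0))) has_derivative (\<lambda>t. frechet_derivative h (at p) (t *\<^sub>R (1, 0)))) (at 0)"
    using has_derivative_compose by blast
  moreover have "(\<lambda>s. h (p + s *\<^sub>R (1, 0))) = (\<lambda>s. h p)"
    using assms(1) by (cases p) (auto simp: fun_eq_iff)
  ultimately have "(\<lambda>t. frechet_derivative h (at p) (t *\<^sub>R (1, 0))) = (\<lambda>t. 0)"
    using has_derivative_unique has_derivative_const by metis
  then show ?thesis by (metis scaleR_one)
qed

locale circle_product = closed_riemannian M for M :: "('a, 'e::euclidean_space) rmanifold"
begin

definition frame :: "'a \<Rightarrow> 'e set" where
  "frame x = (SOME E. finite E \<and> (\<forall>w. w = (\<Sum>e\<in>E. cmetric (chart_at M x) (coord (chart_at M x) x) w e *\<^sub>R e)))"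

definition line :: "'a \<Rightarrow> 'e \<Rightarrow> real \<Rightarrow> 'a" where
  "line x e s = param (chart_at M x) (coord (chart_at M x) x + s *\<^sub>R e)"

definition frame_N :: "'a \<Rightarrow> (real \<times> 'e) set" where
  "frame_N x = insert (1, 0) (Pair 0 ` frame x)"

text \<open>The base point at angle \<open>0\<close> lies outside the image of
  \<open>angle_chart 0\<close>. This is harmless: metric and density are given by formulas that do
  not involve the angle.\<close>

definition drift :: "'a \<Rightarrow> 'e \<Rightarrow> real" where
  "drift x e = (let C = product_chart (angle_chart 0) (chart_at M x)
     in drift_coeff (cmetric C) (vol_density C) (frame_N x) (0, coord (chart_at M x) x) (0, e))"

lemma frame:
  assumes "x \<in> points M"
  shows "finite (frame x)" "w = (\<Sum>e\<in>frame x. cmetric (chart_at M x) (coord (chart_at M x) x) w e *\<^sub>R e)"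
proof -
  let ?g = "cmetric (chart_at M x) (coord (chart_at M x) x)"
  note c = chart_at[OF assms]
  have "posdef_form ?g" by (rule posdef[OF conjunct1[OF c] coord_in_cimage[OF conjunct2[OF c]]])
  then obtain E where "finite E" "\<And>w. w = (\<Sum>e\<in>E. ?g w e *\<^sub>R e)"
    using posdef_form_orthonormal_basis by metis
  then have "\<exists>E. finite E \<and> (\<forall>w. w = (\<Sum>e\<in>E. ?g w e *\<^sub>R e))" by blast
  from someI_ex[OF this] show "finite (frame x)" "w = (\<Sum>e\<in>frame x. ?g w e *\<^sub>R e)"
    unfolding frame_def by blast+
qed

lemma line_0: "x \<in> points M \<Longrightarrow> line x e 0 = x"
  using chart_at[of x] by (simp add: line_def param_coord[OF is_chart])

lemma eventually_line_in_cimage: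
  assumes "x \<in> points M" "open V" "coord (chart_at M x) x \<in> V"
  shows "\<forall>\<^sub>F s in nhds 0. coord (chart_at M x) x + s *\<^sub>R e \<in> V"
proof -
  have "open ((\<lambda>s. coord (chart_at M x) x + s *\<^sub>R e) -` V)"
    by (rule open_vimage[OF assms(2)]) (intro continuous_intros)
  moreover have "0 \<in> (\<lambda>s. coord (chart_at M x) x + s *\<^sub>R e) -` V" using assms(3) by simp
  ultimately have "\<forall>\<^sub>F s in nhds 0. s \<in> (\<lambda>s. coord (chart_at M x) x + s *\<^sub>R e) -` V"
    by (rule eventually_nhds_in_open)
  then show ?thesis by simp
qed

lemma line_operator_M: "line_operator (mtop M) frame line"
proof
  show "compact_space (mtop M)" by (rule compact)
  show "line x i 0 = x" if "x \<in> points M" for x i by (rule line_0[OF that])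
  fix x e V assume x: "x \<in> points M" and V: "openin (mtop M) V" "x \<in> V"
  let ?c = "chart_at M x"
  note c = chart_at[OF x]
  have "openin (top_of_set (cimage ?c)) {z \<in> topspace (top_of_set (cimage ?c)). param ?c z \<in> V}"
    using openin_continuous_map_preimage[OF chart_facts(6)[OF is_chart]] c V by blast
  then have "open {z \<in> cimage ?c. param ?c z \<in> V}"
    using open_cimage c openin_open_trans by fastforce
  moreover have "coord ?c x \<in> {z \<in> cimage ?c. param ?c z \<in> V}"
    using c V by (auto simp: coord_in_cimage param_coord[OF is_chart])
  ultimately have "\<forall>\<^sub>F s in nhds 0. coord ?c x + s *\<^sub>R e \<in> {z \<in> cimage ?c. param ?c z \<in> V}"
    by (rule eventually_line_in_cimage[OF x])
  then show "\<forall>\<^sub>F s in nhds 0. line x e s \<in> V"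
    by eventually_elim (simp add: line_def)
qed

sublocale L: line_operator "mtop M" frame line drift
  by (rule line_operator_M)

sublocale N: closed_riemannian "riemannian_product unit_circle M"
  by (intro closed_riemannian_product closed_riemannian_unit_circle closed_riemannian_axioms)

lemma mtop_N: "mtop (riemannian_product unit_circle M) = prod_topology (top_of_set (sphere 0 1)) (mtop M)"
  and points_N: "points (riemannian_product unit_circle M) = sphere 0 1 \<times> points M"
  by (simp_all add: riemannian_product_def unit_circle_def)

lemma product_chart_in_atlas: "d \<in> atlas M \<Longrightarrow> product_chart (angle_chart a) d \<in> atlas (riemannian_product unit_circle M)"
  by (auto simp: riemannian_product_def unit_circle_def)

lemma frame_N_orthonormal:
  assumes "x \<in> points M"
  shows "w = (\<Sum>e\<in>frame_N x. cmetric (product_chart (angle_chart a) (chart_at M x)) (\<theta>, coord (chart_at M x) x) w e *\<^sub>R e)"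
proof -
  let ?g = "cmetric (chart_at M x) (coord (chart_at M x) x)"
  note c = chart_at[OF assms]
  have g: "posdef_form ?g" by (rule posdef[OF conjunct1[OF c] coord_in_cimage[OF conjunct2[OF c]]])
  have z: "?g v 0 = 0" for v using bilinear_rzero[OF posdef_formD(1)[OF g]] .
  have ni: "(1, 0) \<notin> Pair (0 :: real) ` frame x" by auto
  have inj: "inj_on (Pair (0 :: real)) (frame x)" by (simp add: inj_on_def)
  have "(\<Sum>e\<in>frame_N x. cmetric (product_chart (angle_chart a) (chart_at M x)) (\<theta>, coord (chart_at M x) x) w e *\<^sub>R e) =
    (fst w, 0) + (\<Sum>e\<in>frame x. ?g (snd w) e *\<^sub>R (0, e))"
    unfolding frame_N_def using frame(1)[OF assms] ni
    by (simp add: sum.reindex[OF inj] cmetric_product_chart cmetric_angle_chart z)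
  also have "(\<Sum>e\<in>frame x. ?g (snd w) e *\<^sub>R (0 :: real, e)) = (0, \<Sum>e\<in>frame x. ?g (snd w) e *\<^sub>R e)"
    by (simp add: prod_eq_iff fst_sum snd_sum)
  finally show ?thesis using frame(2)[OF assms, of "snd w"] by (simp add: prod_eq_iff)
qed

text \<open>The product metric does not depend on the angle, and the unit vector along the circle
  pairs with each frame vector to a constant. So the drift is that of \<open>M\<close> at every
  angle, with no first-order term along the circle, as the form of \<open>has_lapl\<close>
  demands.\<close>

lemma drift_coeff_N:
  fixes a :: real
  assumes x: "x \<in> points M"
  defines "d \<equiv> chart_at M x" and "y \<equiv> coord (chart_at M x) x"
  defines "C \<equiv> product_chart (angle_chart a) d"
  assumes \<theta>: "(\<theta>, y) \<in> cimage C"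
  shows "drift_coeff (cmetric C) (vol_density C) (frame_N x) (\<theta>, y) (0, e) = drift x e"
    and "drift_coeff (cmetric C) (vol_density C) (frame_N x) (\<theta>, y) (1, 0) = 0"
proof -
  let ?C = "product_chart (angle_chart 0) d"
  have y': "y = coord d x" by (simp add: y_def d_def)
  have C: "cmetric C = cmetric ?C" by (simp add: C_def product_chart_def angle_chart_def)
  then have V: "vol_density C = vol_density ?C" by (simp add: vol_density_def[abs_def])
  have ti: "cmetric C (s, z) v w = cmetric C (t, z) v w" for s t z v w
    by (simp add: C_def cmetric_product_chart cmetric_angle_chart)
  then have tC: "cmetric C (s, z) = cmetric C (t, z)" for s t z by (intro ext)
  have tv: "vol_density C (s, z) = vol_density C (t, z)" for s t z
    unfolding vol_density_def by (simp only: tC[of s z t])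
  show "drift_coeff (cmetric C) (vol_density C) (frame_N x) (\<theta>, y) (0, e) = drift x e"
    unfolding drift_coeff_def drift_def Let_def d_def[symmetric] y_def[symmetric] C[symmetric] V[symmetric]
      frechet_derivative_translation_invariant[of "vol_density C", OF tv, where \<theta> = \<theta>]
      frechet_derivative_translation_invariant[of "\<lambda>z. cmetric C z _ _", OF ti, where \<theta> = \<theta>]
    using tv[of \<theta> y 0] by (simp add: y')
  have CN: "C \<in> atlas (riemannian_product unit_circle M)"
    unfolding C_def d_def using product_chart_in_atlas chart_at[OF x] by blast
  have dif: "(\<lambda>z. cmetric C z v w) differentiable (at (\<theta>, y))" "vol_density C differentiable (at (\<theta>, y))" for v w
    using N.smooth_metric[OF CN, of "Suc 0" v w] N.Ck_vol_density[OF CN, of "Suc 0"] \<theta> by (simp_all add: Ck_on.simps(2))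
  have g: "posdef_form (cmetric d z)" if "z \<in> cimage d" for z using posdef chart_at[OF x] that by (simp add: d_def)
  have oC: "open (cimage C)" using N.open_cimage[OF CN] .
  have "frechet_derivative (\<lambda>z. cmetric C z (1, 0) e) (at (\<theta>, y)) e = 0" if e: "e \<in> frame_N x" for e
  proof -
    have "cmetric C z (1, 0) e = fst e" if "z \<in> cimage C" for z
      using that bilinear_lzero[OF posdef_formD(1)[OF g, of "snd z"]]
      by (auto simp: C_def cmetric_product_chart cmetric_angle_chart cimage_product_chart)
    then have "((\<lambda>z. cmetric C z (1, 0) e) has_derivative (\<lambda>v. 0)) (at (\<theta>, y))"
      using has_derivative_transform_within_open[OF has_derivative_const oC \<theta>, of "fst e" "\<lambda>z. cmetric C z (1, 0) e"] by simp
    from frechet_derivative_at[OF this] show ?thesis by metis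
  qed
  then show "drift_coeff (cmetric C) (vol_density C) (frame_N x) (\<theta>, y) (1, 0) = 0"
    unfolding drift_coeff_def using frechet_derivative_translation_direction[of "vol_density C", OF tv dif(2)] by simp
qed

text \<open>The equation in divergence form is expanded along the product frame. The circle vector
  yields the second derivative in \<open>\<theta>\<close>, the frame of \<open>M\<close> yields
  second derivatives and drift along the curves \<open>line x e\<close>, and the positive density
  cancels.\<close>

lemma phase_transition_has_lapl:
  assumes W: "Ck_on 2 UNIV W" and eps: "\<epsilon> > 0"
    and u: "phase_transition (riemannian_product unit_circle M) W \<epsilon> u" and x: "x \<in> points M"
  shows "L.has_lapl (\<lambda>\<theta> x. u (cis \<theta>, x)) \<theta> x (deriv W (u (cis \<theta>, x)) / \<epsilon>\<^sup>2)"
proof -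
  let ?N = "riemannian_product unit_circle M"
  define d where "d = chart_at M x"
  define y where "y = coord d x"
  \<comment> \<open>The angle chart cut at \<open>\<theta> - pi\<close> has \<open>\<theta>\<close>
    in the middle of its image, so nearby angles stay inside it.\<close>
  define C where "C = product_chart (angle_chart (\<theta> - pi)) d"
  have d: "d \<in> atlas M" "x \<in> cdom d" using chart_at[OF x] by (simp_all add: d_def)
  have CN: "C \<in> atlas ?N" unfolding C_def by (rule product_chart_in_atlas[OF d(1)])
  have ci: "cimage C = {\<theta> - pi<..<\<theta> - pi + 2 * pi} \<times> cimage d"
    by (simp add: C_def cimage_product_chart cimage_angle_chart)
  have p: "(\<theta>, y) \<in> cimage C" using coord_in_cimage[OF d(2)] by (simp add: ci y_def)
  have su: "smooth_function ?N u" and crit: "critical_point ?N W \<epsilon> u"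
    using u by (auto simp: phase_transition_def)
  define f where "f = u \<circ> param C"
  have f2: "Ck_on 2 (cimage C) f" unfolding f_def by (rule N.Ck_function[OF su CN])
  have fe: "f (s, z) = u (cis s, param d z)" if "(s, z) \<in> cimage C" for s z
    using that param_product_chart[OF is_chart_angle_chart is_chart[OF d(1)], of s "\<theta> - pi" z]
    by (simp add: f_def C_def cimage_product_chart cimage_angle_chart param_angle_chart)
  have px: "param d y = x" using param_coord[OF is_chart[OF d(1)] d(2)] by (simp add: y_def)
  have oC: "open (cimage C)" by (rule N.open_cimage[OF CN])
  have V0: "vol_density C (\<theta>, y) > 0" by (rule N.vol_density_pos[OF CN p])
  let ?D2 = "\<lambda>e. frechet_derivative (\<lambda>z. frechet_derivative f (at z) e) (at (\<theta>, y)) e"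
  let ?D1 = "\<lambda>e. frechet_derivative f (at (\<theta>, y)) e"
  have "\<epsilon>\<^sup>2 * divergence (\<lambda>z. vol_density C z *\<^sub>R riesz (cmetric C z) (frechet_derivative f (at z))) (\<theta>, y) =
      vol_density C (\<theta>, y) * deriv W (u (param C (\<theta>, y)))"
    using N.euler_lagrange[OF W su crit eps CN p] unfolding N.cgrad_def f_def .
  also have "divergence (\<lambda>z. vol_density C z *\<^sub>R riesz (cmetric C z) (frechet_derivative f (at z))) (\<theta>, y) =
    vol_density C (\<theta>, y) * ((\<Sum>e\<in>frame_N x. ?D2 e) +
      (\<Sum>e\<in>frame_N x. ?D1 e * drift_coeff (cmetric C) (vol_density C) (frame_N x) (\<theta>, y) e))"
    using V0 frame_N_orthonormal[OF x, of _ "\<theta> - pi" \<theta>, folded d_def, folded y_def C_def]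
    by (intro divergence_gradient_expand[OF oC p _ _ _ _ f2] N.smooth_metric[OF CN] N.posdef[OF CN] N.Ck_vol_density[OF CN]) auto
  finally have eq: "\<epsilon>\<^sup>2 * ((\<Sum>e\<in>frame_N x. ?D2 e) +
      (\<Sum>e\<in>frame_N x. ?D1 e * drift_coeff (cmetric C) (vol_density C) (frame_N x) (\<theta>, y) e)) = deriv W (u (cis \<theta>, x))"
    using V0 fe[OF p] px by (simp add: f_def)
  note dr = drift_coeff_N[OF x, of \<theta> "\<theta> - pi", folded d_def, folded y_def, folded C_def, OF p]
  have ni: "(1, 0) \<notin> Pair (0 :: real) ` frame x" by auto
  have inj: "inj_on (Pair (0 :: real)) (frame x)" by (simp add: inj_on_def)
  have sumN: "(\<Sum>e\<in>frame_N x. h e) = h (1, 0) + (\<Sum>e\<in>frame x. h (0, e))" for h :: "real \<times> 'e \<Rightarrow> real"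
    unfolding frame_N_def using frame(1)[OF x] ni by (simp add: sum.reindex[OF inj])
  have eq2: "\<epsilon>\<^sup>2 * (?D2 (1, 0) + (\<Sum>e\<in>frame x. ?D2 (0, e) + drift x e * ?D1 (0, e))) = deriv W (u (cis \<theta>, x))"
    using eq unfolding sumN dr by (simp add: sum.distrib mult.commute add.assoc)
  note jet = jet2_line[OF oC p f2]
  have j0: "jet2 (\<lambda>s. u (cis (\<theta> + s), x)) (?D1 (1, 0)) (?D2 (1, 0))"
  proof (rule jet2_cong[OF _ jet])
    have "\<forall>\<^sub>F s in nhds 0. s \<in> {- pi<..<pi}" by (rule eventually_nhds_in_open) auto
    then show "\<forall>\<^sub>F s in nhds 0. f ((\<theta>, y) + s *\<^sub>R (1, 0)) = u (cis (\<theta> + s), x)"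
    proof eventually_elim
      case (elim s)
      then have "(\<theta> + s, y) \<in> cimage C" using p by (simp add: ci)
      then show ?case using fe[of "\<theta> + s" y] px by simp
    qed
  qed
  have je: "jet2 (\<lambda>s. u (cis \<theta>, line x e s)) (?D1 (0, e)) (?D2 (0, e))" for e
  proof (rule jet2_cong[OF _ jet])
    have "\<forall>\<^sub>F s in nhds 0. y + s *\<^sub>R e \<in> cimage d"
      using eventually_line_in_cimage[OF x open_cimage[OF d(1)], of e] coord_in_cimage[OF d(2)]
      by (simp add: y_def d_def)
    then show "\<forall>\<^sub>F s in nhds 0. f ((\<theta>, y) + s *\<^sub>R (0, e)) = u (cis \<theta>, line x e s)"
    proof eventually_elim
      case (elim s)
      then have "(\<theta>, y + s *\<^sub>R e) \<in> cimage C" using p by (simp add: ci)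
      then show ?case using fe[of \<theta> "y + s *\<^sub>R e"] by (simp add: line_def d_def y_def)
    qed
  qed
  have "deriv W (u (cis \<theta>, x)) / \<epsilon>\<^sup>2 = ?D2 (1, 0) + (\<Sum>e\<in>frame x. ?D2 (0, e) + drift x e * ?D1 (0, e))"
    using eq2 eps by (simp add: field_simps)
  then show ?thesis
    unfolding L.has_lapl_def
    by (intro exI[of _ "?D1 (1, 0)"] exI[of _ "?D2 (1, 0)"] exI[of _ "\<lambda>e. ?D1 (0, e)"]
        exI[of _ "\<lambda>e. ?D2 (0, e)"] conjI ballI j0 je)
qed

end

section \<open>The derivative of the potential meets the comparison hypotheses\<close>

lemma double_well_deriv:
  assumes W: "double_well W"
  shows "Ck_on k UNIV W"
    and "deriv W (- t) = - deriv W t" "deriv W 1 = 0"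
    and "0 < s \<Longrightarrow> s < t \<Longrightarrow> t \<le> 1 \<Longrightarrow> deriv W s / s < deriv W t / t"
    and "\<exists>K\<ge>0. \<forall>s t. \<bar>s\<bar> \<le> 1 \<longrightarrow> \<bar>t\<bar> \<le> 1 \<longrightarrow> \<bar>deriv W s - deriv W t\<bar> \<le> K * \<bar>s - t\<bar>"
proof -
  show C: "Ck_on k UNIV W" for k using W by (simp add: double_well_def smooth_on_def)
  note d = Ck_on_deriv(1)[OF C]
  note d2 = Ck_on_deriv[OF Ck_on_deriv(2)[OF C]]
  have even: "W (- x) = W x" for x using W by (metis double_well_def)
  show "deriv W (- t) = - deriv W t" for t
  proof -
    have "((\<lambda>x. W (- x)) has_real_derivative deriv W (- t) * -1) (at t)"
      by (rule DERIV_chain2[OF d]) (auto intro!: derivative_eq_intros)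
    then have "(W has_real_derivative - deriv W (- t)) (at t)" by (simp add: even)
    then show ?thesis using DERIV_unique[OF d] by fastforce
  qed
  have "W 1 = 0" "\<And>x. W x \<ge> 0" using W by (auto simp: double_well_def)
  then show "deriv W 1 = 0" using DERIV_local_min[OF d[of 1], of 1] by simp
  have mono: "deriv W s / s < deriv W t / t" if "0 < s" "s < t" "t < 1" for s t
    using W that unfolding double_well_def strict_mono_on_def by auto
  \<comment> \<open>Monotonicity is given on the open interval only. At \<open>t = 1\<close> a left
    limit yields a weak inequality, and the intermediate point \<open>r\<close> restores
    strictness.\<close>
  show "deriv W s / s < deriv W t / t" if st: "0 < s" "s < t" "t \<le> 1" for s t
  proof (cases "t < 1")
    case False
    then have t: "t = 1" using st by simp
    define r where "r = (s + 1) / 2"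
    have r: "s < r" "r < 1" using st t by (auto simp: r_def)
    have "isCont (\<lambda>x. deriv W x / x) 1"
      using DERIV_isCont[OF d2(1)] by (intro continuous_intros) auto
    then have "((\<lambda>x. deriv W x / x) \<longlongrightarrow> deriv W 1 / 1) (at_left 1)"
      by (simp add: isCont_def filterlim_at_split)
    moreover have "\<forall>\<^sub>F x in at_left 1. deriv W r / r \<le> deriv W x / x"
      unfolding eventually_at_left_field using r st mono by (intro exI[of _ r]) (auto intro: less_imp_le)
    ultimately have "deriv W r / r \<le> deriv W 1 / 1" by (rule tendsto_lowerbound) simp
    then show ?thesis using mono[of s r] r st t by simp
  qed (use mono st in simp)
  have "compact (deriv (deriv W) ` {-1..1})"
    using Ck_on_imp_continuous_on[OF d2(2)] continuous_on_subset by (intro compact_continuous_image) auto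
  then obtain K where K: "\<forall>x\<in>{-1..1}. \<bar>deriv (deriv W) x\<bar> \<le> K"
    using compact_imp_bounded[of "deriv (deriv W) ` {-1..1}"] unfolding bounded_iff by auto
  have "\<bar>deriv W s - deriv W t\<bar> \<le> \<bar>K\<bar> * \<bar>s - t\<bar>" if "\<bar>s\<bar> \<le> 1" "\<bar>t\<bar> \<le> 1" for s t
  proof -
    have "norm (deriv W s - deriv W t) \<le> \<bar>K\<bar> * norm (s - t)"
    proof (rule field_differentiable_bound[where S = "{-1..1}" and f' = "deriv (deriv W)"])
      show "(deriv W has_field_derivative deriv (deriv W) z) (at z within {- 1..1})" for z
        using d2(1) has_field_derivative_at_within by blast
      show "norm (deriv (deriv W) z) \<le> \<bar>K\<bar>" if "z \<in> {-1..1}" for z using K that by fastforce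
    qed (use that in auto)
    then show ?thesis by simp
  qed
  then show "\<exists>K\<ge>0. \<forall>s t. \<bar>s\<bar> \<le> 1 \<longrightarrow> \<bar>t\<bar> \<le> 1 \<longrightarrow> \<bar>deriv W s - deriv W t\<bar> \<le> K * \<bar>s - t\<bar>"
    by (intro exI[of _ "\<bar>K\<bar>"]) auto
qed

lemma (in circle_product) continuous_map_lift:
  assumes "smooth_function (riemannian_product unit_circle M) u"
  shows "continuous_map L.LX euclideanreal (\<lambda>(\<theta>, x). u (cis \<theta>, x))"
proof -
  have "continuous_map L.LX (mtop (riemannian_product unit_circle M)) (\<lambda>p. (cis (fst p), snd p))"
    unfolding mtop_N
  proof (intro continuous_map_pairedI continuous_map_snd)
    have "continuous_map euclideanreal (top_of_set (sphere 0 1)) cis"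
      by (auto simp: continuous_map_in_subtopology cis_conv_exp[abs_def] intro!: continuous_intros)
    then show "continuous_map L.LX (top_of_set (sphere 0 1)) (\<lambda>p. cis (fst p))"
      using continuous_map_compose[OF continuous_map_fst] by (simp add: comp_def)
  qed
  from continuous_map_compose[OF this N.continuous_map_smooth_function[OF assms]]
  show ?thesis by (simp add: comp_def case_prod_unfold)
qed

section \<open>Hausdorff convergence of the nodal sets\<close>

lemma dist_cis: "dist (cis a) (cis b) = 2 * \<bar>sin ((a - b) / 2)\<bar>"
proof -
  have "cis a - cis b = cis b * (cis (a - b) - 1)" by (simp add: algebra_simps cis_mult)
  then have "dist (cis a) (cis b) = norm (exp (\<i> * of_real (a - b)) - 1)"
    by (simp add: dist_norm norm_mult cis_conv_exp[of "a - b"])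
  then show ?thesis using dist_exp_i_1[of "a - b"] by simp
qed

lemma dist_cis_le: "dist (cis a) (cis b) \<le> \<bar>a - b\<bar>"
  using abs_sin_x_le_abs_x[of "(a - b) / 2"] by (simp add: dist_cis)

lemma exists_2pi_shift:
  obtains k :: int where "\<bar>t - 2 * pi * k\<bar> \<le> pi"
proof -
  define k where "k = \<lfloor>t / (2 * pi) + 1 / 2\<rfloor>"
  have "of_int k \<le> t / (2 * pi) + 1 / 2" "t / (2 * pi) + 1 / 2 < of_int k + 1"
    unfolding k_def by linarith+
  then have "2 * pi * k \<le> t + pi" "t < 2 * pi * k + pi" by (simp_all add: field_simps)
  then show thesis using that[of k] by (simp add: abs_le_iff)
qed

text \<open>On the compact set of angles in \<open>{-pi..pi}\<close> at distance at least
  \<open>\<delta>\<close> from \<open>0\<close>, the chord to \<open>1\<close> has a positive lower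
  bound. A shorter chord forces a small angle after a shift by full turns.\<close>

lemma chord_small_imp_angle_small:
  assumes "\<delta> > 0"
  obtains \<eta> where "\<eta> > 0" "\<And>a b. dist (cis a) (cis b) < \<eta> \<Longrightarrow> \<exists>k::int. \<bar>a - (b + 2 * pi * k)\<bar> < \<delta>"
proof -
  define S where "S = {-pi..pi} - {-\<delta><..<\<delta>}"
  have cS: "compact S" unfolding S_def by (intro compact_diff) auto
  have pos: "dist (cis s) 1 > 0" if "s \<in> S" for s
  proof -
    have "cis s \<noteq> cis 0" using cis_inj_2pi[of s 0] that assms pi_gt_zero by (auto simp: S_def)
    then show ?thesis by simp
  qed
  obtain \<eta> where \<eta>: "\<eta> > 0" "\<forall>s\<in>S. dist (cis s) 1 \<ge> \<eta>"
  proof (cases "S = {}")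
    case True
    then show thesis using that[of 1] by simp
  next
    case False
    have "continuous_on S (\<lambda>s. dist (cis s) 1)" unfolding cis_conv_exp by (intro continuous_intros)
    then obtain s where "s \<in> S" "\<forall>s'\<in>S. dist (cis s) 1 \<le> dist (cis s') 1"
      using continuous_attains_inf[OF cS False] by blast
    then show thesis using that[of "dist (cis s) 1"] pos by blast
  qed
  have "\<exists>k::int. \<bar>a - (b + 2 * pi * k)\<bar> < \<delta>" if d: "dist (cis a) (cis b) < \<eta>" for a b
  proof -
    obtain k :: int where k: "\<bar>a - b - 2 * pi * k\<bar> \<le> pi" using exists_2pi_shift .
    define s where "s = a - b - 2 * pi * k"
    have "cis s = cis (a - b)" using cis_eq_cis_iff[of "a - b" s] by (auto simp: s_def)
    then have "dist (cis s) 1 < \<eta>"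
      using d dist_cis[of "a - b" 0] dist_cis[of a b] by simp
    then have "s \<notin> S" using \<eta>(2) by force
    then have "\<bar>s\<bar> < \<delta>" using k by (auto simp: S_def s_def abs_le_iff)
    then show ?thesis by (intro exI[of _ k]) (simp add: s_def algebra_simps)
  qed
  then show thesis using that \<eta>(1) by blast
qed

text \<open>The derivative may be unbounded near the finite exceptional set, so integrability is not
  known in advance. If the integral is infinite the estimate is trivial; otherwise the fundamental
  theorem applies.\<close>

lemma has_vector_derivative_diff_le_nn_integral:
  fixes f :: "real \<Rightarrow> real"
  assumes st: "s \<le> t" and S: "finite S" and cont: "continuous_on {s..t} f"
    and der: "\<And>r. r \<in> {s..t} - S \<Longrightarrow> (f has_vector_derivative D r) (at r)"
    and contD: "continuous_on ({s..t} - S) D"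
  shows "(\<lambda>r. \<bar>D r\<bar> * indicator ({s<..<t} - S) r) \<in> borel_measurable borel"
    and "ennreal \<bar>f t - f s\<bar> \<le> (\<integral>\<^sup>+r. ennreal (\<bar>D r\<bar> * indicator ({s<..<t} - S) r) \<partial>lborel)"
proof -
  let ?A = "{s<..<t} - S"
  have A: "open ?A" using S by (simp add: open_Diff finite_imp_closed)
  have cA: "continuous_on ?A D" by (rule continuous_on_subset[OF contD]) auto
  have h[measurable]: "(\<lambda>r. D r * indicator ?A r) \<in> borel_measurable borel"
    using cA A by (intro continuous_on_times_indicator_measurable[where S = ?A]) auto
  show "(\<lambda>r. \<bar>D r\<bar> * indicator ?A r) \<in> borel_measurable borel"
    using cA A by (intro continuous_on_times_indicator_measurable[where S = ?A] continuous_intros) auto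
  have abs: "\<bar>D r\<bar> * indicator ?A r = norm (D r * indicator ?A r)" for r by (simp add: abs_mult)
  show "ennreal \<bar>f t - f s\<bar> \<le> (\<integral>\<^sup>+r. ennreal (\<bar>D r\<bar> * indicator ?A r) \<partial>lborel)"
  proof (cases "(\<integral>\<^sup>+r. ennreal (norm (D r * indicator ?A r)) \<partial>lborel) < \<infinity>")
    case True
    then have i: "integrable lborel (\<lambda>r. D r * indicator ?A r)"
      by (intro integrableI_bounded) auto
    have "(D has_integral (f t - f s)) {s..t}"
      by (rule fundamental_theorem_of_calculus_strong[OF S st der cont])
    then have "((\<lambda>r. D r * indicator ?A r) has_integral (f t - f s)) {s..t}"
      by (rule has_integral_spike_finite[where S = "insert s (insert t S)", rotated 2]) (use S in auto)
    then have "((\<lambda>r. D r * indicator ?A r) has_integral (f t - f s)) UNIV"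
      by (rule has_integral_on_superset) auto
    then have "f t - f s = integral\<^sup>L lborel (\<lambda>r. D r * indicator ?A r)"
      using has_integral_integral_lborel[OF i] has_integral_unique by blast
    then show ?thesis using integral_norm_bound_ennreal[OF i] unfolding abs by simp
  next
    case False
    then show ?thesis unfolding abs by (simp add: not_less top_unique)
  qed
qed

section \<open>Riemannian distance controls the angle and respects the clopen parts of
  \<open>M\<close>\<close>

context circle_product
begin

abbreviation "NN \<equiv> riemannian_product unit_circle M"

lemma atlas_NE:
  assumes "C \<in> atlas NN"
  obtains a d where "C = product_chart (angle_chart a) d" "d \<in> atlas M"
  using assms by (auto simp: riemannian_product_def unit_circle_def)

text \<open>The speed is computed in a chart depending on the time, so the derivative found in the chart
  \<open>C\<close> has to be moved there.\<close>

lemma speed_ge_angular: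
  assumes C: "C \<in> atlas NN" and r: "s < r" "r < t" and sub: "\<gamma> ` {s..t} \<subseteq> cdom C"
    and der: "(coord C \<circ> \<gamma> has_vector_derivative v) (at r)"
  shows "\<bar>fst v\<bar> \<le> speed NN \<gamma> r"
proof -
  define C' where "C' = chart_at NN (\<gamma> r)"
  have gr: "\<gamma> r \<in> cdom C" using sub r by auto
  then have C': "C' \<in> atlas NN" "\<gamma> r \<in> cdom C'"
    using N.chart_at[of "\<gamma> r"] N.cdom_subset[OF C] by (auto simp: C'_def)
  let ?y = "coord C (\<gamma> r)"
  have y: "?y \<in> coord C ` (cdom C \<inter> cdom C')" using gr C' by auto
  note T = N.transition_facts[OF C C'(1)]
  let ?T = "N.transition C C'"
  let ?DT = "frechet_derivative ?T (at ?y)"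
  have lin: "linear ?DT" using has_derivative_linear[OF T(7)[OF y]] .
  have Tc: "?T (coord C p) = coord C' p" if "p \<in> cdom C" for p
    by (simp add: N.transition_def param_coord[OF N.is_chart[OF C] that])
  have "((coord C \<circ> \<gamma>) has_derivative (\<lambda>h. h *\<^sub>R v)) (at r)"
    using der by (simp add: has_vector_derivative_def)
  moreover have "(?T has_derivative ?DT) (at ((coord C \<circ> \<gamma>) r))" using T(7)[OF y] by simp
  ultimately have "((\<lambda>q. ?T ((coord C \<circ> \<gamma>) q)) has_derivative (\<lambda>h. ?DT (h *\<^sub>R v))) (at r)"
    by (rule has_derivative_compose)
  then have "((\<lambda>q. ?T ((coord C \<circ> \<gamma>) q)) has_derivative (\<lambda>h. h *\<^sub>R ?DT v)) (at r)"
    by (simp add: linear_cmul[OF lin])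
  then have "((coord C' \<circ> \<gamma>) has_derivative (\<lambda>h. h *\<^sub>R ?DT v)) (at r)"
  proof (rule has_derivative_transform_within_open[of _ _ _ _ "{s<..<t}"])
    show "?T ((coord C \<circ> \<gamma>) q) = (coord C' \<circ> \<gamma>) q" if "q \<in> {s<..<t}" for q
      using Tc[of "\<gamma> q"] sub that by (auto simp: image_subset_iff)
  qed (use r in auto)
  then have vd: "vector_derivative (coord C' \<circ> \<gamma>) (at r) = ?DT v"
    by (intro vector_derivative_at) (simp add: has_vector_derivative_def)
  obtain a d where Cd: "C = product_chart (angle_chart a) d" "d \<in> atlas M" using atlas_NE[OF C] .
  have "snd ?y \<in> cimage d" using coord_in_cimage[OF gr] unfolding Cd by (auto simp: cimage_product_chart)
  then have "cmetric d (snd ?y) (snd v) (snd v) \<ge> 0"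
    using posdef_formD(4)[OF posdef[OF Cd(2)]] by blast
  \<comment> \<open>The part of the metric coming from \<open>M\<close> is nonnegative and is
    dropped.\<close>
  then have "(fst v)\<^sup>2 \<le> cmetric C ?y v v"
    unfolding Cd(1) cmetric_product_chart cmetric_angle_chart by (simp add: power2_eq_square)
  also have "\<dots> = cmetric C' (coord C' (\<gamma> r)) (?DT v) (?DT v)"
    unfolding T(8)[OF y] Tc[OF gr] ..
  finally have "sqrt ((fst v)\<^sup>2) \<le> sqrt (cmetric C' (coord C' (\<gamma> r)) (?DT v) (?DT v))"
    by (rule real_sqrt_le_mono)
  then show ?thesis
    unfolding speed_def Let_def C'_def[symmetric] vd by simp
qed

text \<open>The speed is computed in a chart that \<open>chart_at\<close> picks anew at every time,
  so its measurability is not at hand. A measurable minorant \<open>g\<close> is carried along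
  instead: integrals of minorants can be added, and they stay below the length.\<close>

lemma chord_le_local:
  assumes C: "C \<in> atlas NN" and st: "s \<le> t" and sub: "\<gamma> ` {s..t} \<subseteq> cdom C"
    and pw: "(coord C \<circ> \<gamma>) piecewise_C1_differentiable_on {s..t}"
  shows "\<exists>g\<in>borel_measurable borel. (\<forall>r. g r \<le> ennreal (speed NN \<gamma> r) * indicator {s..t} r) \<and>
    ennreal (dist (fst (\<gamma> s)) (fst (\<gamma> t))) \<le> (\<integral>\<^sup>+r. g r \<partial>lborel)"
proof -
  obtain S where S: "finite S" "(coord C \<circ> \<gamma>) C1_differentiable_on ({s..t} - S)"
    and cont: "continuous_on {s..t} (coord C \<circ> \<gamma>)"
    using pw unfolding piecewise_C1_differentiable_on_def by blast
  obtain D where D: "\<And>r. r \<in> {s..t} - S \<Longrightarrow> (coord C \<circ> \<gamma> has_vector_derivative D r) (at r)"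
    and Dc: "continuous_on ({s..t} - S) D"
    using S(2) unfolding C1_differentiable_on_def by blast
  define f where "f r = fst (coord C (\<gamma> r))" for r
  let ?g = "\<lambda>r. \<bar>fst (D r)\<bar> * indicator ({s<..<t} - S) r"
  have fc: "continuous_on {s..t} f"
    using continuous_on_fst[OF cont] by (simp add: f_def comp_def)
  have fd: "(f has_vector_derivative fst (D r)) (at r)" if "r \<in> {s..t} - S" for r
    using bounded_linear.has_vector_derivative[OF bounded_linear_fst D[OF that]] by (simp add: f_def[abs_def] comp_def)
  have Dc': "continuous_on ({s..t} - S) (\<lambda>r. fst (D r))" by (rule continuous_on_fst[OF Dc])
  note b = has_vector_derivative_diff_le_nn_integral[OF st S(1) fc fd Dc']
  obtain a d where Cd: "C = product_chart (angle_chart a) d" "d \<in> atlas M" using atlas_NE[OF C] .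
  have cf: "cis (f r) = fst (\<gamma> r)" if "r \<in> {s..t}" for r
  proof -
    have "\<gamma> r \<in> cdom C" using sub that by auto
    then have "fst (\<gamma> r) \<in> cdom (angle_chart a)" by (auto simp: Cd cdom_product_chart)
    then show ?thesis
      using coord_angle_chart_props(1) by (simp add: f_def Cd coord_product_chart case_prod_unfold)
  qed
  have "dist (fst (\<gamma> s)) (fst (\<gamma> t)) \<le> \<bar>f t - f s\<bar>"
    using dist_cis_le[of "f s" "f t"] cf[of s] cf[of t] st by (simp add: abs_minus_commute)
  then have "ennreal (dist (fst (\<gamma> s)) (fst (\<gamma> t))) \<le> (\<integral>\<^sup>+r. ennreal (?g r) \<partial>lborel)"
    using b(2) by (meson ennreal_leI order_trans)
  moreover have "\<forall>r. ennreal (?g r) \<le> ennreal (speed NN \<gamma> r) * indicator {s..t} r"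
  proof
    fix r
    show "ennreal (?g r) \<le> ennreal (speed NN \<gamma> r) * indicator {s..t} r"
  proof (cases "r \<in> {s<..<t} - S")
    case True
    then show ?thesis
      using speed_ge_angular[OF C _ _ sub D, of r] by (auto intro!: ennreal_leI)
  qed simp
  qed
  moreover have "(\<lambda>r. ennreal (?g r)) \<in> borel_measurable borel" using b(1) by simp
  ultimately show ?thesis by (intro bexI[of _ "\<lambda>r. ennreal (?g r)"] conjI)
qed

lemma chord_le_curve_length:
  assumes \<gamma>: "piecewise_C1_curve NN \<gamma>"
  shows "ennreal (dist (fst (\<gamma> 0)) (fst (\<gamma> 1))) \<le> curve_length NN \<gamma>"
proof -
  define P where "P s t \<longleftrightarrow> (0 \<le> s \<and> t \<le> 1 \<longrightarrow>
    (\<exists>g\<in>borel_measurable borel. (\<forall>r. g r \<le> ennreal (speed NN \<gamma> r) * indicator {s..t} r) \<and>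
    ennreal (dist (fst (\<gamma> s)) (fst (\<gamma> t))) \<le> (\<integral>\<^sup>+r. g r \<partial>lborel)))" for s t :: real
  have gc: "continuous_map (top_of_set {0..1}) (mtop NN) \<gamma>"
    and gp: "\<And>C s t. C \<in> atlas NN \<Longrightarrow> 0 \<le> s \<Longrightarrow> s \<le> t \<Longrightarrow> t \<le> 1 \<Longrightarrow> \<gamma> ` {s..t} \<subseteq> cdom C \<Longrightarrow>
      (coord C \<circ> \<gamma>) piecewise_C1_differentiable_on {s..t}"
    using \<gamma> unfolding piecewise_C1_curve_def by blast+
  have "P 0 1"
  \<comment> \<open>Subdivision principle: the estimate holds on short intervals, whose image lies
    in one chart, and passes to the union of two adjacent intervals.\<close>
  proof (induction rule: Bolzano[of 0 1 P, OF zero_le_one, case_names trans local])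
    case (trans a b c)
    show ?case
      unfolding P_def
    proof (intro impI)
      assume ac: "0 \<le> a \<and> c \<le> 1"
      obtain g1 where g1: "g1 \<in> borel_measurable borel" "\<And>r. g1 r \<le> ennreal (speed NN \<gamma> r) * indicator {a..b} r"
        "ennreal (dist (fst (\<gamma> a)) (fst (\<gamma> b))) \<le> (\<integral>\<^sup>+r. g1 r \<partial>lborel)"
        using trans ac unfolding P_def by auto
      obtain g2 where g2: "g2 \<in> borel_measurable borel" "\<And>r. g2 r \<le> ennreal (speed NN \<gamma> r) * indicator {b..c} r"
        "ennreal (dist (fst (\<gamma> b)) (fst (\<gamma> c))) \<le> (\<integral>\<^sup>+r. g2 r \<partial>lborel)"
        using trans ac unfolding P_def by auto
      \<comment> \<open>The common endpoint \<open>b\<close> is removed from both minorants, so that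
        their sum stays below the speed; a single point does not change the integrals.\<close>
      define g where "g r = g1 r * indicator (- {b}) r + g2 r * indicator (- {b}) r" for r
      have m1: "(\<lambda>r. g1 r * indicator (- {b}) r) \<in> borel_measurable borel"
        "(\<lambda>r. g2 r * indicator (- {b}) r) \<in> borel_measurable borel"
        using g1(1) g2(1) by measurable
      have gm: "g \<in> borel_measurable borel" unfolding g_def[abs_def] using m1 by measurable
      have ae: "AE r in lborel. r \<noteq> b" by (rule AE_lborel_singleton)
      have i1: "(\<integral>\<^sup>+r. g1 r * indicator (- {b}) r \<partial>lborel) = (\<integral>\<^sup>+r. g1 r \<partial>lborel)"
        by (rule nn_integral_cong_AE) (use ae in \<open>auto elim!: eventually_mono\<close>)
      have i2: "(\<integral>\<^sup>+r. g2 r * indicator (- {b}) r \<partial>lborel) = (\<integral>\<^sup>+r. g2 r \<partial>lborel)"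
        by (rule nn_integral_cong_AE) (use ae in \<open>auto elim!: eventually_mono\<close>)
      have "(\<integral>\<^sup>+r. g r \<partial>lborel) = (\<integral>\<^sup>+r. g1 r \<partial>lborel) + (\<integral>\<^sup>+r. g2 r \<partial>lborel)"
        unfolding g_def i1[symmetric] i2[symmetric] using m1 by (intro nn_integral_add) auto
      moreover have "ennreal (dist (fst (\<gamma> a)) (fst (\<gamma> c))) \<le>
          ennreal (dist (fst (\<gamma> a)) (fst (\<gamma> b))) + ennreal (dist (fst (\<gamma> b)) (fst (\<gamma> c)))"
        by (simp add: ennreal_plus[symmetric] dist_triangle del: ennreal_plus)
      ultimately have "ennreal (dist (fst (\<gamma> a)) (fst (\<gamma> c))) \<le> (\<integral>\<^sup>+r. g r \<partial>lborel)"
        using add_mono[OF g1(3) g2(3)] by simp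
      moreover have "g r \<le> ennreal (speed NN \<gamma> r) * indicator {a..c} r" for r
      proof -
        consider "r < b" | "r = b" | "r > b" by linarith
        then show ?thesis
        proof cases
          case 1
          then show ?thesis using g1(2)[of r] g2(2)[of r] trans(3,4) by (auto simp: g_def indicator_def split: if_splits)
        next
          case 3
          then show ?thesis using g1(2)[of r] g2(2)[of r] trans(3,4) by (auto simp: g_def indicator_def split: if_splits)
        qed (simp add: g_def)
      qed
      ultimately show "\<exists>g\<in>borel_measurable borel. (\<forall>r. g r \<le> ennreal (speed NN \<gamma> r) * indicator {a..c} r) \<and>
        ennreal (dist (fst (\<gamma> a)) (fst (\<gamma> c))) \<le> (\<integral>\<^sup>+r. g r \<partial>lborel)"
        using gm by blast
    qed
  next
    case (local x)
    then have gx: "\<gamma> x \<in> points NN" using continuous_map_image_subset_topspace[OF gc] by auto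
    define C where "C = chart_at NN (\<gamma> x)"
    have C: "C \<in> atlas NN" "\<gamma> x \<in> cdom C" using N.chart_at[OF gx] by (auto simp: C_def)
    have "openin (top_of_set {0..1}) {r \<in> topspace (top_of_set {0..1}). \<gamma> r \<in> cdom C}"
      by (rule openin_continuous_map_preimage[OF gc N.open_cdom[OF C(1)]])
    then obtain d where d: "d > 0" "\<forall>r\<in>{0..1}. dist r x < d \<longrightarrow> \<gamma> r \<in> cdom C"
      using local C(2) unfolding openin_euclidean_subtopology_iff by auto
    have "P a b" if ab: "a \<le> x" "x \<le> b" "b - a < d" for a b
      unfolding P_def
    proof (intro impI)
      assume 01: "0 \<le> a \<and> b \<le> 1"
      have sub: "\<gamma> ` {a..b} \<subseteq> cdom C" using d(2) ab 01 by (auto simp: dist_real_def abs_less_iff)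
      have le: "a \<le> b" using ab by simp
      show "\<exists>g\<in>borel_measurable borel. (\<forall>r. g r \<le> ennreal (speed NN \<gamma> r) * indicator {a..b} r) \<and>
        ennreal (dist (fst (\<gamma> a)) (fst (\<gamma> b))) \<le> (\<integral>\<^sup>+r. g r \<partial>lborel)"
        using 01 by (intro chord_le_local[OF C(1) le sub] gp[OF C(1) _ le _ sub]) auto
    qed
    then show ?case using d(1) by blast
  qed
  then obtain g where g: "\<And>r. g r \<le> ennreal (speed NN \<gamma> r) * indicator {0..1} r"
    "ennreal (dist (fst (\<gamma> 0)) (fst (\<gamma> 1))) \<le> (\<integral>\<^sup>+r. g r \<partial>lborel)"
    unfolding P_def by auto
  note g(2)
  also have "(\<integral>\<^sup>+r. g r \<partial>lborel) \<le> curve_length NN \<gamma>"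
    unfolding curve_length_def by (rule nn_integral_mono) (rule g(1))
  finally show ?thesis .
qed

text \<open>The projection of the curve to \<open>M\<close> has connected image, which either lies
  in \<open>Q\<close> or misses it.\<close>

lemma curve_in_clopen:
  assumes \<gamma>: "piecewise_C1_curve NN \<gamma>" and Q: "openin (mtop M) Q" "closedin (mtop M) Q"
    and one: "snd (\<gamma> 1) \<in> Q"
  shows "snd (\<gamma> 0) \<in> Q"
proof -
  have "continuous_map (top_of_set {0..1}) (mtop NN) \<gamma>" using \<gamma> by (simp add: piecewise_C1_curve_def)
  then have "continuous_map (top_of_set {0..1}) (mtop M) (snd \<circ> \<gamma>)"
    unfolding mtop_N by (rule continuous_map_compose) (rule continuous_map_snd)
  moreover have "connectedin (top_of_set {0..1}) {0..1::real}" by (simp add: connectedin_subtopology)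
  ultimately have "connectedin (mtop M) ((snd \<circ> \<gamma>) ` {0..1})" by (rule connectedin_continuous_map_image)
  from connectedin_clopen_cases[OF this Q(2,1)] show ?thesis
  proof
    assume "(snd \<circ> \<gamma>) ` {0..1} \<subseteq> Q"
    then show ?thesis by (auto simp: image_subset_iff)
  next
    assume "disjnt ((snd \<circ> \<gamma>) ` {0..1}) Q"
    moreover have "snd (\<gamma> 1) \<in> (snd \<circ> \<gamma>) ` {0..1}" by (rule image_eqI[of _ _ 1]) auto
    ultimately show ?thesis using one by (auto simp: disjnt_iff)
  qed
qed

lemma riemannian_dist_small:
  assumes "riemannian_dist NN p q < ennreal \<eta>"
  shows "dist (fst p) (fst q) < \<eta>"
    and "openin (mtop M) Q \<Longrightarrow> closedin (mtop M) Q \<Longrightarrow> snd q \<in> Q \<Longrightarrow> snd p \<in> Q"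
proof -
  obtain \<gamma> where \<gamma>: "piecewise_C1_curve NN \<gamma>" "\<gamma> 0 = p" "\<gamma> 1 = q" "curve_length NN \<gamma> < ennreal \<eta>"
    using assms unfolding riemannian_dist_def Inf_less_iff by auto
  have "ennreal (dist (fst p) (fst q)) < ennreal \<eta>"
    using chord_le_curve_length[OF \<gamma>(1)] \<gamma> by (simp add: order_le_less_trans)
  then show "dist (fst p) (fst q) < \<eta>" by (simp add: ennreal_less_iff)
  show "openin (mtop M) Q \<Longrightarrow> closedin (mtop M) Q \<Longrightarrow> snd q \<in> Q \<Longrightarrow> snd p \<in> Q"
    using curve_in_clopen[OF \<gamma>(1)] \<gamma> by auto
qed

text \<open>When \<open>M\<close> is disconnected, points over different components have distance \<open>\<infinity>\<close>, so every slice is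
  approached by nodal points over each clopen part \<open>Q\<close> of \<open>M\<close> separately.\<close>

lemma hausdorff_limit_nodal:
  fixes u :: "nat \<Rightarrow> complex \<times> 'a \<Rightarrow> real"
  assumes lim: "hausdorff_limit NN (\<lambda>i. {p \<in> points NN. u i p = 0}) (\<Theta> \<times> points M)"
    and \<Theta>: "\<Theta> \<subseteq> sphere 0 1" and \<delta>: "\<delta> > 0"
  defines "A \<equiv> {\<alpha>. cis \<alpha> \<in> \<Theta>}"
  shows "\<forall>\<^sub>F i in sequentially.
    (\<forall>\<theta>. \<forall>x\<in>points M. u i (cis \<theta>, x) = 0 \<longrightarrow> (\<exists>\<alpha>\<in>A. \<bar>\<theta> - \<alpha>\<bar> < \<delta>)) \<and>
    (\<forall>\<alpha>\<in>A. \<forall>Q. \<forall>x\<in>Q. openin (mtop M) Q \<longrightarrow> closedin (mtop M) Q \<longrightarrow>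
       (\<exists>\<theta>. \<exists>y\<in>Q. \<bar>\<theta> - \<alpha>\<bar> < \<delta> \<and> u i (cis \<theta>, y) = 0))"
proof -
  obtain \<eta> where \<eta>: "\<eta> > 0" "\<And>a b. dist (cis a) (cis b) < \<eta> \<Longrightarrow> \<exists>k::int. \<bar>a - (b + 2 * pi * k)\<bar> < \<delta>"
    using chord_small_imp_angle_small[OF \<delta>] by metis
  have per: "cis (b + 2 * pi * of_int k) = cis b" for b k
    using cis_eq_cis_iff[of "b + 2 * pi * of_int k" b] by blast
  have "\<forall>\<^sub>F i in sequentially. hausdorff_distance (riemannian_dist NN) {p \<in> points NN. u i p = 0} (\<Theta> \<times> points M) < ennreal \<eta>"
    using lim \<eta>(1) unfolding hausdorff_limit_def by (intro order_tendstoD) auto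
  then show ?thesis
  proof eventually_elim
    case (elim i)
    have h1: "\<exists>q\<in>\<Theta> \<times> points M. riemannian_dist NN p q < ennreal \<eta>" if "p \<in> points NN" "u i p = 0" for p
    proof -
      have "(INF q\<in>\<Theta> \<times> points M. riemannian_dist NN p q) \<le>
          (SUP p\<in>{p \<in> points NN. u i p = 0}. INF q\<in>\<Theta> \<times> points M. riemannian_dist NN p q)"
        using that by (intro SUP_upper) auto
      also have "\<dots> < ennreal \<eta>" using elim by (simp add: hausdorff_distance_def)
      finally show ?thesis by (simp add: INF_less_iff)
    qed
    have h2: "\<exists>p\<in>{p \<in> points NN. u i p = 0}. riemannian_dist NN p q < ennreal \<eta>" if "q \<in> \<Theta> \<times> points M" for q
    proof -
      have "(INF p\<in>{p \<in> points NN. u i p = 0}. riemannian_dist NN p q) \<le>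
          (SUP q\<in>\<Theta> \<times> points M. INF p\<in>{p \<in> points NN. u i p = 0}. riemannian_dist NN p q)"
        by (rule SUP_upper[OF that])
      also have "\<dots> < ennreal \<eta>" using elim by (simp add: hausdorff_distance_def)
      finally show ?thesis unfolding INF_less_iff .
    qed
    have "\<exists>\<alpha>\<in>A. \<bar>\<theta> - \<alpha>\<bar> < \<delta>" if x: "x \<in> points M" "u i (cis \<theta>, x) = 0" for \<theta> x
    proof -
      obtain q where q: "q \<in> \<Theta> \<times> points M" "riemannian_dist NN (cis \<theta>, x) q < ennreal \<eta>"
        using h1[of "(cis \<theta>, x)"] x by (auto simp: points_N)
      have d: "dist (cis \<theta>) (fst q) < \<eta>" using riemannian_dist_small(1)[OF q(2)] by simp
      have "norm (fst q) = 1" using q(1) \<Theta> by auto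
      then have "cis (Arg2pi (fst q)) = fst q" by (simp add: complex_norm_eq_1_exp cis_conv_exp)
      then obtain k :: int where k: "\<bar>\<theta> - (Arg2pi (fst q) + 2 * pi * k)\<bar> < \<delta>" "cis (Arg2pi (fst q) + 2 * pi * k) = fst q"
        using \<eta>(2)[of \<theta> "Arg2pi (fst q)"] d per by auto
      then show ?thesis using q(1) by (intro bexI[of _ "Arg2pi (fst q) + 2 * pi * k"]) (auto simp: A_def)
    qed
    moreover have "\<exists>\<theta>. \<exists>y\<in>Q. \<bar>\<theta> - \<alpha>\<bar> < \<delta> \<and> u i (cis \<theta>, y) = 0"
      if \<alpha>: "\<alpha> \<in> A" and Q: "x \<in> Q" "openin (mtop M) Q" "closedin (mtop M) Q" for \<alpha> Q x
    proof -
      have "x \<in> points M" using Q openin_subset by blast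
      then obtain p where p: "p \<in> points NN" "u i p = 0" "riemannian_dist NN p (cis \<alpha>, x) < ennreal \<eta>"
        using h2[of "(cis \<alpha>, x)"] \<alpha> by (auto simp: A_def)
      have y: "snd p \<in> Q" using riemannian_dist_small(2)[OF p(3) Q(2,3)] Q(1) by simp
      have d: "dist (fst p) (cis \<alpha>) < \<eta>" using riemannian_dist_small(1)[OF p(3)] by simp
      have "norm (fst p) = 1" using p(1) by (auto simp: points_N)
      then have c: "cis (Arg2pi (fst p)) = fst p" by (simp add: complex_norm_eq_1_exp cis_conv_exp)
      then obtain k :: int where k: "\<bar>Arg2pi (fst p) - (\<alpha> + 2 * pi * k)\<bar> < \<delta>"
        using \<eta>(2)[of "Arg2pi (fst p)" \<alpha>] d by auto
      have "cis (Arg2pi (fst p) + 2 * pi * of_int (- k)) = fst p" unfolding per by (rule c)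
      then show ?thesis using k y p(2)
        by (intro exI[of _ "Arg2pi (fst p) + 2 * pi * of_int (- k)"] bexI[of _ "snd p"]) (auto simp: algebra_simps)
    qed
    ultimately show ?case by blast
  qed
qed

end

section \<open>Alternation and equal spacing of the nodal slices\<close>

definition parity_sign :: "int \<Rightarrow> real" where
  "parity_sign k = (if even k then 1 else - 1)"

lemma parity_sign_simps: "parity_sign (k + 1) = - parity_sign k" "parity_sign 0 = 1"
  "parity_sign (k - 1) = - parity_sign k"
  "parity_sign k = 1 \<or> parity_sign k = - 1"
  by (auto simp: parity_sign_def)

text \<open>\<open>\<alpha>\<close> lists the lifts of the limit slices to the line in increasing
  order, so raising the index by \<open>m\<close> is one full turn. The second half of
  \<open>nodal\<close> speaks of every nonempty clopen \<open>Q\<close>, because zeros over one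
  component say nothing about another.\<close>

locale nodal_limit = allen_cahn_operator X I \<gamma> k w K
  for X :: "'a topology" and I :: "'a \<Rightarrow> 'i set" and \<gamma> k w K +
  fixes U :: "nat \<Rightarrow> real \<Rightarrow> 'a \<Rightarrow> real" and \<epsilon> :: "nat \<Rightarrow> real" and \<alpha> :: "int \<Rightarrow> real" and m :: nat
  assumes nonempty: "topspace X \<noteq> {}"
    and sol: "solution (\<epsilon> i) (U i)" and eps_pos: "\<epsilon> i > 0" and eps_lim: "\<epsilon> \<longlonglongrightarrow> 0"
    and periodic: "U i (\<theta> + 2 * pi) x = U i \<theta> x"
    and m: "m \<ge> 1" and \<alpha>_mono: "strict_mono \<alpha>" and \<alpha>_shift: "\<alpha> (j + int m) = \<alpha> j + 2 * pi"
    and nodal: "\<delta> > 0 \<Longrightarrow> \<forall>\<^sub>F i in sequentially.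
      (\<forall>\<theta>. \<forall>x\<in>topspace X. U i \<theta> x = 0 \<longrightarrow> (\<exists>j. \<bar>\<theta> - \<alpha> j\<bar> < \<delta>)) \<and>
      (\<forall>j. \<forall>Q. \<forall>x\<in>Q. openin X Q \<longrightarrow> closedin X Q \<longrightarrow> (\<exists>\<theta>. \<exists>y\<in>Q. \<bar>\<theta> - \<alpha> j\<bar> < \<delta> \<and> U i \<theta> y = 0))"
begin

definition good :: "real \<Rightarrow> nat \<Rightarrow> bool" where
  "good \<delta> i \<longleftrightarrow> (\<forall>\<theta>. \<forall>x\<in>topspace X. U i \<theta> x = 0 \<longrightarrow> (\<exists>j. \<bar>\<theta> - \<alpha> j\<bar> < \<delta>)) \<and>
      (\<forall>j. \<forall>Q. \<forall>x\<in>Q. openin X Q \<longrightarrow> closedin X Q \<longrightarrow> (\<exists>\<theta>. \<exists>y\<in>Q. \<bar>\<theta> - \<alpha> j\<bar> < \<delta> \<and> U i \<theta> y = 0))"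

lemma eventually_good: "\<delta> > 0 \<Longrightarrow> \<forall>\<^sub>F i in sequentially. good \<delta> i"
  unfolding good_def by (rule nodal)

text \<open>By the shift property every gap equals one of those with index in
  \<open>{0..<int m}\<close>, so there is a smallest gap and it is positive.\<close>

lemma gap_bound: obtains g where "g > 0" "\<And>j. \<alpha> j + g \<le> \<alpha> (j + 1)"
proof -
  define G where "G = (\<lambda>j. \<alpha> (j + 1) - \<alpha> j) ` {0..<int m}"
  have G: "finite G" "G \<noteq> {}" using m by (auto simp: G_def)
  have per: "\<alpha> (j + int m * q) = \<alpha> j + 2 * pi * q" for j q
  proof (induction q rule: int_induct[of _ 0])
    case (step1 q)
    have "\<alpha> (j + int m * (q + 1)) = \<alpha> (j + int m * q + int m)" by (simp add: algebra_simps)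
    then show ?case using step1(2) \<alpha>_shift[of "j + int m * q"] by (simp add: algebra_simps)
  next
    case (step2 q)
    have "\<alpha> (j + int m * (q - 1) + int m) = \<alpha> (j + int m * q)" by (simp add: algebra_simps)
    then show ?case using step2 \<alpha>_shift[of "j + int m * (q - 1)"] by (simp add: algebra_simps)
  qed simp
  have "\<alpha> (j + 1) - \<alpha> j \<in> G" for j
  proof -
    define r q where "r = j mod int m" and "q = j div int m"
    have j: "j = r + int m * q" by (simp add: r_def q_def)
    have "\<alpha> (j + 1) - \<alpha> j = \<alpha> (r + 1) - \<alpha> r"
      using per[of r q] per[of "r + 1" q] unfolding j by (simp add: algebra_simps)
    moreover have "r \<in> {0..<int m}" using m by (simp add: r_def)
    ultimately show ?thesis unfolding G_def by blast
  qed
  then have "Min G \<le> \<alpha> (j + 1) - \<alpha> j" for j using G by simp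
  moreover have "Min G > 0"
    using G \<alpha>_mono by (subst Min_gr_iff) (auto simp: G_def strict_mono_def)
  ultimately show thesis using that[of "Min G"] by (simp add: algebra_simps)
qed

definition mid :: "int \<Rightarrow> real" where "mid j = (\<alpha> j + \<alpha> (j + 1)) / 2"

lemma solution_continuous: "x \<in> topspace X \<Longrightarrow> continuous_on S (\<lambda>\<theta>. U i \<theta> x)"
  using continuous_in_line[of "U i" x] sol[of i] continuous_on_subset by (fastforce simp: solution_def)

lemma continuous_slice:
  assumes "continuous_map LX euclideanreal (\<lambda>(\<theta>, x). V \<theta> x)"
  shows "continuous_map X euclideanreal (V \<theta>)"
proof -
  have "continuous_map X LX (\<lambda>y. (\<theta>, y))" by (intro continuous_map_pairedI) auto
  from continuous_map_compose[OF this assms] show ?thesis by (simp add: comp_def)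
qed

lemma sgn_const_on_interval:
  fixes f :: "real \<Rightarrow> real"
  assumes "continuous_on {a..b} f" "\<And>s. s \<in> {a..b} \<Longrightarrow> f s \<noteq> 0" "s \<in> {a..b}" "t \<in> {a..b}" "f s > 0"
  shows "f t > 0"
proof (rule ccontr)
  assume "\<not> f t > 0"
  then have t: "f t < 0" using assms(2)[OF assms(4)] by simp
  have "connected (f ` {a..b})" using assms(1) by (intro connected_continuous_image) auto
  moreover have "f t \<in> f ` {a..b}" "f s \<in> f ` {a..b}" using assms by auto
  ultimately have "0 \<in> f ` {a..b}" using t assms(5) unfolding connected_iff_interval by (meson less_imp_le)
  then show False using assms(2) by auto
qed

lemma good_nonzero:
  assumes "good \<delta> i" "\<theta> \<in> {\<alpha> j + \<delta>..\<alpha> (j + 1) - \<delta>}" "x \<in> topspace X"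
  shows "U i \<theta> x \<noteq> 0"
proof
  assume "U i \<theta> x = 0"
  then obtain l where l: "\<bar>\<theta> - \<alpha> l\<bar> < \<delta>" using assms by (auto simp: good_def)
  have "\<alpha> l \<le> \<alpha> j \<or> \<alpha> (j + 1) \<le> \<alpha> l"
    using strict_mono_less_eq[OF \<alpha>_mono] by (metis add1_zle_eq not_le order_refl)
  then show False using l assms(2) by (auto simp: abs_less_iff)
qed

text \<open>With \<open>\<sigma>\<close> equal to \<open>1\<close> or \<open>-1\<close>, a statement
  proved for positive values covers the negative case as well.\<close>

definition signed :: "nat \<Rightarrow> real \<Rightarrow> real \<Rightarrow> 'a \<Rightarrow> real" where
  "signed i \<sigma> \<theta> x = \<sigma> * U i \<theta> x"

lemma solution_signed: "\<sigma> = 1 \<or> \<sigma> = -1 \<Longrightarrow> solution (\<epsilon> i) (signed i \<sigma>)"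
  using sol[of i] solution_uminus[OF sol, of i] by (auto simp: signed_def[abs_def])

context
  fixes \<delta> g :: real and i :: nat and \<sigma> :: real
  assumes g: "g > 0" "\<And>j. \<alpha> j + g \<le> \<alpha> (j + 1)" and \<delta>: "\<delta> > 0" "6 * \<delta> \<le> g" and good: "good \<delta> i"
    and \<sigma>: "\<sigma> = 1 \<or> \<sigma> = -1"
begin

abbreviation "V \<equiv> signed i \<sigma>"

lemma mid_in: "mid j \<in> {\<alpha> j + \<delta>..\<alpha> (j + 1) - \<delta>}"
  using g(2)[of j] \<delta> by (auto simp: mid_def field_simps)

lemma V_cont: "x \<in> topspace X \<Longrightarrow> continuous_on S (\<lambda>\<theta>. V \<theta> x)"
  unfolding signed_def by (intro continuous_intros solution_continuous)

lemma V_nonzero: "\<theta> \<in> {\<alpha> j + \<delta>..\<alpha> (j + 1) - \<delta>} \<Longrightarrow> x \<in> topspace X \<Longrightarrow> V \<theta> x \<noteq> 0"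
  using good_nonzero[OF good] \<sigma> by (auto simp: signed_def)

lemma V_pos:
  assumes "V s x > 0" "s \<in> {\<alpha> j + \<delta>..\<alpha> (j + 1) - \<delta>}" "t \<in> {\<alpha> j + \<delta>..\<alpha> (j + 1) - \<delta>}" "x \<in> topspace X"
  shows "V t x > 0"
  by (rule sgn_const_on_interval[OF V_cont V_nonzero assms(2,3,1)]) (use assms in auto)

text \<open>\<open>V\<close> has no zeros on the slice \<open>mid j\<close>, so \<open>> 0\<close>
  and \<open>\<ge> 0\<close> define the same set: open by the first description, closed by the
  second.\<close>

lemma clopen_pos: "openin X {x \<in> topspace X. V (mid j) x > 0}" "closedin X {x \<in> topspace X. V (mid j) x > 0}"
proof -
  have c: "continuous_map X euclideanreal (V (mid j))"
    using solution_signed[OF \<sigma>, of i] by (intro continuous_slice) (simp add: solution_def)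
  show "openin X {x \<in> topspace X. V (mid j) x > 0}"
    using openin_continuous_map_preimage[OF c, of "{0<..}"] by simp
  have "{x \<in> topspace X. V (mid j) x > 0} = {x \<in> topspace X. V (mid j) x \<in> {0..}}"
    using V_nonzero[OF mid_in] by (auto simp: less_le)
  then show "closedin X {x \<in> topspace X. V (mid j) x > 0}"
    using closedin_continuous_map_preimage[OF c, of "{0..}"] by simp
qed

text \<open>The contradiction arises at the right-most zero near \<open>\<alpha> j\<close> over \<open>Q\<close>, where \<open>positive_across\<close> applies.\<close>

lemma no_nonnegative_mirror:
  assumes Q: "openin X Q" "closedin X Q" "x0 \<in> Q" and pos: "\<And>x. x \<in> Q \<Longrightarrow> V (mid j) x > 0"
    and mirror: "\<And>c. c \<in> {\<alpha> j - \<delta>..\<alpha> j + \<delta>} \<Longrightarrow>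
      \<exists>r>0. c + r < \<alpha> (j + 1) - \<delta> \<and> (\<forall>x\<in>Q. V (c - r) x \<ge> 0)"
  shows False
proof -
  have QX: "Q \<subseteq> topspace X" using Q(1) openin_subset by blast
  have Vs: "solution (\<epsilon> i) V" by (rule solution_signed[OF \<sigma>])
  then have Vc: "continuous_map LX euclideanreal (\<lambda>(\<theta>, x). V \<theta> x)" by (simp add: solution_def)
  define S where "S = {\<alpha> j - \<delta>..\<alpha> j + \<delta>} \<times> Q"
  \<comment> \<open>The zeros over \<open>Q\<close> in the window around \<open>\<alpha> j\<close>:
    a compact set, nonempty by the second half of \<open>good\<close>, hence with a right-most
    point.\<close>
  define Z where "Z = S \<inter> {p \<in> topspace LX. (case p of (\<theta>, x) \<Rightarrow> V \<theta> x) \<in> {0}}"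
  have "closedin LX {p \<in> topspace LX. (case p of (\<theta>, x) \<Rightarrow> V \<theta> x) \<in> {0}}"
    by (rule closedin_continuous_map_preimage[OF Vc]) simp
  then have cZ: "compactin LX Z"
    unfolding Z_def S_def using compactin_slab[OF Q(2)] by (rule compact_Int_closedin[rotated])
  obtain \<theta> y where \<theta>: "\<bar>\<theta> - \<alpha> j\<bar> < \<delta>" "y \<in> Q" "U i \<theta> y = 0"
    using good Q unfolding good_def by blast
  then have "(\<theta>, y) \<in> Z" using QX by (auto simp: Z_def S_def signed_def abs_less_iff)
  then have ne: "Z \<noteq> {}" by blast
  have "continuous_map (subtopology LX Z) euclideanreal fst"
    by (intro continuous_map_from_subtopology continuous_map_fst)
  from compactin_attains_sup[OF cZ ne this] obtain p where p: "p \<in> Z" "\<forall>q\<in>Z. fst q \<le> fst p" by blast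
  define c where "c = fst p"
  have c: "c \<in> {\<alpha> j - \<delta>..\<alpha> j + \<delta>}" "snd p \<in> Q" "V c (snd p) = 0" using p(1) by (auto simp: Z_def S_def c_def)
  define B where "B = \<alpha> (j + 1) - \<delta>"
  \<comment> \<open>Inside the window a zero to the right of \<open>c\<close> contradicts the choice
    of \<open>c\<close>, and beyond the window \<open>good\<close> excludes zeros. So the sign on
    the slice \<open>mid j\<close> propagates down to \<open>c\<close>.\<close>
  have posB: "V \<theta> x > 0" if \<theta>: "c < \<theta>" "\<theta> \<le> B" and x: "x \<in> Q" for \<theta> x
  proof -
    have xX: "x \<in> topspace X" using x QX by blast
    show ?thesis
    proof (rule sgn_const_on_interval[where f = "\<lambda>\<theta>. V \<theta> x" and t = \<theta> and a = "min \<theta> (mid j)" and b = B and s = "mid j"])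
      show "continuous_on {min \<theta> (mid j)..B} (\<lambda>\<theta>. V \<theta> x)" by (rule V_cont[OF xX])
      show "V s x \<noteq> 0" if s: "s \<in> {min \<theta> (mid j)..B}" for s
      proof (cases "s \<le> \<alpha> j + \<delta>")
        case True
        show ?thesis
        proof
          assume "V s x = 0"
          moreover have "\<alpha> j + \<delta> < mid j" using g(2)[of j] \<delta> by (simp add: mid_def)
          then have "c < s" using s True \<theta> c(1) by (auto simp: min_def split: if_splits)
          ultimately have "(s, x) \<in> Z" using True c(1) x xX by (auto simp: Z_def S_def)
          then show False using p(2) \<open>c < s\<close> by (auto simp: c_def)
        qed
      next
        case False
        then show ?thesis using V_nonzero[of s j x] s xX by (auto simp: B_def)
      qed
    qed (use mid_in[of j] \<theta> pos[OF x] in \<open>auto simp: B_def\<close>)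
  qed
  obtain r where r: "r > 0" "c + r < B" "\<forall>x\<in>Q. V (c - r) x \<ge> 0" using mirror[OF c(1)] by (auto simp: B_def)
  have "V c (snd p) > 0"
  proof (rule positive_across[OF Vs eps_pos Q(1,2), where e = "c + r" and ?e2.0 = B])
    have "2 * c - (c + r) = c - r" by simp
    then show "0 \<le> V (2 * c - (c + r)) x" if "x \<in> Q" for x using r(3) that by simp
  qed (use r posB c in auto)
  then show False using c(3) by simp
qed

text \<open>If the sign did not change, \<open>V\<close> would be positive in both gaps over a
  clopen \<open>Q\<close>. A step of \<open>2 * \<delta>\<close> to the left from any point of the
  window lands in the left gap, at distance at least \<open>\<delta>\<close> from its ends, and
  contradicts \<open>no_nonnegative_mirror\<close>.\<close>

lemma alternate:
  assumes x: "x \<in> topspace X" and pos: "V (mid j) x > 0"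
  shows "V (mid (j - 1)) x < 0"
proof (rule ccontr)
  assume "\<not> V (mid (j - 1)) x < 0"
  then have pos': "V (mid (j - 1)) x > 0" using V_nonzero[OF mid_in, of x "j - 1"] x by simp
  define Q where "Q = {x \<in> topspace X. V (mid j) x > 0} \<inter> {x \<in> topspace X. V (mid (j - 1)) x > 0}"
  show False
  proof (rule no_nonnegative_mirror[of Q x j])
    show "openin X Q" "closedin X Q" unfolding Q_def using clopen_pos by blast+
    show "x \<in> Q" using x pos pos' by (simp add: Q_def)
    show "V (mid j) x > 0" if "x \<in> Q" for x using that by (simp add: Q_def)
    show "\<exists>r>0. c + r < \<alpha> (j + 1) - \<delta> \<and> (\<forall>x\<in>Q. V (c - r) x \<ge> 0)" if c: "c \<in> {\<alpha> j - \<delta>..\<alpha> j + \<delta>}" for c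
    proof (intro exI[of _ "2 * \<delta>"] conjI ballI)
      show "c + 2 * \<delta> < \<alpha> (j + 1) - \<delta>" using c g(2)[of j] \<delta> by auto
      fix x assume x: "x \<in> Q"
      have "c - 2 * \<delta> \<in> {\<alpha> (j - 1) + \<delta>..\<alpha> (j - 1 + 1) - \<delta>}" using c g(2)[of "j - 1"] \<delta> by auto
      then show "V (c - 2 * \<delta>) x \<ge> 0"
        using V_pos[OF _ mid_in, of "j - 1" x "c - 2 * \<delta>"] x by (auto simp: Q_def)
    qed (use \<delta> in simp)
  qed
qed

end

lemma sign_step:
  assumes "g > 0" "\<And>j. \<alpha> j + g \<le> \<alpha> (j + 1)" "\<delta> > 0" "6 * \<delta> \<le> g" "good \<delta> i" and x: "x \<in> topspace X"
  shows "sgn (U i (mid (j - 1)) x) = - sgn (U i (mid j) x)"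
proof -
  have "U i (mid j) x \<noteq> 0"
    using good_nonzero[OF assms(5) mid_in[OF assms(1-5), of 1] x] by simp
  then consider "U i (mid j) x > 0" | "U i (mid j) x < 0" by linarith
  then show ?thesis
  proof cases
    case 1
    then show ?thesis using alternate[OF assms(1-5), of 1 x j] x by (simp add: signed_def)
  next
    case 2
    then show ?thesis using alternate[OF assms(1-5), of "-1" x j] x by (simp add: signed_def)
  qed
qed

lemma sign_at:
  assumes "g > 0" "\<And>j. \<alpha> j + g \<le> \<alpha> (j + 1)" "\<delta> > 0" "6 * \<delta> \<le> g" "good \<delta> i" and x: "x \<in> topspace X"
  shows "sgn (U i (mid j) x) = parity_sign j * sgn (U i (mid 0) x)"
proof (induction j rule: int_induct[of _ 0])
  case (step1 j)
  then show ?case using sign_step[OF assms, of "j + 1"] by (simp add: parity_sign_simps)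
next
  case (step2 j)
  then show ?case using sign_step[OF assms, of j] by (simp add: parity_sign_simps)
qed (simp add: parity_sign_simps)

lemma good_exists:
  assumes "\<delta> > 0" obtains i where "good \<delta> i"
  using eventually_happens'[OF sequentially_bot eventually_good[OF assms]] by blast

lemma even_m: "even m"
proof -
  obtain g where g: "g > 0" "\<And>j. \<alpha> j + g \<le> \<alpha> (j + 1)" using gap_bound by metis
  define \<delta> where "\<delta> = g / 6"
  have \<delta>: "\<delta> > 0" "6 * \<delta> \<le> g" using g by (simp_all add: \<delta>_def)
  obtain i where i: "good \<delta> i" using good_exists[OF \<delta>(1)] .
  obtain x where x: "x \<in> topspace X" using nonempty by blast
  have "mid (int m) = mid 0 + 2 * pi"
    using \<alpha>_shift[of 0] \<alpha>_shift[of 1] by (simp add: mid_def add.commute field_simps)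
  then have "sgn (U i (mid 0) x) = parity_sign (int m) * sgn (U i (mid 0) x)"
    using sign_at[OF g \<delta> i x, of "int m"] periodic[of i "mid 0" x] by simp
  moreover have "U i (mid 0) x \<noteq> 0"
    using good_nonzero[OF i mid_in[OF g \<delta> i, of 1] x] by simp
  ultimately have "parity_sign (int m) = 1" by (simp add: sgn_zero_iff)
  then show ?thesis by (simp add: parity_sign_def split: if_splits)
qed

lemma gap_antimono: "\<alpha> (j + 1) - \<alpha> j \<le> \<alpha> j - \<alpha> (j - 1)"
proof (rule ccontr)
  assume "\<not> ?thesis"
  then have lt: "\<alpha> j - \<alpha> (j - 1) < \<alpha> (j + 1) - \<alpha> j" by simp
  obtain g where g: "g > 0" "\<And>j. \<alpha> j + g \<le> \<alpha> (j + 1)" using gap_bound by metis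
  \<comment> \<open>\<open>6 * \<delta>\<close> is also at most the excess of the right gap over the
    left one, so the slice \<open>c + r\<close> with the radius \<open>r\<close> chosen below stays
    left of \<open>\<alpha> (j + 1) - \<delta>\<close> for every \<open>c\<close> in the
    window.\<close>
  define \<delta> where "\<delta> = min g ((\<alpha> (j + 1) - \<alpha> j) - (\<alpha> j - \<alpha> (j - 1))) / 6"
  have \<delta>: "\<delta> > 0" "6 * \<delta> \<le> g" "6 * \<delta> \<le> (\<alpha> (j + 1) - \<alpha> j) - (\<alpha> j - \<alpha> (j - 1))"
    using g lt by (simp_all add: \<delta>_def)
  obtain i where i: "good \<delta> i" using good_exists[OF \<delta>(1)] .
  obtain x where x: "x \<in> topspace X" using nonempty by blast
  define \<sigma> where "\<sigma> = sgn (U i (mid j) x)"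
  have nz: "U i (mid j) x \<noteq> 0"
    using good_nonzero[OF i mid_in[OF g \<delta>(1,2) i, of 1] x] by simp
  then have \<sigma>: "\<sigma> = 1 \<or> \<sigma> = -1" by (auto simp: \<sigma>_def sgn_if)
  define V where "V = signed i \<sigma>"
  note loc = g \<delta>(1,2) i \<sigma>
  define Q where "Q = {x \<in> topspace X. V (mid j) x > 0}"
  show False
  proof (rule no_nonnegative_mirror[OF loc, of Q x j, folded V_def])
    show "openin X Q" "closedin X Q" unfolding Q_def V_def using clopen_pos[OF loc] by blast+
    show "x \<in> Q" using x nz by (auto simp: Q_def V_def signed_def \<sigma>_def sgn_if)
    show "V (mid j) x > 0" if "x \<in> Q" for x using that by (simp add: Q_def)
    show "\<exists>r>0. c + r < \<alpha> (j + 1) - \<delta> \<and> (\<forall>x\<in>Q. V (c - r) x \<ge> 0)" if c: "c \<in> {\<alpha> j - \<delta>..\<alpha> j + \<delta>}" for c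
    \<comment> \<open>This radius reflects to the slice \<open>\<alpha> (j - 1) - \<delta>\<close>,
      whatever \<open>c\<close> is: just past the left limit slice, where two sign changes have
      restored the sign.\<close>
    proof (intro exI[of _ "c - \<alpha> (j - 1) + \<delta>"] conjI ballI)
      show "0 < c - \<alpha> (j - 1) + \<delta>" using c g(1) g(2)[of "j - 1"] \<delta> by auto
      show "c + (c - \<alpha> (j - 1) + \<delta>) < \<alpha> (j + 1) - \<delta>" using c \<delta> by auto
      fix y assume y: "y \<in> Q"
      then have yX: "y \<in> topspace X" "V (mid j) y > 0" by (auto simp: Q_def)
      have "sgn (U i (mid (j - 1 - 1)) y) = sgn (U i (mid j) y)"
        using sign_step[OF g \<delta>(1,2) i yX(1), of j] sign_step[OF g \<delta>(1,2) i yX(1), of "j - 1"] by simp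
      then have p: "V (mid (j - 1 - 1)) y > 0"
        using yX(2) \<sigma> by (auto simp: V_def signed_def sgn_if split: if_splits)
      have "\<alpha> (j - 1) - \<delta> \<in> {\<alpha> (j - 1 - 1) + \<delta>..\<alpha> (j - 1 - 1 + 1) - \<delta>}"
        using g(2)[of "j - 1 - 1"] \<delta> by simp
      then have "V (\<alpha> (j - 1) - \<delta>) y > 0"
        unfolding V_def by (rule V_pos[OF loc p[unfolded V_def] mid_in[OF loc] _ yX(1)])
      then show "V (c - (c - \<alpha> (j - 1) + \<delta>)) y \<ge> 0" by (simp add: algebra_simps)
    qed
  qed
qed

lemma gap_eq: "\<alpha> (j + 1) = \<alpha> j + 2 * pi / m"
proof -
  define G where "G j = \<alpha> (j + 1) - \<alpha> j" for j
  have G1: "G (j + 1) \<le> G j" for j using gap_antimono[of "j + 1"] by (simp add: G_def)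
  have dec: "G (j + int n) \<le> G j" for j n
  proof (induction n)
    case (Suc n)
    have "G (j + int (Suc n)) = G (j + int n + 1)" by (simp add: algebra_simps)
    then show ?case using G1[of "j + int n"] Suc by linarith
  qed simp
  have per: "G (j + int m) = G j" for j
    using \<alpha>_shift[of j] \<alpha>_shift[of "j + 1"] by (simp add: G_def algebra_simps)
  have const: "G (j + int n) = G j" if "n \<le> m" for n
  proof -
    have "G (j + int m) = G (j + int n + int (m - n))" using that by (simp add: algebra_simps of_nat_diff)
    then have "G j \<le> G (j + int n)" using dec[of "j + int n" "m - n"] per[of j] by simp
    then show ?thesis using dec[of j n] by simp
  qed
  have sum: "\<alpha> (j + int n) = \<alpha> j + n * G j" if "n \<le> m" for n
    using that
  proof (induction n)
    case (Suc n)
    have "\<alpha> (j + int (Suc n)) = \<alpha> (j + int n + 1)" by (simp add: algebra_simps)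
    also have "\<dots> = \<alpha> (j + int n) + G (j + int n)" by (simp add: G_def)
    finally show ?case using Suc const[of n] by (simp add: algebra_simps)
  qed simp
  have "m * G j = 2 * pi" using sum[of m] \<alpha>_shift[of j] by simp
  then have "G j = 2 * pi / m" using m by (simp add: field_simps)
  then show ?thesis by (simp add: G_def)
qed

text \<open>It depends on \<open>x\<close> because different components of \<open>M\<close> may
  carry opposite signs. The quotient is continuous with values of modulus one; the default
  \<open>1\<close> makes it a sign function also for early indices \<open>i\<close>, when the
  reference slice may still contain zeros.\<close>

definition ref_sign :: "nat \<Rightarrow> 'a \<Rightarrow> real" where
  "ref_sign i x = (if \<forall>y\<in>topspace X. U i (mid 0) y \<noteq> 0 then U i (mid 0) x / \<bar>U i (mid 0) x\<bar> else 1)"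

lemma ref_sign_pm: "x \<in> topspace X \<Longrightarrow> ref_sign i x = 1 \<or> ref_sign i x = -1"
  by (auto simp: ref_sign_def abs_if)

lemma continuous_ref_sign: "continuous_map X euclideanreal (ref_sign i)"
proof (cases "\<forall>y\<in>topspace X. U i (mid 0) y \<noteq> 0")
  case True
  have "continuous_map X euclideanreal (U i (mid 0))"
    using sol[of i] by (intro continuous_slice) (simp add: solution_def)
  then have "continuous_map X euclideanreal (\<lambda>x. U i (mid 0) x / \<bar>U i (mid 0) x\<bar>)"
    using True by (intro continuous_map_real_divide continuous_map_real_abs) auto
  then show ?thesis using True by (simp add: ref_sign_def[abs_def])
next
  case False
  then have "ref_sign i = (\<lambda>x. 1)" by (auto simp: ref_sign_def fun_eq_iff)
  then show ?thesis by simp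
qed

lemma signed_limit:
  assumes ab: "\<alpha> j < a" "b < \<alpha> (j + 1)" and \<eta>: "\<eta> > 0"
  shows "\<forall>\<^sub>F i in sequentially. \<forall>\<theta>\<in>{a..b}. \<forall>x\<in>topspace X.
    \<bar>ref_sign i x * U i \<theta> x - parity_sign j\<bar> < \<eta>"
proof -
  obtain g where g: "g > 0" "\<And>j. \<alpha> j + g \<le> \<alpha> (j + 1)" using gap_bound by metis
  \<comment> \<open>\<open>{a..b}\<close> keeps distance \<open>2 * \<delta>\<close> from the two
    limit slices, so the barrier interval of length \<open>2 * \<delta>\<close> around any of its
    points stays in the zone free of zeros.\<close>
  define \<delta> where "\<delta> = min (g / 6) (min ((a - \<alpha> j) / 2) ((\<alpha> (j + 1) - b) / 2))"
  have \<delta>: "\<delta> > 0" "6 * \<delta> \<le> g" "\<alpha> j + 2 * \<delta> \<le> a" "b \<le> \<alpha> (j + 1) - 2 * \<delta>"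
    using g ab by (auto simp: \<delta>_def min_def field_simps)
  \<comment> \<open>The cap \<open>1 / 2\<close> keeps \<open>\<eta>'\<close> below
    \<open>1\<close>, as the barrier requires; taking half of \<open>\<eta>\<close> makes the final
    estimate strict.\<close>
  define \<eta>' where "\<eta>' = min (\<eta> / 2) (1 / 2)"
  have \<eta>': "0 < \<eta>'" "\<eta>' < 1" "\<eta>' < \<eta>" using \<eta> by (auto simp: \<eta>'_def)
  have neg: "0 < - w (1 - \<eta>') / (1 - \<eta>')"
    using w_ratio[of "1 - \<eta>'" 1] \<eta>' by (simp add: w_1)
  have "(\<lambda>i. (\<epsilon> i)\<^sup>2 * (pi / (2 * \<delta>))\<^sup>2) \<longlonglongrightarrow> 0\<^sup>2 * (pi / (2 * \<delta>))\<^sup>2"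
    by (intro tendsto_intros eps_lim)
  then have "\<forall>\<^sub>F i in sequentially. (\<epsilon> i)\<^sup>2 * (pi / (2 * \<delta>))\<^sup>2 < - w (1 - \<eta>') / (1 - \<eta>')"
    using neg by (intro order_tendstoD(2)) auto
  then show ?thesis
    using eventually_good[OF \<delta>(1)]
  proof eventually_elim
    case (elim i)
    show ?case
    proof (intro ballI)
      fix \<theta> x assume \<theta>: "\<theta> \<in> {a..b}" and x: "x \<in> topspace X"
      have nz: "U i (mid l) y \<noteq> 0" if "y \<in> topspace X" for y l
        using good_nonzero[OF elim(2) mid_in[OF g \<delta>(1,2) elim(2), of 1] that] by simp
      define \<sigma> where "\<sigma> = parity_sign j * ref_sign i x"
      have rs: "ref_sign i x = sgn (U i (mid 0) x)" using nz by (simp add: ref_sign_def sgn_if abs_if)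
      have \<sigma>: "\<sigma> = 1 \<or> \<sigma> = -1" using ref_sign_pm[OF x, of i] parity_sign_simps(4)[of j] by (auto simp: \<sigma>_def)
      have \<sigma>j: "\<sigma> = sgn (U i (mid j) x)" using sign_at[OF g \<delta>(1,2) elim(2) x, of j] by (simp add: \<sigma>_def rs)
      define V where "V = signed i \<sigma>"
      note loc = g \<delta>(1,2) elim(2) \<sigma>
      define Q where "Q = {x \<in> topspace X. V (mid j) x > 0}"
      have xQ: "x \<in> Q" using x nz[OF x, of j] by (auto simp: Q_def V_def signed_def \<sigma>j sgn_if)
      have "1 - \<eta>' \<le> V \<theta> x"
      proof (rule solution_barrier[where U = V and c = \<theta> and x = x and L = "2 * \<delta>" and Q = Q])
        show "solution (\<epsilon> i) V" unfolding V_def by (rule solution_signed[OF \<sigma>])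
        show "openin X Q" "closedin X Q" unfolding Q_def V_def using clopen_pos[OF loc] by blast+
        show "V t y > 0" if t: "t \<in> {\<theta> - 2 * \<delta> / 2..\<theta> + 2 * \<delta> / 2}" and y: "y \<in> Q" for t y
        proof -
          have "t \<in> {\<alpha> j + \<delta>..\<alpha> (j + 1) - \<delta>}" using t \<theta> \<delta> by auto
          then show ?thesis
            using V_pos[OF loc, of "mid j" y j t] mid_in[OF loc, of j] y by (auto simp: Q_def V_def)
        qed
      qed (use eps_pos \<eta>' \<delta> elim(1) xQ in auto)
      moreover have "V \<theta> x \<le> 1"
        using solution_signed[OF \<sigma>, of i] x by (auto simp: V_def solution_def abs_le_iff)
      ultimately have "\<bar>V \<theta> x - 1\<bar> < \<eta>" using \<eta>' by simp
      moreover have "\<bar>ref_sign i x * U i \<theta> x - parity_sign j\<bar> = \<bar>V \<theta> x - 1\<bar>"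
      proof -
        have ve: "V \<theta> x = parity_sign j * (ref_sign i x * U i \<theta> x)" by (simp add: V_def signed_def \<sigma>_def)
        have "\<bar>y - p\<bar> = \<bar>p * y - 1\<bar>" if "p = 1 \<or> p = - 1" for y p :: real
          using that by auto
        from this[OF parity_sign_simps(4)] show ?thesis unfolding ve .
      qed
      ultimately show "\<bar>ref_sign i x * U i \<theta> x - parity_sign j\<bar> < \<eta>" by simp
    qed
  qed
qed

end

section \<open>Lifting points of the circle to the line\<close>

lemma circle_enumeration:
  fixes \<Theta> :: "complex set"
  assumes fin: "finite \<Theta>" and \<Theta>: "\<Theta> \<subseteq> sphere 0 1" and m: "card \<Theta> = m" "m \<ge> 1"
  obtains \<alpha> :: "int \<Rightarrow> real" where "strict_mono \<alpha>" "\<And>j. \<alpha> (j + int m) = \<alpha> j + 2 * pi"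
    "range \<alpha> = {t. cis t \<in> \<Theta>}"
proof -
  have ca: "cis (Arg2pi z) = z" if "z \<in> \<Theta>" for z
    using that \<Theta> by (auto simp: complex_norm_eq_1_exp cis_conv_exp)
  define L where "L = sorted_list_of_set (Arg2pi ` \<Theta>)"
  have inj: "inj_on Arg2pi \<Theta>" by (metis ca inj_onI)
  have L: "length L = m" "set L = Arg2pi ` \<Theta>" "sorted_wrt (<) L"
    using fin m card_image[OF inj] by (auto simp: L_def)
  have Lr: "0 \<le> L ! i" "L ! i < 2 * pi" "cis (L ! i) \<in> \<Theta>" if "i < m" for i
  proof -
    have "L ! i \<in> Arg2pi ` \<Theta>" using that L by (metis nth_mem)
    then show "0 \<le> L ! i" "L ! i < 2 * pi" "cis (L ! i) \<in> \<Theta>" using ca Arg2pi by auto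
  qed
  have Lm: "L ! i < L ! j" if "i < j" "j < m" for i j
    using sorted_wrt_nth_less[OF L(3)] that L(1) by simp
  \<comment> \<open>The sorted angles of one period continued by full turns:
    \<open>j mod int m\<close> selects the angle and \<open>j div int m\<close> the turn, also for
    negative \<open>j\<close>.\<close>
  define \<alpha> where "\<alpha> j = L ! nat (j mod int m) + 2 * pi * of_int (j div int m)" for j
  have nm: "nat (j mod int m) < m" for j using m by (simp add: nat_less_iff)
  have per: "cis (b + 2 * pi * of_int k) = cis b" for b k
    using cis_eq_cis_iff[of "b + 2 * pi * of_int k" b] by blast
  have "strict_mono \<alpha>"
  proof (rule strict_monoI)
    fix i j :: int assume ij: "i < j"
    show "\<alpha> i < \<alpha> j"
    proof (cases "i div int m = j div int m")
      case True
      then have "i mod int m < j mod int m"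
        using ij by (smt (verit) mult_div_mod_eq)
      then have "nat (i mod int m) < nat (j mod int m)"
        using m by (subst nat_less_eq_zless) simp_all
      then show ?thesis using Lm nm True by (simp add: \<alpha>_def)
    next
      case False
      then have "i div int m + 1 \<le> j div int m" using zdiv_mono1[of i j "int m"] ij m by simp
      then have "of_int (i div int m) + 1 \<le> (of_int (j div int m) :: real)" by linarith
      then have "2 * pi * (of_int (i div int m) + 1) \<le> 2 * pi * of_int (j div int m)" by simp
      then show ?thesis using Lr(2)[OF nm, of i] Lr(1)[OF nm, of j] by (simp add: \<alpha>_def algebra_simps)
    qed
  qed
  moreover have "\<alpha> (j + int m) = \<alpha> j + 2 * pi" for j
    using m by (simp add: \<alpha>_def algebra_simps)
  moreover have "range \<alpha> = {t. cis t \<in> \<Theta>}"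
  proof (intro equalityI subsetI)
    fix t assume "t \<in> range \<alpha>"
    then show "t \<in> {t. cis t \<in> \<Theta>}" using Lr(3)[OF nm] by (auto simp: \<alpha>_def per)
  next
    fix t assume "t \<in> {t. cis t \<in> \<Theta>}"
    then have t: "cis t \<in> \<Theta>" by simp
    then have "Arg2pi (cis t) \<in> set L" using L(2) by simp
    then obtain i where i: "i < m" "L ! i = Arg2pi (cis t)" using L(1) by (metis in_set_conv_nth)
    then have "cis t = cis (L ! i)" using ca[OF t] by simp
    then obtain k :: int where k: "t = L ! i + 2 * pi * k" using cis_eq_cis_iff by blast
    have "\<alpha> (int i + int m * k) = t" using i(1) k by (simp add: \<alpha>_def)
    then show "t \<in> range \<alpha>" by blast
  qed
  ultimately show thesis using that by blast
qed

lemma openin_cis_image: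
  assumes "a < t" "t < b"
  obtains V where "openin (top_of_set (sphere 0 1)) V" "cis t \<in> V" "V \<subseteq> cis ` {a<..<b}"
proof -
  define J where "J = {a<..<b} \<inter> {t - pi<..<t + pi}"
  have J: "J \<subseteq> cimage (angle_chart (t - pi))" by (auto simp: J_def cimage_angle_chart)
  have "param (angle_chart (t - pi)) ` J = cis ` J"
    by (rule image_cong[OF refl]) (auto simp: J_def intro!: param_angle_chart)
  moreover have "openin (top_of_set (sphere 0 1)) (param (angle_chart (t - pi)) ` J)"
    by (rule chart_facts(8)[OF is_chart_angle_chart J]) (auto simp: J_def)
  moreover have "t \<in> J" using assms pi_gt_zero by (simp add: J_def)
  then have "cis t \<in> cis ` J" by (rule imageI)
  moreover have "cis ` J \<subseteq> cis ` {a<..<b}" by (rule image_mono) (auto simp: J_def)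
  ultimately show thesis using that[of "cis ` J"] by simp
qed

text \<open>The shift property makes \<open>\<alpha>\<close> unbounded in both directions, so among
  the indices between two explicit bounds there is a largest \<open>j\<close> with
  \<open>\<alpha> j < t\<close>.\<close>

lemma strict_mono_int_between:
  fixes \<alpha> :: "int \<Rightarrow> real"
  assumes mono: "strict_mono \<alpha>" and shift: "\<And>j. \<alpha> (j + int m) = \<alpha> j + 2 * pi"
    and t: "t \<notin> range \<alpha>"
  obtains j where "\<alpha> j < t" "t < \<alpha> (j + 1)"
proof -
  have up: "\<alpha> (int m * int n) = \<alpha> 0 + 2 * pi * n" for n
  proof (induction n)
    case (Suc n)
    have "\<alpha> (int m * int (Suc n)) = \<alpha> (int m * int n + int m)" by (simp add: algebra_simps)
    then show ?case using Suc shift[of "int m * int n"] by (simp add: algebra_simps)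
  qed simp
  have down: "\<alpha> (- (int m * int n)) = \<alpha> 0 - 2 * pi * n" for n
  proof (induction n)
    case (Suc n)
    have "\<alpha> (- (int m * int (Suc n)) + int m) = \<alpha> (- (int m * int n))" by (simp add: algebra_simps)
    then show ?case using Suc shift[of "- (int m * int (Suc n))"] by (simp add: algebra_simps)
  qed simp
  obtain n1 :: nat where "(t - \<alpha> 0) / (2 * pi) < n1" using reals_Archimedean2 by blast
  then have hi: "t < \<alpha> (int m * int n1)" using up[of n1] by (simp add: field_simps)
  obtain n2 :: nat where "(\<alpha> 0 - t) / (2 * pi) < n2" using reals_Archimedean2 by blast
  then have lo: "\<alpha> (- (int m * int n2)) < t" using down[of n2] by (simp add: field_simps)
  define S where "S = {j. - (int m * int n2) \<le> j \<and> j \<le> int m * int n1 \<and> \<alpha> j < t}"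
  have "S \<subseteq> {- (int m * int n2)..int m * int n1}" by (auto simp: S_def)
  then have fS: "finite S" using finite_subset by blast
  have "- (int m * int n2) < int m * int n1"
    using lo hi strict_mono_less[OF mono] by (meson order_less_trans)
  then have "- (int m * int n2) \<in> S" using lo by (simp add: S_def)
  then have M: "Max S \<in> S" using fS Max_in by blast
  define j where "j = Max S"
  have j: "\<alpha> j < t" "- (int m * int n2) \<le> j" using M by (auto simp: j_def S_def)
  have "j < int m * int n1" using j(1) hi strict_mono_less[OF mono] by (meson order_less_trans)
  then have "\<not> \<alpha> (j + 1) < t" using Max_ge[OF fS, of "j + 1"] j(2) by (force simp: S_def j_def)
  moreover have "\<alpha> (j + 1) \<noteq> t" using t by auto
  ultimately show thesis using that[of j] j(1) by simp
qed

section \<open>Descent from the line to the circle\<close>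

theorem theorem1p1:
  fixes M :: "('a, 'e::euclidean_space) rmanifold"
    and N :: "(complex \<times> 'a, real \<times> 'e) rmanifold"
    and W :: "real \<Rightarrow> real"
    and \<epsilon> :: "nat \<Rightarrow> real"
    and u :: "nat \<Rightarrow> complex \<times> 'a \<Rightarrow> real"
    and m :: nat
    and \<theta> :: "nat \<Rightarrow> complex"
    and \<Sigma> :: "(complex \<times> 'a) set"
  assumes M: "closed_riemannian_manifold M"
    and N: "N = riemannian_product unit_circle M"
    and W: "double_well W"
    and eps_pos: "\<And>i. \<epsilon> i > 0"
    and eps_decr: "decseq \<epsilon>"
    and eps_lim: "\<epsilon> \<longlonglongrightarrow> 0"
    and u: "\<And>i. phase_transition N W (\<epsilon> i) (u i)"
    and m: "m \<ge> 1"
    and theta_circle: "\<And>j. j \<in> {1..m} \<Longrightarrow> \<theta> j \<in> points unit_circle"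
    and theta_distinct: "inj_on \<theta> {1..m}"
    and Sigma: "\<Sigma> = \<theta> ` {1..m} \<times> points M"
    and limit: "hausdorff_limit N (\<lambda>i. {p \<in> points N. u i p = 0}) \<Sigma>"
  shows "(\<exists>\<sigma> s.
            sign_function (subtopology (mtop N) (points N - \<Sigma>)) \<sigma> \<and>
            (\<forall>j\<in>{1..m}. changes_sign_across (\<theta> j) (points M) \<sigma>) \<and>
            (\<forall>i. sign_function (mtop M) (s i)) \<and>
            locally_uniform_limit (subtopology (mtop N) (points N - \<Sigma>))
              (\<lambda>i p. s i (snd p) * u i p) \<sigma>)
         \<and> even m
         \<and> (\<lambda>(z, x). (cis (2 * pi / real m) * z, x)) ` \<Sigma> = \<Sigma>"
proof -
  have "closed_riemannian M"
    using M by (unfold_locales) (auto simp: closed_riemannian_manifold_def riemannian_manifold_def)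
  then interpret circle_product M by (simp add: circle_product_def)
  obtain K where K: "K \<ge> 0" "\<forall>s t. \<bar>s\<bar> \<le> 1 \<longrightarrow> \<bar>t\<bar> \<le> 1 \<longrightarrow> \<bar>deriv W s - deriv W t\<bar> \<le> K * \<bar>s - t\<bar>"
    using double_well_deriv(5)[OF W] by blast
  interpret A: allen_cahn_operator "mtop M" frame line drift "deriv W" K
    by unfold_locales (use double_well_deriv[OF W] K in auto)
  define \<Theta> where "\<Theta> = \<theta> ` {1..m}"
  have \<Theta>: "finite \<Theta>" "\<Theta> \<subseteq> sphere 0 1" "card \<Theta> = m"
    using theta_circle card_image[OF theta_distinct] by (auto simp: \<Theta>_def unit_circle_def)
  obtain \<alpha> where \<alpha>: "strict_mono \<alpha>" "\<And>j. \<alpha> (j + int m) = \<alpha> j + 2 * pi" "range \<alpha> = {t. cis t \<in> \<Theta>}"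
    using circle_enumeration[OF \<Theta> m] by metis
  have smooth: "smooth_function NN (u i)" for i using u[of i] by (simp add: phase_transition_def N)
  have per: "cis (t + 2 * pi) = cis t" for t by (simp add: cis_mult[symmetric])
  have cM: "points M \<noteq> {}"
    using M by (auto simp: closed_riemannian_manifold_def riemannian_manifold_def)
  interpret B: nodal_limit "mtop M" frame line drift "deriv W" K "\<lambda>i t x. u i (cis t, x)" \<epsilon> \<alpha> m
  proof unfold_locales
    show "A.solution (\<epsilon> i) (\<lambda>t x. u i (cis t, x))" for i
      unfolding A.solution_def
    proof (intro conjI allI ballI)
      show "continuous_map (prod_topology euclideanreal (mtop M)) euclideanreal (\<lambda>(t, x). u i (cis t, x))"
        by (rule continuous_map_lift[OF smooth])
      fix t x assume x: "x \<in> points M"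
      then have "u i (cis t, x) \<in> {-1..1}" using u[of i] by (auto simp: phase_transition_def N points_N)
      then show "\<bar>u i (cis t, x)\<bar> \<le> 1" by (auto simp: abs_le_iff)
      show "L.has_lapl (\<lambda>t x. u i (cis t, x)) t x (deriv W (u i (cis t, x)) / (\<epsilon> i)\<^sup>2)"
        using u[of i] by (intro phase_transition_has_lapl[OF double_well_deriv(1)[OF W] eps_pos _ x]) (simp add: N)
    qed
    fix \<delta> :: real assume \<delta>: "\<delta> > 0"
    have "hausdorff_limit NN (\<lambda>i. {p \<in> points NN. u i p = 0}) (\<Theta> \<times> points M)"
      using limit by (simp add: N Sigma \<Theta>_def)
    from hausdorff_limit_nodal[OF this \<Theta>(2) \<delta>]
    show "\<forall>\<^sub>F i in sequentially.
      (\<forall>t. \<forall>x\<in>points M. u i (cis t, x) = 0 \<longrightarrow> (\<exists>j. \<bar>t - \<alpha> j\<bar> < \<delta>)) \<and>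
      (\<forall>j. \<forall>Q. \<forall>x\<in>Q. openin (mtop M) Q \<longrightarrow> closedin (mtop M) Q \<longrightarrow>
         (\<exists>t. \<exists>y\<in>Q. \<bar>t - \<alpha> j\<bar> < \<delta> \<and> u i (cis t, y) = 0))"
      unfolding \<alpha>(3)[symmetric] by simp
  qed (use cM eps_pos eps_lim per m \<alpha> in auto)
  have even: "even m" by (rule B.even_m)
  have mult: "\<alpha> (j + int m * q) = \<alpha> j + 2 * pi * q" for j q
  proof (induction q rule: int_induct[of _ 0])
    case (step1 q)
    have "\<alpha> (j + int m * (q + 1)) = \<alpha> (j + int m * q + int m)" by (simp add: algebra_simps)
    then show ?case using step1(2) \<alpha>(2)[of "j + int m * q"] by (simp add: algebra_simps)
  next
    case (step2 q)
    have "\<alpha> (j + int m * (q - 1) + int m) = \<alpha> (j + int m * q)" by (simp add: algebra_simps)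
    then show ?case using step2 \<alpha>(2)[of "j + int m * (q - 1)"] by (simp add: algebra_simps)
  qed simp
  \<comment> \<open>The index of the gap containing a lift of \<open>fst p\<close> is determined
    only up to multiples of \<open>m\<close>, and \<open>SOME\<close> picks any representative. Its
    parity is well defined because \<open>m\<close> is even. The values on \<open>\<Sigma>\<close>
    are irrelevant.\<close>
  define \<sigma> :: "complex \<times> 'a \<Rightarrow> real" where
    "\<sigma> p = parity_sign (SOME j. \<exists>t. cis t = fst p \<and> \<alpha> j < t \<and> t < \<alpha> (j + 1))" for p
  have \<sigma>: "\<sigma> (cis t, x) = parity_sign j" if t: "\<alpha> j < t" "t < \<alpha> (j + 1)" for j t x
  proof -
    define l where "l = (SOME j. \<exists>t'. cis t' = cis t \<and> \<alpha> j < t' \<and> t' < \<alpha> (j + 1))"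
    have "\<exists>t'. cis t' = cis t \<and> \<alpha> l < t' \<and> t' < \<alpha> (l + 1)"
      unfolding l_def by (rule someI[of _ j]) (use t in blast)
    then obtain t' where t': "cis t' = cis t" "\<alpha> l < t'" "t' < \<alpha> (l + 1)" by blast
    obtain q :: int where q: "t' = t + 2 * pi * q" using t'(1) cis_eq_cis_iff by blast
    have "\<alpha> (j + int m * q) < t'" "t' < \<alpha> (j + int m * q + 1)"
      using t mult[of j q] mult[of "j + 1" q] by (simp_all add: q algebra_simps)
    then have "\<alpha> (j + int m * q) < \<alpha> (l + 1)" "\<alpha> l < \<alpha> (j + int m * q + 1)" using t' by linarith+
    then have "j + int m * q < l + 1" "l < j + int m * q + 1" using strict_mono_less[OF \<alpha>(1)] by blast+
    then have "l = j + int m * q" by simp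
    then have "parity_sign l = parity_sign j" using even by (simp add: parity_sign_def)
    then show ?thesis by (simp add: \<sigma>_def l_def)
  qed
  have off: "\<exists>t j. p = (cis t, snd p) \<and> snd p \<in> points M \<and> \<alpha> j < t \<and> t < \<alpha> (j + 1)" if p: "p \<in> points N - \<Sigma>" for p
  proof -
    have p': "fst p \<in> sphere 0 1" "snd p \<in> points M" "fst p \<notin> \<Theta>"
      using p by (auto simp: N points_N Sigma \<Theta>_def mem_Times_iff)
    define t where "t = Arg2pi (fst p)"
    have t: "cis t = fst p" using p'(1) by (simp add: t_def complex_norm_eq_1_exp cis_conv_exp)
    then have "t \<notin> range \<alpha>" unfolding \<alpha>(3) using p'(3) by simp
    then obtain j where "\<alpha> j < t" "t < \<alpha> (j + 1)" using strict_mono_int_between[OF \<alpha>(1,2)] by metis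
    then show ?thesis using t p'(2) by (metis prod.collapse)
  qed
  let ?X = "subtopology (mtop N) (points N - \<Sigma>)"
  have tX: "topspace ?X = points N - \<Sigma>" by auto
  have nb: "\<exists>V. openin ?X V \<and> p \<in> V \<and> (\<forall>q\<in>V. \<sigma> q = \<sigma> p) \<and> uniform_limit V (\<lambda>i p. B.ref_sign i (snd p) * u i p) \<sigma> sequentially"
    if p: "p \<in> points N - \<Sigma>" for p
  proof -
    obtain t j where t: "p = (cis t, snd p)" "snd p \<in> points M" "\<alpha> j < t" "t < \<alpha> (j + 1)"
      using off[OF p] by blast
    \<comment> \<open>Halfway to the two neighbouring limit slices: a closed interval around
      \<open>t\<close> inside the gap, as \<open>signed_limit\<close> asks.\<close>
    define a b where "a = (\<alpha> j + t) / 2" and "b = (t + \<alpha> (j + 1)) / 2"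
    have ab: "\<alpha> j < a" "a < t" "t < b" "b < \<alpha> (j + 1)" using t by (auto simp: a_def b_def)
    obtain V where V: "openin (top_of_set (sphere 0 1)) V" "cis t \<in> V" "V \<subseteq> cis ` {a<..<b}"
      using openin_cis_image[OF ab(2,3)] by metis
    define Y where "Y = V \<times> points M"
    have "openin (mtop N) Y" unfolding N mtop_N Y_def using V(1) by (simp add: openin_prod_Times_iff)
    moreover have Yq: "\<exists>r. q = (cis r, snd q) \<and> r \<in> {a..b} \<and> snd q \<in> points M" if q: "q \<in> Y" for q
    proof -
      have "fst q \<in> V" "snd q \<in> points M" using q by (auto simp: Y_def)
      then obtain r where "fst q = cis r" "a < r" "r < b" using V(3) by auto
      then show ?thesis using \<open>snd q \<in> points M\<close> by (intro exI[of _ r]) (auto simp: prod_eq_iff)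
    qed
    have Y\<sigma>: "\<sigma> q = parity_sign j" if q: "q \<in> Y" for q
    proof -
      obtain r where r: "q = (cis r, snd q)" "r \<in> {a..b}" using Yq[OF q] by blast
      have "\<sigma> (cis r, snd q) = parity_sign j" by (rule \<sigma>) (use r ab in auto)
      then show ?thesis using r(1) by simp
    qed
    moreover have "Y \<subseteq> points N - \<Sigma>"
    proof
      fix q assume q: "q \<in> Y"
      obtain r where r: "q = (cis r, snd q)" "r \<in> {a..b}" "snd q \<in> points M" using Yq[OF q] by blast
      have "r \<notin> range \<alpha>"
      proof
        assume "r \<in> range \<alpha>"
        then obtain l where "r = \<alpha> l" by blast
        then have "\<alpha> j < \<alpha> l" "\<alpha> l < \<alpha> (j + 1)" using r(2) ab by auto
        then have "j < l" "l < j + 1" using strict_mono_less[OF \<alpha>(1)] by blast+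
        then show False by simp
      qed
      then have "cis r \<notin> \<Theta>" unfolding \<alpha>(3) by simp
      then show "q \<in> points N - \<Sigma>"
        using r(1,3) by (metis (no_types, lifting) DiffI N Sigma \<Theta>_def cis_sphere mem_Sigma_iff points_N)
    qed
    ultimately have op: "openin ?X Y" by (simp add: openin_subtopology_alt image_iff) (metis inf.absorb2 inf_commute)
    have pY: "p \<in> Y" using t(1,2) V(2) by (metis Y_def mem_Sigma_iff)
    have "uniform_limit Y (\<lambda>i p. B.ref_sign i (snd p) * u i p) \<sigma> sequentially"
      unfolding uniform_limit_iff
    proof (intro allI impI)
      fix \<eta> :: real assume "\<eta> > 0"
      from B.signed_limit[OF ab(1,4) this]
      show "\<forall>\<^sub>F i in sequentially. \<forall>q\<in>Y. dist (B.ref_sign i (snd q) * u i q) (\<sigma> q) < \<eta>"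
      proof eventually_elim
        case (elim i)
        show ?case
        proof
          fix q assume q: "q \<in> Y"
          obtain r where r: "q = (cis r, snd q)" "r \<in> {a..b}" "snd q \<in> points M" using Yq[OF q] by blast
          have "\<bar>B.ref_sign i (snd q) * u i (cis r, snd q) - parity_sign j\<bar> < \<eta>" using elim r by blast
          then show "dist (B.ref_sign i (snd q) * u i q) (\<sigma> q) < \<eta>"
            unfolding dist_real_def Y\<sigma>[OF q] using r(1) by simp
        qed
      qed
    qed
    moreover have "\<forall>q\<in>Y. \<sigma> q = \<sigma> p" using Y\<sigma> pY by simp
    ultimately show ?thesis using op pY by blast
  qed
  have "continuous_map ?X euclideanreal \<sigma>"
    unfolding continuous_map_def
  proof (intro conjI allI impI)
    fix S :: "real set"
    show "openin ?X {p \<in> topspace ?X. \<sigma> p \<in> S}"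
    proof (subst openin_subopen, intro ballI)
      fix p assume p: "p \<in> {p \<in> topspace ?X. \<sigma> p \<in> S}"
      obtain V where V: "openin ?X V" "p \<in> V" "\<forall>q\<in>V. \<sigma> q = \<sigma> p" using nb[of p] p unfolding tX by blast
      have "\<sigma> p \<in> S" using p by blast
      then have "V \<subseteq> {p \<in> topspace ?X. \<sigma> p \<in> S}" using V(3) openin_subset[OF V(1)] by fastforce
      then show "\<exists>T. openin ?X T \<and> p \<in> T \<and> T \<subseteq> {p \<in> topspace ?X. \<sigma> p \<in> S}" using V by blast
    qed
  qed simp
  then have s1: "sign_function ?X \<sigma>"
    unfolding sign_function_def by (simp add: \<sigma>_def parity_sign_def)
  have s2: "changes_sign_across (\<theta> j) (points M) \<sigma>" if j: "j \<in> {1..m}" for j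
  proof -
    \<comment> \<open>A move by less than the lower bound \<open>g\<close> on the gaps leads from
      \<open>\<alpha> l\<close> into the gap \<open>l\<close> or the gap \<open>l - 1\<close>, whose
      parities differ.\<close>
    obtain g where g: "g > 0" "\<And>l. \<alpha> l + g \<le> \<alpha> (l + 1)" using B.gap_bound by metis
    have "norm (\<theta> j) = 1" using theta_circle[OF j] by (simp add: unit_circle_def)
    then have "cis (Arg2pi (\<theta> j)) = \<theta> j" by (simp add: complex_norm_eq_1_exp cis_conv_exp)
    moreover have "\<theta> j \<in> \<Theta>" using j by (simp add: \<Theta>_def)
    ultimately have "Arg2pi (\<theta> j) \<in> range \<alpha>" unfolding \<alpha>(3) by simp
    then obtain l where l: "\<theta> j = cis (\<alpha> l)" using \<open>cis (Arg2pi (\<theta> j)) = \<theta> j\<close> by (metis rangeE)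
    show ?thesis
      unfolding changes_sign_across_def
    proof (intro ballI exI[of _ g] conjI allI impI)
      fix x t assume t: "0 < t \<and> t < g"
      have "\<theta> j * cis t = cis (\<alpha> l + t)" "\<theta> j * cis (- t) = cis (\<alpha> l - t)" by (simp_all add: l cis_mult)
      moreover have "\<sigma> (cis (\<alpha> l + t), x) = parity_sign l" by (rule \<sigma>) (use t g(2)[of l] in auto)
      moreover have "\<sigma> (cis (\<alpha> l - t), x) = parity_sign (l - 1)"
        by (rule \<sigma>) (use t g(2)[of "l - 1"] in auto)
      ultimately show "\<sigma> (\<theta> j * cis t, x) = - \<sigma> (\<theta> j * cis (- t), x)" by (simp add: parity_sign_simps)
    qed (rule g(1))
  qed
  have s3: "sign_function (mtop M) (B.ref_sign i)" for i
    unfolding sign_function_def using B.continuous_ref_sign B.ref_sign_pm by blast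
  have s4: "locally_uniform_limit ?X (\<lambda>i p. B.ref_sign i (snd p) * u i p) \<sigma>"
    unfolding locally_uniform_limit_def tX using nb by blast
  have rot: "(\<lambda>z. cis (2 * pi / real m) * z) ` \<Theta> = \<Theta>"
  proof -
    have c: "\<exists>l. z = cis (\<alpha> l)" if "z \<in> \<Theta>" for z
    proof -
      have "cis (Arg2pi z) = z" using that \<Theta>(2) by (auto simp: complex_norm_eq_1_exp cis_conv_exp)
      then have "Arg2pi z \<in> range \<alpha>" unfolding \<alpha>(3) using that by simp
      then show ?thesis using \<open>cis (Arg2pi z) = z\<close> by (metis rangeE)
    qed
    have c': "cis (\<alpha> l) \<in> \<Theta>" for l using \<alpha>(3) by blast
    \<comment> \<open>Since all gaps equal \<open>2 * pi / m\<close>, the rotation is the shift of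
      the index by one on the lifted slices.\<close>
    have r: "cis (2 * pi / real m) * cis (\<alpha> l) = cis (\<alpha> (l + 1))" for l
      using B.gap_eq[of l] by (simp add: cis_mult add.commute)
    show ?thesis
    proof (intro equalityI subsetI)
      fix z assume "z \<in> (\<lambda>z. cis (2 * pi / real m) * z) ` \<Theta>"
      then show "z \<in> \<Theta>" using c c' r by (metis imageE)
    next
      fix z assume "z \<in> \<Theta>"
      then obtain l where l: "z = cis (\<alpha> l)" using c by blast
      have "z = cis (2 * pi / real m) * cis (\<alpha> (l - 1))" using r[of "l - 1"] l by simp
      then show "z \<in> (\<lambda>z. cis (2 * pi / real m) * z) ` \<Theta>" using c' by blast
    qed
  qed
  have "(\<lambda>(z, x). (cis (2 * pi / real m) * z, x)) ` \<Sigma> = ((\<lambda>z. cis (2 * pi / real m) * z) ` \<Theta>) \<times> points M"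
    unfolding Sigma \<Theta>_def[symmetric] by force
  then have "(\<lambda>(z, x). (cis (2 * pi / real m) * z, x)) ` \<Sigma> = \<Sigma>"
    unfolding rot by (simp add: Sigma \<Theta>_def)
  then show ?thesis using s1 s2 s3 s4 even by blast
qed

end
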